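(* Let $n\ge 1$ and $\alpha=\tfrac{2n-1}{2}$. As a module for the joint action of $\mathfrak{spo}(2n|1)$ and $\mathfrak{k}'\cong\mathfrak{gl}(1|1)$, $$\mathrm{S}(E)^{\mathfrak{n}'^{+}}=\mathrm{V}^{2n|1}_{(0_n)}\otimes \mathrm{V}^{1|1}_{(\alpha,-\alpha)}\ \oplus\ \mathrm{V}^{2n|1}_{(0_n)}\otimes \mathrm{V}^{1|1}_{(1+\alpha,\,2n-\alpha)}\ \oplus\ \bigoplus_{d=0}^{\infty}\bigoplus_{k=1}^{n}\Big(\mathrm{V}^{2n|1}_{(d+1,1_{k-1},0_{n-k})}\otimes \mathrm{V}^{1|1}_{(d+1+\alpha,\,k-1-\alpha)}\ \oplus\ \mathrm{V}^{2n|1}_{(d+1,1_{k-1},0_{n-k})}\otimes \mathrm{V}^{1|1}_{(d+1+\alpha,\,2n-k-\alpha)}\Big),$$ where $\mathrm{V}^{2n|1}_{\lambda}$ is the irreducible $\mathfrak{spo}(2n|1)$-module of highest weight $\lambda$ and $\mathrm{V}^{1|1}_{(a,b)}$ is the irreducible $\mathfrak{gl}(1|1)$-module of highest weight $(a,b)$.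
   Context: Everything is over $\mathbb{C}$. $V=\mathbb{C}^{2n|1}$ has even basis vectors $u_1,\dots,u_{2n}$, odd basis vector $u_{2n+1}$, and bilinear form $B$ with $B(u_i,u_{2n+1-i})=1=-B(u_{2n+1-i},u_i)$ for $1\le i\le n$, $B(u_{2n+1},u_{2n+1})=1$, all other pairings of basis vectors zero. $\mathfrak{spo}(2n|1)\subset\mathfrak{gl}(2n|1)$ is spanned by homogeneous $X$ with $B(Xv,w)+(-1)^{|X||v|}B(v,Xw)=0$. With $\mathrm{E}_{i,j}$ the matrix units, its Cartan subalgebra is spanned by $\mathrm{E}_{i,i}-\mathrm{E}_{2n+1-i,2n+1-i}$, $1\le i\le n$, and a weight $(\lambda_1,\dots,\lambda_n)$ lists the eigenvalues of these elements. The Borel subalgebra $\mathfrak{b}^{\mathrm{spo}}$ has even part the upper triangular matrices in $\mathfrak{sp}(2n)$ and odd part $\bigoplus_{k=1}^n\mathbb{C}(\mathrm{E}_{k,2n+1}+\mathrm{E}_{2n+1,2n+1-k})$; highest weights are with respect to it. $0_a$, $1_a$ denote $(0,\dots,0)$, $(1,\dots,1)$ of length $a$. $X'=\mathbb{C}^{1|1}$ has even basis vector $v_1$ and odd basis vector $w_1$; $E=V\otimes X'$ has even basis $x_i=u_i\otimes v_1$ ($1\le i\le 2n$), $x_{2n+1}=u_{2n+1}\otimes w_1$ and odd basis $\eta_i=u_i\otimes w_1$ ($1\le i\le 2n$), $\eta_{2n+1}=u_{2n+1}\otimes v_1$. $\mathrm{S}(E)=\mathbb{C}[x_1,\dots,x_{2n+1}]\otimes\Lambda(\eta_1,\dots,\eta_{2n+1})$;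 $\mathfrak{spo}(2n|1)$ acts on $E$ by $X(v\otimes v')=Xv\otimes v'$ and on $\mathrm{S}(E)$ by superderivations. $\mathfrak{k}'\cong\mathfrak{gl}(1|1)$ is the span of the operators $F_{1,1}=\sum_{i=1}^{2n}x_i\partial_{x_i}+\eta_{2n+1}\partial_{\eta_{2n+1}}+\frac{2n-1}{2}$, $F_{2,2}=\sum_{i=1}^{2n}\eta_i\partial_{\eta_i}+x_{2n+1}\partial_{x_{2n+1}}-\frac{2n-1}{2}$, $F_{2,1}=x_{2n+1}\partial_{\eta_{2n+1}}-\sum_{i=1}^{2n}\eta_i\partial_{x_i}$, $F_{1,2}=\eta_{2n+1}\partial_{x_{2n+1}}-\sum_{i=1}^{2n}x_i\partial_{\eta_i}$ on $\mathrm{S}(E)$. A $\mathfrak{gl}(1|1)$-highest weight vector of weight $(a,b)$ is killed by $F_{1,2}$ and has $F_{1,1}$- and $F_{2,2}$-eigenvalues $a$ and $b$. $\mathfrak{n}'^{+}=\mathrm{span}\{D_{12},D_{22}\}$ with $D_{12}=\partial_{x_{2n+1}}\partial_{\eta_{2n+1}}+\sum_{i=1}^n(\partial_{x_i}\partial_{\eta_{2n+1-i}}-\partial_{x_{2n+1-i}}\partial_{\eta_i})$, $D_{22}=\partial_{x_{2n+1}}^2+2\sum_{i=1}^n\partial_{\eta_i}\partial_{\eta_{2n+1-i}}$, and $\mathrm{S}(E)^{\mathfrak{n}'^{+}}=\{p\in\mathrm{S}(E): D_{12}p=D_{22}p=0\}$. Irreducible highest weight modules are considered up to parity shift, and $\otimes$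 is the outer tensor product. *)

theory Defs
  imports Complex_Main "HOL-Library.Function_Algebras"
begin

section \<open>Superspaces and matrix Lie superalgebras\<close>

text \<open>
  All vector spaces are subspaces of spaces of functions \<open>'a \<Rightarrow> complex\<close>, with the pointwise
  additive structure of \<^theory>\<open>HOL-Library.Function_Algebras\<close> and the following scaling.
\<close>

definition fscale :: "complex \<Rightarrow> ('a \<Rightarrow> complex) \<Rightarrow> ('a \<Rightarrow> complex)"  (infixr \<open>\<odot>\<close> 75)
  where "c \<odot> f = (\<lambda>s. c * f s)"

global_interpretation fs: vector_space "fscale :: complex \<Rightarrow> ('a \<Rightarrow> complex) \<Rightarrow> _"
  by unfold_locales (auto simp: fscale_def fun_eq_iff algebra_simps)

definition linear_on :: "('a \<Rightarrow> complex) set \<Rightarrow> (('a \<Rightarrow> complex) \<Rightarrow> ('b \<Rightarrow> complex)) \<Rightarrow> bool"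
  where "linear_on U f \<longleftrightarrow>
    (\<forall>u\<in>U. \<forall>v\<in>U. f (u + v) = f u + f v) \<and> (\<forall>c. \<forall>u\<in>U. f (c \<odot> u) = c \<odot> f u)"

definition is_direct_sum :: "('a \<Rightarrow> complex) set \<Rightarrow> 'i set \<Rightarrow> ('i \<Rightarrow> ('a \<Rightarrow> complex) set) \<Rightarrow> bool"
  where "is_direct_sum U I W \<longleftrightarrow>
    (\<forall>i\<in>I. fs.subspace (W i)) \<and>
    U = fs.span (\<Union>i\<in>I. W i) \<and>
    (\<forall>J w. finite J \<longrightarrow> J \<subseteq> I \<longrightarrow> (\<forall>i\<in>J. w i \<in> W i) \<longrightarrow> (\<Sum>i\<in>J. w i) = 0 \<longrightarrow> (\<forall>i\<in>J. w i = 0))"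

text \<open>
  A parity is a truth value, with \<open>True\<close> standing for odd; the sum of the parities \<open>p\<close> and \<open>q\<close>
  is \<open>p \<noteq> q\<close>.
\<close>

type_synonym parity = bool

definition koszul :: "parity \<Rightarrow> parity \<Rightarrow> complex"
  where "koszul p q = (if p \<and> q then -1 else 1)"

text \<open>Matrix entries are indexed from 1; entries outside the index range are 0.\<close>

type_synonym cmat = "nat \<times> nat \<Rightarrow> complex"

definition gl :: "nat \<Rightarrow> cmat set"
  where "gl N = {X. \<forall>i j. X (i, j) \<noteq> 0 \<longrightarrow> i \<in> {1..N} \<and> j \<in> {1..N}}"

definition mat_unit :: "nat \<Rightarrow> nat \<Rightarrow> cmat"
  where "mat_unit i j = (\<lambda>s. if s = (i, j) then 1 else 0)"

definition mat_mul :: "nat \<Rightarrow> cmat \<Rightarrow> cmat \<Rightarrow> cmat"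
  where "mat_mul N X Y = (\<lambda>(i, k). \<Sum>j=1..N. X (i, j) * Y (j, k))"

text \<open>Here and below \<open>par i\<close> is the parity of the \<open>i\<close>-th basis vector of the defining module.\<close>

definition homogeneous :: "(nat \<Rightarrow> parity) \<Rightarrow> parity \<Rightarrow> cmat \<Rightarrow> bool"
  where "homogeneous par p X \<longleftrightarrow> (\<forall>i j. X (i, j) \<noteq> 0 \<longrightarrow> (par i \<noteq> par j) = p)"

definition supercomm :: "nat \<Rightarrow> parity \<Rightarrow> parity \<Rightarrow> cmat \<Rightarrow> cmat \<Rightarrow> cmat"
  where "supercomm N p q X Y = mat_mul N X Y - koszul p q \<odot> mat_mul N Y X"

record 'a smodule =
  part :: "parity \<Rightarrow> ('a \<Rightarrow> complex) set"
  act :: "cmat \<Rightarrow> ('a \<Rightarrow> complex) \<Rightarrow> ('a \<Rightarrow> complex)"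

definition scarrier :: "'a smodule \<Rightarrow> ('a \<Rightarrow> complex) set"
  where "scarrier M = {u + v | u v. u \<in> part M False \<and> v \<in> part M True}"

definition is_smodule :: "cmat set \<Rightarrow> (nat \<Rightarrow> parity) \<Rightarrow> nat \<Rightarrow> 'a smodule \<Rightarrow> bool"
  where "is_smodule g par N M \<longleftrightarrow>
    (\<forall>p. fs.subspace (part M p)) \<and>
    part M False \<inter> part M True = {0} \<and>
    (\<forall>X\<in>g. linear_on (scarrier M) (act M X)) \<and>
    (\<forall>v\<in>scarrier M. linear_on g (\<lambda>X. act M X v)) \<and>
    (\<forall>p q. \<forall>X\<in>g. homogeneous par p X \<longrightarrow> (\<forall>v\<in>part M q. act M X v \<in> part M (p \<noteq> q))) \<and>
    (\<forall>p q. \<forall>X\<in>g. \<forall>Y\<in>g. homogeneous par p X \<longrightarrow> homogeneous par q Y \<longrightarrow>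
      (\<forall>v\<in>scarrier M. act M (supercomm N p q X Y) v
          = act M X (act M Y v) - koszul p q \<odot> act M Y (act M X v)))"

definition is_subsmodule :: "cmat set \<Rightarrow> 'a smodule \<Rightarrow> ('a \<Rightarrow> complex) set \<Rightarrow> bool"
  where "is_subsmodule g M U \<longleftrightarrow>
    fs.subspace U \<and>
    U = {u + v | u v. u \<in> U \<inter> part M False \<and> v \<in> U \<inter> part M True} \<and>
    (\<forall>X\<in>g. \<forall>u\<in>U. act M X u \<in> U)"

definition is_irreducible :: "cmat set \<Rightarrow> (nat \<Rightarrow> parity) \<Rightarrow> nat \<Rightarrow> 'a smodule \<Rightarrow> bool"
  where "is_irreducible g par N M \<longleftrightarrow>
    is_smodule g par N M \<and> scarrier M \<noteq> {0} \<and>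
    (\<forall>U. is_subsmodule g M U \<longrightarrow> U = {0} \<or> U = scarrier M)"


section \<open>The Lie superalgebra spo(2n|1) and its irreducible highest weight modules\<close>

definition spo_par :: "nat \<Rightarrow> nat \<Rightarrow> parity"
  where "spo_par n i \<longleftrightarrow> i = 2*n+1"

definition V_part :: "nat \<Rightarrow> parity \<Rightarrow> (nat \<Rightarrow> complex) set"
  where "V_part n p = {v. \<forall>i. v i \<noteq> 0 \<longrightarrow> i \<in> {1..2*n+1} \<and> spo_par n i = p}"

definition V_space :: "nat \<Rightarrow> (nat \<Rightarrow> complex) set"
  where "V_space n = {v. \<forall>i. v i \<noteq> 0 \<longrightarrow> i \<in> {1..2*n+1}}"

definition B_basis :: "nat \<Rightarrow> nat \<Rightarrow> nat \<Rightarrow> complex"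
  where "B_basis n i j =
    (if i \<in> {1..n} \<and> j = 2*n+1-i then 1
     else if j \<in> {1..n} \<and> i = 2*n+1-j then -1
     else if i = 2*n+1 \<and> j = 2*n+1 then 1
     else 0)"

definition Bform :: "nat \<Rightarrow> (nat \<Rightarrow> complex) \<Rightarrow> (nat \<Rightarrow> complex) \<Rightarrow> complex"
  where "Bform n v w = (\<Sum>i=1..2*n+1. \<Sum>j=1..2*n+1. v i * w j * B_basis n i j)"

definition mat_app :: "nat \<Rightarrow> cmat \<Rightarrow> (nat \<Rightarrow> complex) \<Rightarrow> (nat \<Rightarrow> complex)"
  where "mat_app N X v = (\<lambda>i. \<Sum>j=1..N. X (i, j) * v j)"

definition spo_part :: "nat \<Rightarrow> parity \<Rightarrow> cmat set"
  where "spo_part n p = {X \<in> gl (2*n+1). homogeneous (spo_par n) p X \<and>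
    (\<forall>q. \<forall>v\<in>V_part n q. \<forall>w\<in>V_space n.
      Bform n (mat_app (2*n+1) X v) w + koszul p q * Bform n v (mat_app (2*n+1) X w) = 0)}"

definition spo :: "nat \<Rightarrow> cmat set"
  where "spo n = fs.span (\<Union>p. spo_part n p)"

definition spo_cartan :: "nat \<Rightarrow> nat \<Rightarrow> cmat"
  where "spo_cartan n i = mat_unit i i - mat_unit (2*n+1-i) (2*n+1-i)"

text \<open>The even part of spo(2n|1) is sp(2n): an even element has zero last row and column.\<close>

definition spo_borel :: "nat \<Rightarrow> cmat set"
  where "spo_borel n = fs.span
    ({X \<in> spo_part n False. \<forall>i j. X (i, j) \<noteq> 0 \<longrightarrow> i \<le> j} \<union>
     {mat_unit k (2*n+1) + mat_unit (2*n+1) (2*n+1-k) | k. k \<in> {1..n}})"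

text \<open>The nilradical of the Borel subalgebra (its elements with zero diagonal); highest weight vectors are the weight vectors it kills.\<close>

definition spo_nilrad :: "nat \<Rightarrow> cmat set"
  where "spo_nilrad n = {X \<in> spo_borel n. \<forall>i. X (i, i) = 0}"

text \<open>The weight \<open>wt\<close> is the list of its \<open>n\<close> coordinates.\<close>

definition spo_hw_vector :: "nat \<Rightarrow> complex list \<Rightarrow> 'a smodule \<Rightarrow> ('a \<Rightarrow> complex) \<Rightarrow> bool"
  where "spo_hw_vector n wt M v \<longleftrightarrow>
    length wt = n \<and> v \<noteq> 0 \<and> v \<in> part M False \<union> part M True \<and>
    (\<forall>i\<in>{1..n}. act M (spo_cartan n i) v = (wt ! (i-1)) \<odot> v) \<and>
    (\<forall>X\<in>spo_nilrad n. act M X v = 0)"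

text \<open>
  The highest weight vector may be even or odd, so this describes the irreducible highest weight
  module of highest weight \<open>wt\<close> up to isomorphism and parity shift.
\<close>

definition is_V_spo :: "nat \<Rightarrow> complex list \<Rightarrow> 'a smodule \<Rightarrow> bool"
  where "is_V_spo n wt M \<longleftrightarrow>
    is_irreducible (spo n) (spo_par n) (2*n+1) M \<and> (\<exists>v. spo_hw_vector n wt M v)"


section \<open>The Lie superalgebra gl(1|1) and its irreducible highest weight modules\<close>

definition gl11_par :: "nat \<Rightarrow> parity"
  where "gl11_par i \<longleftrightarrow> i = 2"

definition gl11_hw_vector :: "complex \<times> complex \<Rightarrow> 'a smodule \<Rightarrow> ('a \<Rightarrow> complex) \<Rightarrow> bool"
  where "gl11_hw_vector \<mu> M v \<longleftrightarrow>
    v \<noteq> 0 \<and> v \<in> part M False \<union> part M True \<and>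
    act M (mat_unit 1 1) v = fst \<mu> \<odot> v \<and>
    act M (mat_unit 2 2) v = snd \<mu> \<odot> v \<and>
    act M (mat_unit 1 2) v = 0"

definition is_V_gl11 :: "complex \<times> complex \<Rightarrow> 'a smodule \<Rightarrow> bool"
  where "is_V_gl11 \<mu> M \<longleftrightarrow>
    is_irreducible (gl 2) gl11_par 2 M \<and> (\<exists>v. gl11_hw_vector \<mu> M v)"


section \<open>The supersymmetric algebra S(E)\<close>

text \<open>
  \<open>(m, A)\<close> is the monomial \<open>\<Prod>i. x\<^sub>i ^ m i\<close> times the product of the \<open>\<eta>\<^sub>i\<close> with \<open>i \<in> A\<close>,
  taken in increasing order of \<open>i\<close>; an element of S(E) is its function of coefficients.
\<close>

type_synonym smono = "(nat \<Rightarrow> nat) \<times> nat set"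
type_synonym spoly = "smono \<Rightarrow> complex"

definition SE :: "nat \<Rightarrow> spoly set"
  where "SE n = {f. finite {s. f s \<noteq> 0} \<and>
    (\<forall>m A. f (m, A) \<noteq> 0 \<longrightarrow> {i. m i \<noteq> 0} \<subseteq> {1..2*n+1} \<and> A \<subseteq> {1..2*n+1})}"

definition SE_part :: "nat \<Rightarrow> parity \<Rightarrow> spoly set"
  where "SE_part n p = {f \<in> SE n. \<forall>m A. f (m, A) \<noteq> 0 \<longrightarrow> odd (card A) = p}"

text \<open>\<open>GX i\<close> and \<open>GH i\<close> stand for the generators \<open>x\<^sub>i\<close> and \<open>\<eta>\<^sub>i\<close>.\<close>

datatype gen = GX nat | GH nat

fun gpar :: "gen \<Rightarrow> parity"
  where "gpar (GX i) = False" | "gpar (GH i) = True"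

definition hsign :: "nat \<Rightarrow> nat set \<Rightarrow> complex"
  where "hsign i A = (-1) ^ card {j \<in> A. j < i}"

text \<open>Left multiplication by a generator.\<close>

fun gmul :: "gen \<Rightarrow> spoly \<Rightarrow> spoly"
  where
    "gmul (GX i) f = (\<lambda>(m, A). if m i = 0 then 0 else f (m(i := m i - 1), A))"
  | "gmul (GH i) f = (\<lambda>(m, A). if i \<in> A then hsign i A * f (m, A - {i}) else 0)"

text \<open>Partial derivatives (left derivatives for the odd generators).\<close>

fun gder :: "gen \<Rightarrow> spoly \<Rightarrow> spoly"
  where
    "gder (GX i) f = (\<lambda>(m, A). of_nat (m i + 1) * f (m(i := m i + 1), A))"
  | "gder (GH i) f = (\<lambda>(m, A). if i \<in> A then 0 else hsign i A * f (m, insert i A))"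

definition SE_one :: spoly
  where "SE_one = (\<lambda>s. if s = (\<lambda>_. 0, {}) then 1 else 0)"

text \<open>The generators \<open>u\<^sub>i \<otimes> v\<^sub>1\<close> and \<open>u\<^sub>i \<otimes> w\<^sub>1\<close>.\<close>

definition gv :: "nat \<Rightarrow> nat \<Rightarrow> gen"
  where "gv n i = (if i \<le> 2*n then GX i else GH i)"

definition gw :: "nat \<Rightarrow> nat \<Rightarrow> gen"
  where "gw n i = (if i \<le> 2*n then GH i else GX i)"

text \<open>
  The superderivation extending the linear map \<open>v \<otimes> v' \<mapsto> X v \<otimes> v'\<close> of E, written as the sum
  over the basis vectors \<open>e\<close> of E of the image of \<open>e\<close> times \<open>\<partial>\<^sub>e\<close>.
  The lemmas below confirm that for homogeneous \<open>X\<close> this is the superderivation in question.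
\<close>

definition spo_act :: "nat \<Rightarrow> cmat \<Rightarrow> spoly \<Rightarrow> spoly"
  where "spo_act n X f = (\<Sum>i=1..2*n+1. \<Sum>j=1..2*n+1.
    X (i, j) \<odot> (gmul (gv n i) (gder (gv n j) f) + gmul (gw n i) (gder (gw n j) f)))"

lemma hsign_remove: "hsign i (A - {j}) = (if j \<in> A \<and> j < i then - hsign i A else hsign i A)"
proof (cases "j \<in> A \<and> j < i")
  case True
  then have "{k \<in> A. k < i} = insert j {k \<in> A - {j}. k < i}" by auto
  moreover have "finite {k \<in> A - {j}. k < i}" by simp
  ultimately have "card {k \<in> A. k < i} = Suc (card {k \<in> A - {j}. k < i})" by simp
  then show ?thesis using True by (simp add: hsign_def)
next
  case False
  then have "{k \<in> A - {j}. k < i} = {k \<in> A. k < i}" by auto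
  then show ?thesis using False by (simp add: hsign_def)
qed

lemma hsign_insert: "hsign i (insert j A) = (if j \<notin> A \<and> j < i then - hsign i A else hsign i A)"
  using hsign_remove[of i "insert j A" j] hsign_remove[of i A j]
  by (cases "j \<in> A") (auto simp: insert_absorb split: if_splits)

lemma hsign_square [simp]: "hsign i A * hsign i A = 1"
  by (simp add: hsign_def flip: power_mult_distrib)

lemma hsign_square' [simp]: "hsign i A * (hsign i A * c) = c"
  by (simp flip: mult.assoc)

lemma gmul_gmul: "gmul e (gmul e' f) = koszul (gpar e) (gpar e') \<odot> gmul e' (gmul e f)"
proof (cases e; cases e')
  fix i j assume "e = GX i" "e' = GX j"
  then show ?thesis
    by (cases "i = j") (auto simp: fun_eq_iff fscale_def koszul_def fun_upd_twist)
next
  fix i j assume e: "e = GH i" "e' = GH j"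
  have *: "A - {i} - {j} = A - {j} - {i}" for A by blast
  show ?thesis using e
    by (cases i j rule: linorder_cases)
       (auto simp: fun_eq_iff fscale_def koszul_def hsign_remove *)
qed (auto simp: fun_eq_iff fscale_def koszul_def)

lemma gder_gmul:
  "gder e (gmul e' f) = (if e = e' then f else 0) + koszul (gpar e) (gpar e') \<odot> gmul e' (gder e f)"
proof (cases e; cases e')
  fix i j assume e: "e = GX i" "e' = GX j"
  have "gder (GX i) (gmul (GX i) f) = f + gmul (GX i) (gder (GX i) f)"
    by (auto simp: fun_eq_iff algebra_simps)
  moreover have "gder (GX i) (gmul (GX j) f) = gmul (GX j) (gder (GX i) f)" if "i \<noteq> j"
    using that by (auto simp: fun_eq_iff fun_upd_twist)
  ultimately show ?thesis using e by (auto simp: koszul_def fscale_def)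
next
  fix i j assume e: "e = GH i" "e' = GH j"
  have *: "hsign i (insert i A) = hsign i A" "hsign i (A - {i}) = hsign i A" for A
    by (simp_all add: hsign_remove hsign_insert)
  have "gder (GH i) (gmul (GH i) f) = f - gmul (GH i) (gder (GH i) f)"
    by (auto simp: fun_eq_iff * insert_absorb)
  moreover have "gder (GH i) (gmul (GH j) f) = - gmul (GH j) (gder (GH i) f)" if "i \<noteq> j"
  proof -
    have *: "insert i A - {j} = insert i (A - {j})" for A using that by blast
    show ?thesis using that
      by (cases i j rule: linorder_cases)
         (auto simp: fun_eq_iff hsign_remove hsign_insert *)
  qed
  ultimately show ?thesis using e
    by (cases "i = j") (simp_all add: koszul_def fs.scale_minus_left del: gder.simps gmul.simps)
qed (auto simp: fun_eq_iff fscale_def koszul_def)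

lemma gmul_linear:
  "gmul e (f + g) = gmul e f + gmul e g" "gmul e (c \<odot> f) = c \<odot> gmul e f" "gmul e 0 = 0"
  by (cases e; auto simp: fun_eq_iff fscale_def algebra_simps)+

lemma gmul_sum: "gmul e (\<Sum>i\<in>I. f i) = (\<Sum>i\<in>I. gmul e (f i))"
proof (induction I rule: infinite_finite_induct)
  case (insert i I)
  then show ?case by (simp only: sum.insert gmul_linear not_False_eq_True)
qed (simp_all only: sum.infinite sum.empty gmul_linear not_False_eq_True)

lemma gder_one: "gder e SE_one = 0"
  by (cases e) (auto simp: SE_one_def fun_eq_iff zero_fun_def dest: fun_cong)

lemma spo_act_one: "spo_act n X SE_one = 0"
  by (simp add: spo_act_def gder_one gmul_linear fs.scale_zero_right)

lemma gv_gw_simps: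
  "gv n i = gv n j \<longleftrightarrow> i = j" "gw n i = gw n j \<longleftrightarrow> i = j"
  "i \<in> {1..2*n+1} \<Longrightarrow> j \<in> {1..2*n+1} \<Longrightarrow> gv n i \<noteq> gw n j"
  "i \<in> {1..2*n+1} \<Longrightarrow> j \<in> {1..2*n+1} \<Longrightarrow> gw n i \<noteq> gv n j"
  "i \<in> {1..2*n+1} \<Longrightarrow> gpar (gv n i) = spo_par n i"
  "i \<in> {1..2*n+1} \<Longrightarrow> gpar (gw n i) = (\<not> spo_par n i)"
  by (auto simp: gv_def gw_def spo_par_def)

text \<open>The super Leibniz rule for a product with a generator, in the first factor.\<close>

lemma gmul_gder_leibniz:
  "gmul a (gder b (gmul e f)) =
    (if b = e then gmul a f else 0) + koszul (gpar a \<noteq> gpar b) (gpar e) \<odot> gmul e (gmul a (gder b f))"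
proof -
  have k: "koszul (gpar a \<noteq> gpar b) (gpar e) = koszul (gpar b) (gpar e) * koszul (gpar a) (gpar e)"
    by (simp add: koszul_def)
  have "gmul a (gder b (gmul e f)) = gmul a (if b = e then f else 0)
      + koszul (gpar b) (gpar e) \<odot> gmul a (gmul e (gder b f))"
    by (simp only: gder_gmul gmul_linear)
  also have "gmul a (gmul e (gder b f)) = koszul (gpar a) (gpar e) \<odot> gmul e (gmul a (gder b f))"
    by (rule gmul_gmul)
  finally show ?thesis
    by (simp only: k fs.scale_scale gmul_linear if_distrib[of "gmul a"])
qed

lemma spo_act_leibniz_aux:
  assumes X: "homogeneous (spo_par n) p X"
    and e: "e = gv n k \<or> e = gw n k" and k: "k \<in> {1..2*n+1}"
  shows "spo_act n X (gmul e f) =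
    (\<Sum>i=1..2*n+1. X (i, k) \<odot> gmul (if e = gv n k then gv n i else gw n i) f)
    + koszul p (gpar e) \<odot> gmul e (spo_act n X f)"
proof -
  have "X (i, j) \<odot> (gmul (gv n i) (gder (gv n j) (gmul e f)) + gmul (gw n i) (gder (gw n j) (gmul e f)))
      = (if j = k then X (i, k) \<odot> gmul (if e = gv n k then gv n i else gw n i) f else 0)
        + koszul p (gpar e) \<odot> gmul e
           (X (i, j) \<odot> (gmul (gv n i) (gder (gv n j) f) + gmul (gw n i) (gder (gw n j) f)))"
    if i: "i \<in> {1..2*n+1}" and j: "j \<in> {1..2*n+1}" for i j
  proof (cases "X (i, j) = 0")
    case True
    then show ?thesis by (auto simp: gmul_linear fs.scale_zero_right)
  next
    case False
    then have p: "(spo_par n i \<noteq> spo_par n j) = p"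
      using X by (auto simp: homogeneous_def)
    then have p': "((\<not> spo_par n i) \<noteq> (\<not> spo_par n j)) = p" by auto
    have ne: "gv n k \<noteq> gw n k" using k by (simp add: gv_gw_simps)
    have par: "(gpar (gv n i) \<noteq> gpar (gv n j)) = p" "(gpar (gw n i) \<noteq> gpar (gw n j)) = p"
      using i j p by (simp_all add: gv_gw_simps)
    have eq: "gv n j = e \<longleftrightarrow> j = k \<and> e = gv n k" "gw n j = e \<longleftrightarrow> j = k \<and> e = gw n k"
      using e j k by (auto simp: gv_gw_simps)
    show ?thesis
      unfolding gmul_gder_leibniz par eq using e ne
      by (auto simp: gmul_linear fs.scale_right_distrib mult.commute)
  qed
  then have "spo_act n X (gmul e f) = (\<Sum>i=1..2*n+1. \<Sum>j=1..2*n+1.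
        (if j = k then X (i, k) \<odot> gmul (if e = gv n k then gv n i else gw n i) f else 0)
        + koszul p (gpar e) \<odot> gmul e
           (X (i, j) \<odot> (gmul (gv n i) (gder (gv n j) f) + gmul (gw n i) (gder (gw n j) f))))"
    unfolding spo_act_def by (intro sum.cong refl) auto
  also have "\<dots> = (\<Sum>i=1..2*n+1. X (i, k) \<odot> gmul (if e = gv n k then gv n i else gw n i) f)
      + koszul p (gpar e) \<odot> gmul e (spo_act n X f)"
    unfolding sum.distrib spo_act_def gmul_sum fs.scale_sum_right using k by simp
  finally show ?thesis .
qed

text \<open>
  On generators \<open>spo_act n X\<close> is \<open>u\<^sub>k \<otimes> v' \<mapsto> X u\<^sub>k \<otimes> v'\<close>, it kills 1 (see above), and it satisfies
  the super Leibniz rule; this determines it.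
\<close>

lemma spo_act_leibniz:
  assumes "homogeneous (spo_par n) p X" and "k \<in> {1..2*n+1}"
  shows "spo_act n X (gmul (gv n k) f) =
      (\<Sum>i=1..2*n+1. X (i, k) \<odot> gmul (gv n i) f)
      + koszul p (gpar (gv n k)) \<odot> gmul (gv n k) (spo_act n X f)"
    and "spo_act n X (gmul (gw n k) f) =
      (\<Sum>i=1..2*n+1. X (i, k) \<odot> gmul (gw n i) f)
      + koszul p (gpar (gw n k)) \<odot> gmul (gw n k) (spo_act n X f)"
  using spo_act_leibniz_aux[OF assms(1) _ assms(2), of "gv n k"]
        spo_act_leibniz_aux[OF assms(1) _ assms(2), of "gw n k"]
        gv_gw_simps(4)[OF assms(2) assms(2)]
  by simp_all

definition F11 :: "nat \<Rightarrow> spoly \<Rightarrow> spoly"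
  where "F11 n f = (\<Sum>i=1..2*n. gmul (GX i) (gder (GX i) f))
    + gmul (GH (2*n+1)) (gder (GH (2*n+1)) f) + ((2 * of_nat n - 1) / 2) \<odot> f"

definition F22 :: "nat \<Rightarrow> spoly \<Rightarrow> spoly"
  where "F22 n f = (\<Sum>i=1..2*n. gmul (GH i) (gder (GH i) f))
    + gmul (GX (2*n+1)) (gder (GX (2*n+1)) f) - ((2 * of_nat n - 1) / 2) \<odot> f"

definition F21 :: "nat \<Rightarrow> spoly \<Rightarrow> spoly"
  where "F21 n f = gmul (GX (2*n+1)) (gder (GH (2*n+1)) f)
    - (\<Sum>i=1..2*n. gmul (GH i) (gder (GX i) f))"

definition F12 :: "nat \<Rightarrow> spoly \<Rightarrow> spoly"
  where "F12 n f = gmul (GH (2*n+1)) (gder (GX (2*n+1)) f)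
    - (\<Sum>i=1..2*n. gmul (GX i) (gder (GH i) f))"

text \<open>The action of gl(1|1) on S(E) identifying the matrix unit \<open>E\<^sub>i\<^sub>j\<close> with \<open>F\<^sub>i\<^sub>j\<close>.\<close>

definition gl11_act :: "nat \<Rightarrow> cmat \<Rightarrow> spoly \<Rightarrow> spoly"
  where "gl11_act n Y f =
    Y (1, 1) \<odot> F11 n f + Y (1, 2) \<odot> F12 n f + Y (2, 1) \<odot> F21 n f + Y (2, 2) \<odot> F22 n f"

definition D12 :: "nat \<Rightarrow> spoly \<Rightarrow> spoly"
  where "D12 n f = gder (GX (2*n+1)) (gder (GH (2*n+1)) f)
    + (\<Sum>i=1..n. gder (GX i) (gder (GH (2*n+1-i)) f) - gder (GX (2*n+1-i)) (gder (GH i) f))"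

definition D22 :: "nat \<Rightarrow> spoly \<Rightarrow> spoly"
  where "D22 n f = gder (GX (2*n+1)) (gder (GX (2*n+1)) f)
    + 2 \<odot> (\<Sum>i=1..n. gder (GH i) (gder (GH (2*n+1-i)) f))"

definition SE_inv :: "nat \<Rightarrow> spoly set"
  where "SE_inv n = {f \<in> SE n. D12 n f = 0 \<and> D22 n f = 0}"


section \<open>Outer tensor products and joint submodules of S(E)\<close>

text \<open>
  The tensor product of subspaces of \<open>'a \<Rightarrow> complex\<close> and \<open>'b \<Rightarrow> complex\<close> is realised inside
  \<open>'a \<times> 'b \<Rightarrow> complex\<close>: over a field, \<open>u \<otimes> v \<mapsto> ((a, b) \<mapsto> u a * v b)\<close> is injective.
\<close>

definition ptensor :: "('a \<Rightarrow> complex) \<Rightarrow> ('b \<Rightarrow> complex) \<Rightarrow> ('a \<times> 'b \<Rightarrow> complex)"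
  where "ptensor u v = (\<lambda>(a, b). u a * v b)"

definition tensor_space :: "'a smodule \<Rightarrow> 'b smodule \<Rightarrow> ('a \<times> 'b \<Rightarrow> complex) set"
  where "tensor_space L M = fs.span {ptensor u v | u v. u \<in> scarrier L \<and> v \<in> scarrier M}"

text \<open>
  \<open>\<phi>\<close> is an even isomorphism from the outer tensor product of \<open>L\<close> and \<open>M\<close> onto \<open>W\<close>. The actions on
  the outer tensor product are \<open>X (u \<otimes> v) = X u \<otimes> v\<close> and \<open>Y (u \<otimes> v) = (-1) ^ (\<bar>Y\<bar> \<bar>u\<bar>) u \<otimes> Y v\<close>
  for homogeneous \<open>u\<close>, \<open>v\<close> and \<open>Y\<close>.
\<close>

definition joint_iso ::
    "nat \<Rightarrow> 'a smodule \<Rightarrow> 'b smodule \<Rightarrow> spoly set \<Rightarrow> (('a \<times> 'b \<Rightarrow> complex) \<Rightarrow> spoly) \<Rightarrow> bool"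
  where "joint_iso n L M W \<phi> \<longleftrightarrow>
    linear_on (tensor_space L M) \<phi> \<and> bij_betw \<phi> (tensor_space L M) W \<and>
    (\<forall>p q. \<forall>u\<in>part L p. \<forall>v\<in>part M q.
      \<phi> (ptensor u v) \<in> SE_part n (p \<noteq> q) \<and>
      (\<forall>X\<in>spo n. spo_act n X (\<phi> (ptensor u v)) = \<phi> (ptensor (act L X u) v)) \<and>
      (\<forall>r. \<forall>Y\<in>gl 2. homogeneous gl11_par r Y \<longrightarrow>
        gl11_act n Y (\<phi> (ptensor u v)) = koszul r p \<odot> \<phi> (ptensor u (act M Y v))))"

text \<open>
  \<open>W\<close> is a joint submodule of S(E) isomorphic to the outer tensor product of the irreducible module
  of highest weight \<open>wt\<close> and the irreducible module of highest weight \<open>\<mu>\<close>. The type \<^typ>\<open>spoly\<close> only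
  serves as a space containing a copy of every space of countable dimension, hence of every highest
  weight module; \<open>L\<close> and \<open>M\<close> carry their own actions and need not be related to S(E).
\<close>

definition is_V_tensor_V :: "nat \<Rightarrow> complex list \<Rightarrow> complex \<times> complex \<Rightarrow> spoly set \<Rightarrow> bool"
  where "is_V_tensor_V n wt \<mu> W \<longleftrightarrow>
    (\<exists>(L :: smono smodule) (M :: smono smodule) \<phi>.
      is_V_spo n wt L \<and> is_V_gl11 \<mu> M \<and> joint_iso n L M W \<phi>)"

datatype summand = Sum_const | Sum_top | Sum_low nat nat | Sum_high nat nat

definition summands :: "nat \<Rightarrow> summand set"
  where "summands n = {Sum_const, Sum_top} \<union>
    {Sum_low d k | d k. k \<in> {1..n}} \<union> {Sum_high d k | d k. k \<in> {1..n}}"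

end

theory Submission
  imports Defs
begin

text \<open>
  Let \<open>L p r\<close> be the space of all \<open>f\<close> in S(E) killed by \<open>D\<^sub>1\<^sub>2\<close>, \<open>D\<^sub>2\<^sub>2\<close> and \<open>F\<^sub>2\<^sub>1\<close> that have degree \<open>p\<close> in the
  generators \<open>u\<^sub>i \<otimes> v\<^sub>1\<close> and degree \<open>r\<close> in the \<open>u\<^sub>i \<otimes> w\<^sub>1\<close>. Since the anticommutator of \<open>F\<^sub>1\<^sub>2\<close> and \<open>F\<^sub>2\<^sub>1\<close> is the
  total degree, the invariants are the direct sum of the spaces \<open>L p r + F\<^sub>1\<^sub>2 (L p r)\<close>, so it suffices to show
  that \<open>L p r\<close> is irreducible over spo(2n|1), of the right highest weight, or zero.

  On \<open>L p r\<close> the Casimir operator of spo(2n|1) is the scalar \<open>p * (p + 2 * n + 1) + r * (2 * n + 1 - r)\<close>, because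
  its second-order part is made of \<open>D\<^sub>1\<^sub>2\<close>, \<open>D\<^sub>2\<^sub>2\<close> and \<open>F\<^sub>2\<^sub>1\<close>. If \<open>U \<subset> U'\<close> are submodules of \<open>L p r\<close>, a weight
  vector \<open>f\<close> of maximal height in \<open>U'\<close> but not in \<open>U\<close> is a highest weight vector modulo \<open>U\<close>, so the scalar also is
  \<open>(\<mu>, \<mu> + 2 \<rho>)\<close> for its weight \<open>\<mu>\<close>. An element of the kernel of \<open>D\<^sub>2\<^sub>2\<close> is determined by its coefficients of
  degree at most 1 in \<open>x\<^bsub>2n+1\<^esub>\<close>, and among the monomials in question the equation between the two
  values leaves just one. Hence \<open>f\<close> is unique up to a scalar; applied to \<open>0 \<subset> U\<close> and to \<open>U \<subset> L p r\<close> this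
  shows that a nonzero submodule \<open>U\<close> is all of \<open>L p r\<close>.
\<close>

subsection \<open>Differential operators on S(E)\<close>

text \<open>A maximal vector of a subquotient \<open>U'/U\<close> need not be killed by the raising
  operators in \<open>L p r\<close> itself. It has to be recognised by properties shared by all of
  \<open>L p r\<close>: the bidegree, the kernel of \<open>D22\<close> and the Casimir scalar. The
  scalar exists because the Casimir operator of gl(2n|1) on S(E) is a quadratic expression in
  gl(1|1), while the other terms of the spo-Casimir end in \<open>D12\<close> or \<open>D22\<close>
  or reduce to the degree. The term \<open>r * (2*n+1-r)\<close> is symmetric under
  \<open>r -> 2*n+1-r\<close>. This is why each spo-module occurs twice, and why for
  \<open>r > n\<close> the extremal monomial contains the last even variable. The vectors of
  \<open>L p r\<close> are lowest for gl(1|1). The highest ones lie in \<open>F12 (L p r)\<close>,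
  with weight shifted by \<open>(1, -1)\<close>, except for \<open>p = r = 0\<close>, where
  \<open>F12\<close> vanishes. As \<open>F12\<close> is odd, it commutes with spo(2n|1) only up to
  sign; composing with the parity involution removes the sign. That \<open>L p r\<close> is nonzero
  in the right bidegrees is shown by an explicit vector, the extension of a monomial to the kernel
  of \<open>D22\<close>.\<close>

global_interpretation fsp: vector_space_pair
  "fscale :: complex \<Rightarrow> ('a \<Rightarrow> complex) \<Rightarrow> _" "fscale :: complex \<Rightarrow> ('b \<Rightarrow> complex) \<Rightarrow> _" ..

abbreviation lin :: "(('a \<Rightarrow> complex) \<Rightarrow> ('b \<Rightarrow> complex)) \<Rightarrow> bool"
  where "lin \<equiv> Vector_Spaces.linear (\<odot>) (\<odot>)"

lemma linI:
  assumes "\<And>f g. T (f + g) = T f + T g" and "\<And>c f. T (c \<odot> f) = c \<odot> T f"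
  shows "lin T"
  using assms
  by (simp add: Vector_Spaces.linear_def module_hom_def module_hom_axioms_def
      fs.vector_space_axioms fs.module_axioms)

lemmas lin_rules = fsp.linear_add fsp.linear_scale fsp.linear_0 fsp.linear_neg fsp.linear_diff fsp.linear_sum

lemma gder_add: "gder e (f + g) = gder e f + gder e g"
  by (cases e) (auto simp: fun_eq_iff algebra_simps)

lemma gder_scale: "gder e (c \<odot> f) = c \<odot> gder e f"
  by (cases e) (auto simp: fun_eq_iff fscale_def algebra_simps)

lemma lin_gmul: "lin (gmul e)" and lin_gder: "lin (gder e)"
  by (intro linI gmul_linear gder_add gder_scale)+

lemma gder_gder: "gder e (gder e' f) = koszul (gpar e) (gpar e') \<odot> gder e' (gder e f)"
proof (cases e; cases e')
  fix i j assume "e = GX i" "e' = GX j"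
  then show ?thesis
    by (cases "i = j") (auto simp: fun_eq_iff fscale_def koszul_def fun_upd_twist)
next
  fix i j assume e: "e = GH i" "e' = GH j"
  show ?thesis using e
    by (cases i j rule: linorder_cases)
       (auto simp: fun_eq_iff fscale_def koszul_def hsign_insert insert_commute)
qed (auto simp: fun_eq_iff fscale_def koszul_def)

text \<open>Every operator of the proof is a combination of these: \<open>muld\<close> for gl(2n|1)
  and gl(1|1), \<open>derd\<close> for \<open>D12\<close> and \<open>D22\<close>. In
  \<open>mmdd a c b d\<close> the product of \<open>muld a b\<close> and \<open>muld c d\<close> is
  normally ordered, with both multiplications to the left of both derivatives.\<close>

definition muld :: "gen \<Rightarrow> gen \<Rightarrow> spoly \<Rightarrow> spoly"
  where "muld a b f = gmul a (gder b f)"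

definition derd :: "gen \<Rightarrow> gen \<Rightarrow> spoly \<Rightarrow> spoly"
  where "derd a b f = gder a (gder b f)"

definition mmdd :: "gen \<Rightarrow> gen \<Rightarrow> gen \<Rightarrow> gen \<Rightarrow> spoly \<Rightarrow> spoly"
  where "mmdd a c b d f = gmul a (gmul c (gder b (gder d f)))"

lemma lin_compose: "lin S \<Longrightarrow> lin T \<Longrightarrow> lin (\<lambda>f. S (T f))"
  by (intro linI) (simp_all only: fsp.linear_add[of T] fsp.linear_add[of S] fsp.linear_scale[of T] fsp.linear_scale[of S])

lemma lin_muld: "lin (muld a b)" and lin_derd: "lin (derd a b)" and lin_mmdd: "lin (mmdd a c b d)"
  unfolding muld_def[abs_def] derd_def[abs_def] mmdd_def[abs_def]
  by (intro lin_compose[OF lin_gmul] lin_compose[OF lin_gder] lin_gmul lin_gder)+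

lemmas lins = lin_rules[OF lin_gmul] lin_rules[OF lin_gder] lin_rules[OF lin_muld] lin_rules[OF lin_derd]
  lin_rules[OF lin_mmdd]

lemmas fscale_simps = fs.scale_right_distrib fs.scale_left_distrib fs.scale_right_diff_distrib
  fs.scale_left_diff_distrib

lemma muld_muld_normal:
  "muld a b (muld c d f) = (if b = c then muld a d f else 0) + koszul (gpar b) (gpar c) \<odot> mmdd a c b d f"
  unfolding muld_def mmdd_def gder_gmul by (simp add: lins)

lemma mmdd_swap:
  "mmdd c a d b f = (koszul (gpar a) (gpar c) * koszul (gpar b) (gpar d)) \<odot> mmdd a c b d f"
proof -
  have "mmdd c a d b f = gmul c (gmul a (koszul (gpar d) (gpar b) \<odot> gder b (gder d f)))"
    unfolding mmdd_def by (subst gder_gder) simp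
  also have "\<dots> = koszul (gpar c) (gpar a) \<odot> gmul a (gmul c (koszul (gpar d) (gpar b) \<odot> gder b (gder d f)))"
    by (subst gmul_gmul) simp
  finally show ?thesis
    by (simp add: mmdd_def lins koszul_def)
qed

text \<open>Both orders of the product have the same normally ordered part up to the Koszul sign
  (\<open>mmdd_swap\<close>), so only the two contractions, of \<open>b\<close> with
  \<open>c\<close> and of \<open>d\<close> with \<open>a\<close>, survive in the
  supercommutator.\<close>

lemma muld_muld:
  "muld a b (muld c d f) = (if b = c then muld a d f else 0)
    + koszul (gpar a \<noteq> gpar b) (gpar c \<noteq> gpar d) \<odot> (muld c d (muld a b f) - (if a = d then muld c b f else 0))"
proof -
  have "muld c d (muld a b f) - (if a = d then muld c b f else 0) =
     (koszul (gpar d) (gpar a) * (koszul (gpar a) (gpar c) * koszul (gpar b) (gpar d))) \<odot> mmdd a c b d f"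
    unfolding muld_muld_normal[of c d] mmdd_swap[of c a d b] by simp
  then show ?thesis
    unfolding muld_muld_normal[of a b] by (auto simp: koszul_def)
qed

lemma derd_swap: "derd b a f = koszul (gpar a) (gpar b) \<odot> derd a b f"
  unfolding derd_def by (subst gder_gder) (simp add: koszul_def)

lemma derd_muld:
  "derd a b (muld c d f) = koszul (gpar a \<noteq> gpar b) (gpar c \<noteq> gpar d) \<odot> muld c d (derd a b f)
    + (if b = c then derd a d f else 0)
    + koszul (gpar b) (gpar c) \<odot> (if a = c then derd b d f else 0)"
proof -
  have "gder a (gder b (gder d f)) = (koszul (gpar a) (gpar d) * koszul (gpar b) (gpar d)) \<odot> gder d (gder a (gder b f))"
    by (subst gder_gder[of b d], simp add: lins, subst gder_gder[of a d], simp add: mult.commute)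
  then show ?thesis
    unfolding derd_def muld_def gder_gmul
    by (cases "gpar a"; cases "gpar b"; cases "gpar c"; cases "gpar d"; cases "b = c"; cases "a = c")
      (simp_all add: lins koszul_def gder_gmul)
qed

subsection \<open>Supports\<close>

text \<open>One exponent function for even and odd generators. With it the effect of an operator on
  a monomial is a single equation in \<open>g\<close>, from which bidegree, parity and weight are
  all obtained by summation.\<close>

fun gcount :: "gen \<Rightarrow> smono \<Rightarrow> nat"
  where
    "gcount (GX i) s = fst s i"
  | "gcount (GH i) s = of_bool (i \<in> snd s)"

text \<open>Grading arguments never look at the values of coefficients: it is enough to know from
  which monomial of \<open>f\<close> a nonzero coefficient of the result arises and how the
  exponents differ. All \<open>_supp\<close> lemmas have this form.\<close>

lemma gmul_supp:
  assumes "gmul a f s \<noteq> 0"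
  obtains s' where "f s' \<noteq> 0" "\<And>g. gcount g s = gcount g s' + of_bool (g = a)"
proof (cases a)
  case (GX i)
  obtain m A where s: "s = (m, A)" by force
  have "f (m(i := m i - 1), A) \<noteq> 0" "m i \<noteq> 0" using assms GX s by (auto split: if_splits)
  moreover have "gcount g s = gcount g (m(i := m i - 1), A) + of_bool (g = a)" for g
    using GX s \<open>m i \<noteq> 0\<close> by (cases g) auto
  ultimately show ?thesis using that by blast
next
  case (GH i)
  obtain m A where s: "s = (m, A)" by force
  have "f (m, A - {i}) \<noteq> 0" "i \<in> A" using assms GH s by (auto split: if_splits)
  moreover have "gcount g s = gcount g (m, A - {i}) + of_bool (g = a)" for g
    using GH s \<open>i \<in> A\<close> by (cases g) auto
  ultimately show ?thesis using that by blast
qed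

lemma gder_supp:
  assumes "gder a f s \<noteq> 0"
  obtains s' where "f s' \<noteq> 0" "\<And>g. gcount g s' = gcount g s + of_bool (g = a)"
proof (cases a)
  case (GX i)
  obtain m A where s: "s = (m, A)" by force
  have "f (m(i := m i + 1), A) \<noteq> 0" using assms GX s by (auto split: if_splits)
  moreover have "gcount g (m(i := m i + 1), A) = gcount g s + of_bool (g = a)" for g
    using GX s by (cases g) auto
  ultimately show ?thesis using that by blast
next
  case (GH i)
  obtain m A where s: "s = (m, A)" by force
  have "f (m, insert i A) \<noteq> 0" "i \<notin> A" using assms GH s by (auto split: if_splits)
  moreover have "gcount g (m, insert i A) = gcount g s + of_bool (g = a)" for g
    using GH s \<open>i \<notin> A\<close> by (cases g) auto
  ultimately show ?thesis using that by blast
qed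

lemma muld_supp:
  assumes "muld a b f s \<noteq> 0"
  obtains s' where "f s' \<noteq> 0" "\<And>g. gcount g s + of_bool (g = b) = gcount g s' + of_bool (g = a)"
proof -
  obtain t where t: "gder b f t \<noteq> 0" "\<And>g. gcount g s = gcount g t + of_bool (g = a)"
    using assms unfolding muld_def by (rule gmul_supp) blast
  obtain s' where "f s' \<noteq> 0" "\<And>g. gcount g s' = gcount g t + of_bool (g = b)"
    using t(1) by (rule gder_supp) blast
  then show ?thesis using that t(2) by (metis add.assoc add.commute)
qed

lemma muld_diag: "muld a a f s = of_nat (gcount a s) * f s"
proof (cases a; cases s)
  fix i m A assume "a = GX i" "s = (m, A)"
  then show ?thesis by (simp add: muld_def)
next
  fix i m A assume "a = GH i" "s = (m, A)"
  then show ?thesis by (simp add: muld_def hsign_remove insert_absorb)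
qed

definition gens :: "nat \<Rightarrow> gen set"
  where "gens n = GX ` {1..2*n+1} \<union> GH ` {1..2*n+1}"

lemma SE_iff:
  "f \<in> SE n \<longleftrightarrow> finite {s. f s \<noteq> 0} \<and> (\<forall>s g. f s \<noteq> 0 \<longrightarrow> gcount g s \<noteq> 0 \<longrightarrow> g \<in> gens n)"
proof -
  have "({i. m i \<noteq> 0} \<subseteq> {1..2*n+1} \<and> A \<subseteq> {1..2*n+1}) \<longleftrightarrow> (\<forall>g. gcount g (m, A) \<noteq> 0 \<longrightarrow> g \<in> gens n)"
    for m :: "nat \<Rightarrow> nat" and A
  proof -
    have "(\<forall>g. gcount g (m, A) \<noteq> 0 \<longrightarrow> g \<in> gens n) \<longleftrightarrow>
      (\<forall>i. gcount (GX i) (m, A) \<noteq> 0 \<longrightarrow> GX i \<in> gens n) \<and> (\<forall>i. gcount (GH i) (m, A) \<noteq> 0 \<longrightarrow> GH i \<in> gens n)"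
      by (metis gen.exhaust)
    then show ?thesis by (auto simp: gens_def image_iff)
  qed
  then show ?thesis by (auto simp: SE_def)
qed

lemma SE_gmul:
  assumes "f \<in> SE n" and "e \<in> gens n"
  shows "gmul e f \<in> SE n"
proof -
  have fin: "finite {s. f s \<noteq> 0}" using assms by (simp add: SE_iff)
  have "\<exists>h. {s. gmul e f s \<noteq> 0} \<subseteq> h ` {s. f s \<noteq> 0}"
  proof (cases e)
    case (GX i)
    have "s \<in> (\<lambda>(m, A). (m(i := Suc (m i)), A)) ` {s. f s \<noteq> 0}" if "gmul e f s \<noteq> 0" for s
    proof -
      obtain m A where s: "s = (m, A)" by force
      have *: "f (m(i := m i - 1), A) \<noteq> 0" "m i \<noteq> 0" using that GX s by (auto split: if_splits)
      have "s = (\<lambda>(m, A). (m(i := Suc (m i)), A)) (m(i := m i - 1), A)" using * s by auto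
      with * show ?thesis by blast
    qed
    then show ?thesis by blast
  next
    case (GH i)
    have "s \<in> (\<lambda>(m, A). (m, insert i A)) ` {s. f s \<noteq> 0}" if "gmul e f s \<noteq> 0" for s
    proof -
      obtain m A where s: "s = (m, A)" by force
      have *: "f (m, A - {i}) \<noteq> 0" "i \<in> A" using that GH s by (auto split: if_splits)
      have "s = (\<lambda>(m, A). (m, insert i A)) (m, A - {i})" using * s by auto
      with * show ?thesis by blast
    qed
    then show ?thesis by blast
  qed
  then have "finite {s. gmul e f s \<noteq> 0}" using fin finite_surj by blast
  moreover have "g \<in> gens n" if "gmul e f s \<noteq> 0" "gcount g s \<noteq> 0" for s g
    using that(1)
    by (rule gmul_supp) (use that(2) assms in \<open>auto simp: SE_iff split: if_splits\<close>)
  ultimately show ?thesis by (simp add: SE_iff)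
qed

lemma SE_gder:
  assumes "f \<in> SE n"
  shows "gder e f \<in> SE n"
proof -
  have fin: "finite {s. f s \<noteq> 0}" using assms by (simp add: SE_iff)
  have "\<exists>h. {s. gder e f s \<noteq> 0} \<subseteq> h ` {s. f s \<noteq> 0}"
  proof (cases e)
    case (GX i)
    have "s \<in> (\<lambda>(m, A). (m(i := m i - 1), A)) ` {s. f s \<noteq> 0}" if "gder e f s \<noteq> 0" for s
    proof -
      obtain m A where s: "s = (m, A)" by force
      have *: "f (m(i := m i + 1), A) \<noteq> 0" using that GX s by (auto split: if_splits)
      have "s = (\<lambda>(m, A). (m(i := m i - 1), A)) (m(i := m i + 1), A)" using * s by auto
      with * show ?thesis by blast
    qed
    then show ?thesis by blast
  next
    case (GH i)
    have "s \<in> (\<lambda>(m, A). (m, A - {i})) ` {s. f s \<noteq> 0}" if "gder e f s \<noteq> 0" for s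
    proof -
      obtain m A where s: "s = (m, A)" by force
      have *: "f (m, insert i A) \<noteq> 0" "i \<notin> A" using that GH s by (auto split: if_splits)
      have "s = (\<lambda>(m, A). (m, A - {i})) (m, insert i A)" using * s by auto
      with * show ?thesis by blast
    qed
    then show ?thesis by blast
  qed
  then have "finite {s. gder e f s \<noteq> 0}" using fin finite_surj by blast
  moreover have "g \<in> gens n" if "gder e f s \<noteq> 0" "gcount g s \<noteq> 0" for s g
    using that(1)
    by (rule gder_supp) (use that(2) assms in \<open>auto simp: SE_iff\<close>)
  ultimately show ?thesis by (simp add: SE_iff)
qed

lemma subspace_supported: "fs.subspace {f. \<forall>s. f s \<noteq> 0 \<longrightarrow> P s}"
  by (auto simp: fs.subspace_def fscale_def) (metis add.right_neutral)

lemma subspace_SE: "fs.subspace (SE n)"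
proof -
  have "finite {s. f s + g s \<noteq> 0}" if "finite {s. f s \<noteq> 0}" "finite {s. g s \<noteq> 0}"
    for f g :: spoly
    by (rule finite_subset[OF _ finite_UnI[OF that]]) auto
  moreover have "finite {s. c * f s \<noteq> 0}" if "finite {s. f s \<noteq> 0}" for c and f :: spoly
    by (rule finite_subset[OF _ that]) auto
  ultimately show ?thesis
    by (auto simp: fs.subspace_def SE_iff fscale_def) (metis add.right_neutral)
qed

section \<open>Indices, the duality induced by the form B, and signs\<close>

definition idx :: "nat \<Rightarrow> nat set"
  where "idx n = {1..2*n+1}"

text \<open>The basis vector \<open>u_i\<close> pairs nontrivially under B only with the one of
  index \<open>dual n i\<close>. Indices outside \<open>{1..2*n}\<close> are fixed, so that this is
  an involution of all natural numbers and \<open>dual_dual\<close> holds without side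
  condition.\<close>

definition dual :: "nat \<Rightarrow> nat \<Rightarrow> nat"
  where "dual n i = (if 1 \<le> i \<and> i \<le> 2*n then 2*n+1-i else i)"

text \<open>The value of B on \<open>u_i\<close> and its dual basis vector, see
  \<open>B_basis_eq\<close>.\<close>

definition bsign :: "nat \<Rightarrow> nat \<Rightarrow> complex"
  where "bsign n i = (if n < i \<and> i \<le> 2*n then -1 else 1)"

definition psign :: "nat \<Rightarrow> nat \<Rightarrow> complex"
  where "psign n i = (if spo_par n i then -1 else 1)"

text \<open>The flag selects the basis vector of the second tensor factor, \<open>v_1\<close> for
  \<open>False\<close> and \<open>w_1\<close> for \<open>True\<close>. Both kinds of generators, and
  the parity switch at the index \<open>2*n+1\<close>, are thereby covered by one formula.\<close>

definition zgen :: "nat \<Rightarrow> bool \<Rightarrow> nat \<Rightarrow> gen"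
  where "zgen n b i = (if b then gw n i else gv n i)"

lemma finite_idx [simp]: "finite (idx n)"
  by (simp add: idx_def)

lemma dual_idx [simp]: "dual n i \<in> idx n \<longleftrightarrow> i \<in> idx n"
  by (auto simp: dual_def idx_def)

lemma dual_dual [simp]: "dual n (dual n i) = i"
  by (auto simp: dual_def)

lemma dual_eq_iff: "dual n i = j \<longleftrightarrow> i = dual n j"
  by (metis dual_dual)

lemma dual_inj [simp]: "dual n i = dual n j \<longleftrightarrow> i = j"
  by (metis dual_dual)

lemma par_dual [simp]: "i \<in> idx n \<Longrightarrow> spo_par n (dual n i) = spo_par n i"
  by (auto simp: dual_def idx_def spo_par_def)

lemma psign_dual [simp]: "i \<in> idx n \<Longrightarrow> psign n (dual n i) = psign n i"
  by (simp add: psign_def)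

lemma bsign_dual: "i \<in> idx n \<Longrightarrow> bsign n (dual n i) = - psign n i * bsign n i"
  by (auto simp: dual_def idx_def bsign_def psign_def spo_par_def)

lemma bsign_square [simp]: "bsign n i * bsign n i = 1" "bsign n i * (bsign n i * c) = c"
  by (auto simp: bsign_def)

lemma psign_square [simp]: "psign n i * psign n i = 1" "psign n i * (psign n i * c) = c"
  by (auto simp: psign_def)

lemma bsign_odd: "spo_par n i \<Longrightarrow> bsign n i = 1"
  by (simp add: bsign_def spo_par_def)

lemma sum_dual: "(\<Sum>i\<in>idx n. h (dual n i)) = sum h (idx n)"
  by (rule sum.reindex_bij_witness[of _ "dual n" "dual n"]) auto

text \<open>Reindexing by the involution \<open>(k, l) -> (dual n l, dual n k)\<close>, under which
  the entries of an element of spo(2n|1) change only by a sign.\<close>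

lemma sum_sum_dual:
  "(\<Sum>k\<in>idx n. \<Sum>l\<in>idx n. h (dual n l) (dual n k)) = (\<Sum>k\<in>idx n. \<Sum>l\<in>idx n. h k l)"
proof -
  have "(\<Sum>k\<in>idx n. \<Sum>l\<in>idx n. h (dual n l) (dual n k)) = (\<Sum>k\<in>idx n. \<Sum>l\<in>idx n. h (dual n l) k)"
    by (rule sum_dual)
  also have "\<dots> = (\<Sum>k\<in>idx n. \<Sum>l\<in>idx n. h l k)"
    by (intro sum.cong refl sum_dual)
  finally show ?thesis by (subst (asm) sum.swap)
qed

lemma sum_idx:
  fixes h :: "nat \<Rightarrow> 'a::comm_monoid_add"
  shows "sum h (idx n) = (\<Sum>j=1..n. h j + h (2*n+1-j)) + h (2*n+1)"
proof -
  have "idx n = ({1..n} \<union> {n+1..2*n}) \<union> {2*n+1}" by (auto simp: idx_def)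
  then have "sum h (idx n) = sum h {1..n} + sum h {n+1..2*n} + h (2*n+1)"
    by (simp add: sum.union_disjoint add.commute)
  also have "sum h {n+1..2*n} = (\<Sum>j=1..n. h (2*n+1-j))"
    by (rule sum.reindex_bij_witness[of _ "\<lambda>j. 2*n+1-j" "\<lambda>j. 2*n+1-j"]) auto
  finally show ?thesis by (simp add: sum.distrib)
qed

lemma zgen_eq_iff [simp]: "i \<in> idx n \<Longrightarrow> j \<in> idx n \<Longrightarrow> zgen n a i = zgen n b j \<longleftrightarrow> a = b \<and> i = j"
  by (cases a; cases b) (auto simp: zgen_def idx_def gv_gw_simps)

lemma gpar_zgen [simp]: "i \<in> idx n \<Longrightarrow> gpar (zgen n b i) = (b \<noteq> spo_par n i)"
  by (auto simp: zgen_def gv_gw_simps idx_def)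

lemma zgen_gens: "i \<in> idx n \<Longrightarrow> zgen n b i \<in> gens n"
  by (auto simp: zgen_def gv_def gw_def gens_def idx_def)

section \<open>The action of gl(2n|1) on S(E)\<close>

definition glE :: "nat \<Rightarrow> nat \<Rightarrow> nat \<Rightarrow> spoly \<Rightarrow> spoly"
  where "glE n k l f = (\<Sum>c\<in>UNIV. muld (zgen n c k) (zgen n c l) f)"

lemma lin_sum_op: "(\<And>i. i \<in> I \<Longrightarrow> lin (T i)) \<Longrightarrow> lin (\<lambda>f. \<Sum>i\<in>I. T i f)"
  by (rule fsp.linear_compose_sum) blast

lemma lin_scale_op: "lin T \<Longrightarrow> lin (\<lambda>f. c \<odot> T f)"
  by (rule fsp.linear_compose_scale_right)

lemma lin_diff_op: "lin S \<Longrightarrow> lin T \<Longrightarrow> lin (\<lambda>f. S f - T f)"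
  by (rule fsp.linear_compose_sub)

lemma lin_glE: "lin (glE n k l)"
  unfolding glE_def[abs_def] by (intro lin_sum_op lin_muld)

lemmas glE_lins = lin_rules[OF lin_glE]

lemma spo_act_glE: "spo_act n X f = (\<Sum>i\<in>idx n. \<Sum>j\<in>idx n. X (i, j) \<odot> glE n i j f)"
  by (simp add: spo_act_def glE_def UNIV_bool zgen_def muld_def idx_def add.commute)

lemma spo_act_mat_linear:
  "spo_act n (X + Y) f = spo_act n X f + spo_act n Y f"
  "spo_act n (X - Y) f = spo_act n X f - spo_act n Y f"
  "spo_act n (c \<odot> X) f = c \<odot> spo_act n X f"
  by (simp_all add: spo_act_glE fscale_def[of c X] fs.scale_left_distrib fs.scale_left_diff_distrib sum.distrib sum_subtractf fs.scale_sum_right)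

lemma spo_act_unit: "k \<in> idx n \<Longrightarrow> l \<in> idx n \<Longrightarrow> spo_act n (mat_unit k l) f = glE n k l f"
proof -
  assume kl: "k \<in> idx n" "l \<in> idx n"
  have "(\<Sum>j\<in>idx n. mat_unit k l (i, j) \<odot> glE n i j f) = (if i = k then glE n i l f else 0)" for i
  proof -
    have "mat_unit k l (i, j) \<odot> glE n i j f = (if j = l then if i = k then glE n i l f else 0 else 0)" for j
      by (simp add: mat_unit_def)
    then show ?thesis using kl by simp
  qed
  then show ?thesis using kl by (simp add: spo_act_glE)
qed

lemma lin_spo_act: "lin (spo_act n X)"
  unfolding spo_act_glE[abs_def] by (intro lin_sum_op lin_scale_op lin_glE)

text \<open>Contractions occur only between generators with the same flag, and switching the flag
  changes the parity of both generators in a summand of \<open>glE n i j\<close>, so the sign in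
  \<open>muld_muld\<close> depends on the indices alone. These are the relations of
  gl(2n|1).\<close>

lemma glE_glE:
  assumes "i \<in> idx n" "j \<in> idx n" "k \<in> idx n" "l \<in> idx n"
  shows "glE n i j (glE n k l f) = (if j = k then glE n i l f else 0)
    + koszul (spo_par n i \<noteq> spo_par n j) (spo_par n k \<noteq> spo_par n l)
        \<odot> (glE n k l (glE n i j f) - (if i = l then glE n k j f else 0))"
proof -
  define K where "K = koszul (spo_par n i \<noteq> spo_par n j) (spo_par n k \<noteq> spo_par n l)"
  have muld: "muld (zgen n c i) (zgen n c j) (muld (zgen n d k) (zgen n d l) f)
     = (if j = k then if c = d then muld (zgen n c i) (zgen n c l) f else 0 else 0)
      + K \<odot> (muld (zgen n d k) (zgen n d l) (muld (zgen n c i) (zgen n c j) f)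
         - (if i = l then if c = d then muld (zgen n c k) (zgen n c j) f else 0 else 0))" for c d
  proof -
    have par: "(gpar (zgen n c i) \<noteq> gpar (zgen n c j)) = (spo_par n i \<noteq> spo_par n j)"
      "(gpar (zgen n d k) \<noteq> gpar (zgen n d l)) = (spo_par n k \<noteq> spo_par n l)"
      using assms by auto
    show ?thesis by (subst muld_muld, simp only: par K_def[symmetric]) (use assms in auto)
  qed
  then show ?thesis
    unfolding K_def[symmetric]
    by (simp add: glE_def UNIV_bool lins fscale_simps muld algebra_simps)
qed

subsection \<open>The matrices of spo\<close>

text \<open>
  An element \<open>X\<close> of spo(2n|1) satisfies \<open>X (l', k') = - dsign n k l * X (k, l)\<close> with \<open>i' = dual n i\<close>.
\<close>

definition dsign :: "nat \<Rightarrow> nat \<Rightarrow> nat \<Rightarrow> complex"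
  where "dsign n k l = koszul (spo_par n k \<noteq> spo_par n l) (spo_par n k) * bsign n (dual n k) * bsign n (dual n l)"

text \<open>The relation between dual entries, applied twice, must lead back to the original
  entry.\<close>

lemma dsign_dual: "k \<in> idx n \<Longrightarrow> l \<in> idx n \<Longrightarrow> dsign n (dual n l) (dual n k) * dsign n k l = 1"
  by (cases "spo_par n k"; cases "spo_par n l")
    (simp_all add: dsign_def koszul_def bsign_dual psign_def bsign_odd mult.assoc)

lemma B_basis_eq: "i \<in> idx n \<Longrightarrow> j \<in> idx n \<Longrightarrow> B_basis n i j = (if j = dual n i then bsign n i else 0)"
  by (auto simp: B_basis_def dual_def bsign_def idx_def)

lemma Bform_eq: "Bform n v w = (\<Sum>i\<in>idx n. bsign n i * v i * w (dual n i))"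
proof -
  have "(\<Sum>j\<in>idx n. v i * w j * B_basis n i j) = bsign n i * v i * w (dual n i)" if "i \<in> idx n" for i
  proof -
    have "(\<Sum>j\<in>idx n. v i * w j * B_basis n i j) = (\<Sum>j\<in>idx n. if j = dual n i then bsign n i * v i * w (dual n i) else 0)"
      using that by (intro sum.cong) (auto simp: B_basis_eq)
    then show ?thesis using that by simp
  qed
  then show ?thesis unfolding Bform_def by (simp add: idx_def)
qed

lemma mat_app_idx: "mat_app (2*n+1) X v i = (\<Sum>j\<in>idx n. X (i, j) * v j)"
  by (simp add: mat_app_def idx_def)

lemma Bform_invariance_sum:
  "Bform n (mat_app (2*n+1) X v) w + c * Bform n v (mat_app (2*n+1) X w)
    = (\<Sum>j\<in>idx n. \<Sum>k\<in>idx n. v j * w k * (bsign n (dual n k) * X (dual n k, j) + c * bsign n j * X (dual n j, k)))"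
proof -
  have "Bform n (mat_app (2*n+1) X v) w = (\<Sum>k\<in>idx n. \<Sum>j\<in>idx n. v j * w k * (bsign n (dual n k) * X (dual n k, j)))"
    unfolding Bform_eq
    unfolding sum_dual[of "\<lambda>i. bsign n i * mat_app (2*n+1) X v i * w (dual n i)", symmetric]
    unfolding mat_app_idx
    by (rule sum.cong) (simp_all add: sum_distrib_left sum_distrib_right algebra_simps)
  moreover have "c * Bform n v (mat_app (2*n+1) X w) = (\<Sum>j\<in>idx n. \<Sum>k\<in>idx n. v j * w k * (c * bsign n j * X (dual n j, k)))"
    unfolding Bform_eq mat_app_idx
    by (simp add: sum_distrib_left algebra_simps)
  ultimately show ?thesis
    by (subst (asm) sum.swap) (simp add: sum.distrib algebra_simps)
qed

text \<open>Testing the invariance on pairs of basis vectors leaves one equation per entry. Its sign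
  involves the parity \<open>p\<close> of \<open>X\<close>; on nonzero entries homogeneity expresses
  \<open>p\<close> through \<open>k\<close> and \<open>l\<close>, which is why \<open>dsign\<close>
  can be written without \<open>p\<close>.\<close>

lemma spo_part_iff:
  "X \<in> spo_part n p \<longleftrightarrow> X \<in> gl (2*n+1) \<and> homogeneous (spo_par n) p X \<and>
    (\<forall>k\<in>idx n. \<forall>l\<in>idx n. X (dual n l, dual n k) = - dsign n k l * X (k, l))"
proof -
  define R where "R q j k = bsign n (dual n k) * X (dual n k, j) + koszul p q * bsign n j * X (dual n j, k)" for q j k
  have form: "Bform n (mat_app (2*n+1) X v) w + koszul p q * Bform n v (mat_app (2*n+1) X w)
    = (\<Sum>j\<in>idx n. \<Sum>k\<in>idx n. v j * w k * R q j k)" for v w q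
    unfolding Bform_invariance_sum R_def ..
  have inv: "(\<forall>q. \<forall>v\<in>V_part n q. \<forall>w\<in>V_space n.
      Bform n (mat_app (2*n+1) X v) w + koszul p q * Bform n v (mat_app (2*n+1) X w) = 0)
    \<longleftrightarrow> (\<forall>j\<in>idx n. \<forall>k\<in>idx n. R (spo_par n j) j k = 0)" (is "?A \<longleftrightarrow> ?B")
  proof
    assume A: ?A
    show ?B
    proof (intro ballI)
      fix j k assume jk: "j \<in> idx n" "k \<in> idx n"
      define v w where "v = (\<lambda>i. if i = j then 1 else 0 :: complex)" and "w = (\<lambda>i. if i = k then 1 else 0 :: complex)"
      have "v \<in> V_part n (spo_par n j)" "w \<in> V_space n"
        using jk by (auto simp: v_def w_def V_part_def V_space_def idx_def)
      then have "(\<Sum>j'\<in>idx n. \<Sum>k'\<in>idx n. v j' * w k' * R (spo_par n j) j' k') = 0"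
        using A form by metis
      moreover have "(\<Sum>k'\<in>idx n. v j' * w k' * R (spo_par n j) j' k') = (if j' = j then R (spo_par n j) j k else 0)" for j'
      proof -
        have "v j' * w k' * R (spo_par n j) j' k' = (if k' = k then if j' = j then R (spo_par n j) j k else 0 else 0)" for k'
          by (simp add: v_def w_def)
        then show ?thesis using jk by simp
      qed
      ultimately show "R (spo_par n j) j k = 0" using jk by simp
    qed
  next
    assume B: ?B
    have "v j * w k * R q j k = 0" if "v \<in> V_part n q" "j \<in> idx n" "k \<in> idx n" for v w q j k
      using that B by (cases "v j = 0") (auto simp: V_part_def)
    then show ?A unfolding form by (intro allI ballI sum.neutral)
  qed
  have "(\<forall>j\<in>idx n. \<forall>k\<in>idx n. R (spo_par n j) j k = 0) \<longleftrightarrow>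
    (\<forall>k\<in>idx n. \<forall>l\<in>idx n. X (dual n l, dual n k) = - dsign n k l * X (k, l))" (is "?A = ?B")
    if hom: "homogeneous (spo_par n) p X"
  proof -
    have "R (spo_par n k) (dual n k) l = 0 \<longleftrightarrow> X (dual n l, dual n k) = - dsign n k l * X (k, l)"
      if kl: "k \<in> idx n" "l \<in> idx n" for k l
    proof -
      have "koszul p (spo_par n k) * bsign n (dual n k) * X (k, l) = bsign n (dual n l) * (dsign n k l * X (k, l))"
      proof (cases "X (k, l) = 0")
        case False
        then have "p = (spo_par n k \<noteq> spo_par n l)" using hom by (auto simp: homogeneous_def)
        then show ?thesis by (simp add: dsign_def mult.left_commute)
      qed simp
      then have "R (spo_par n k) (dual n k) l = bsign n (dual n l) * (X (dual n l, dual n k) + dsign n k l * X (k, l))"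
        using kl by (simp add: R_def algebra_simps)
      moreover have "bsign n (dual n l) \<noteq> 0" by (simp add: bsign_def)
      ultimately show ?thesis by (simp add: eq_neg_iff_add_eq_0)
    qed
    moreover have "?A \<longleftrightarrow> (\<forall>k\<in>idx n. \<forall>l\<in>idx n. R (spo_par n k) (dual n k) l = 0)" (is "_ = ?C")
    proof
      assume A: ?A
      show ?C
      proof (intro ballI)
        fix k l assume "k \<in> idx n" "l \<in> idx n"
        then show "R (spo_par n k) (dual n k) l = 0"
          using A[THEN bspec[of _ _ "dual n k"], THEN bspec[of _ _ l]] by simp
      qed
    next
      assume C: ?C
      show ?A
      proof (intro ballI)
        fix k l assume "k \<in> idx n" "l \<in> idx n"
        then show "R (spo_par n k) k l = 0"
          using C[THEN bspec[of _ _ "dual n k"], THEN bspec[of _ _ l]] by simp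
      qed
    qed
    ultimately show ?thesis by blast
  qed
  with inv show ?thesis unfolding spo_part_def by blast
qed

text \<open>The involution that sends \<open>E_(k,l)\<close> to \<open>- dsign n k l\<close> times
  the dual matrix unit has spo(2n|1) as its fixed space, and this is twice the projection of
  \<open>E_(k,l)\<close> to that space.\<close>

definition spog :: "nat \<Rightarrow> nat \<Rightarrow> nat \<Rightarrow> cmat"
  where "spog n k l = mat_unit k l - dsign n k l \<odot> mat_unit (dual n l) (dual n k)"

lemma spog_spo_part:
  assumes "k \<in> idx n" "l \<in> idx n"
  shows "spog n k l \<in> spo_part n (spo_par n k \<noteq> spo_par n l)"
  unfolding spo_part_iff
proof (intro conjI ballI)
  have "k \<in> {1..2*n+1}" "l \<in> {1..2*n+1}" "dual n k \<in> {1..2*n+1}" "dual n l \<in> {1..2*n+1}"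
    using assms dual_idx[of n k] dual_idx[of n l] by (simp_all only: idx_def)
  then show "spog n k l \<in> gl (2*n+1)"
    by (auto simp: gl_def spog_def mat_unit_def fscale_def split: if_splits)
  show "homogeneous (spo_par n) (spo_par n k \<noteq> spo_par n l) (spog n k l)"
    using assms by (auto simp: homogeneous_def spog_def mat_unit_def fscale_def split: if_splits)
  fix k0 l0 assume *: "k0 \<in> idx n" "l0 \<in> idx n"
  have "dsign n (dual n l) (dual n k) * dsign n k l = 1" using assms by (rule dsign_dual)
  moreover have "spog n k l s = (if s = (k, l) then 1 else 0) - dsign n k l * (if s = (dual n l, dual n k) then 1 else 0)" for s
    by (simp add: spog_def mat_unit_def fscale_def)
  moreover have "(dual n l0, dual n k0) = (k, l) \<longleftrightarrow> (k0, l0) = (dual n l, dual n k)"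
    by (metis dual_dual prod.inject)
  moreover have "(dual n l0, dual n k0) = (dual n l, dual n k) \<longleftrightarrow> (k0, l0) = (k, l)"
    by auto
  moreover have "(if Q then 1 else 0) - c * (if P then 1 else 0) = - c0 * ((if P then 1 else 0) - c * (if Q then 1 else 0))"
    if "P \<longrightarrow> c0 = c" "Q \<longrightarrow> c0 * c = 1" for P Q and c c0 :: complex
    using that by (auto simp: algebra_simps)
  ultimately show "spog n k l (dual n l0, dual n k0) = - dsign n k0 l0 * spog n k l (k0, l0)"
    by (simp only:) simp
qed

lemma spo_part_subset_spo: "spo_part n p \<subseteq> spo n"
  unfolding spo_def using fs.span_superset by blast

definition spoX :: "nat \<Rightarrow> nat \<Rightarrow> nat \<Rightarrow> spoly \<Rightarrow> spoly"
  where "spoX n k l f = glE n k l f - dsign n k l \<odot> glE n (dual n l) (dual n k) f"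

lemma lin_spoX: "lin (spoX n k l)"
  unfolding spoX_def[abs_def] by (intro lin_diff_op lin_scale_op lin_glE)

lemma spo_act_spog: "k \<in> idx n \<Longrightarrow> l \<in> idx n \<Longrightarrow> spo_act n (spog n k l) f = spoX n k l f"
  by (simp add: spog_def spo_act_mat_linear spo_act_unit spoX_def)

text \<open>The factor 1/2 makes up for every matrix unit being counted once directly and once
  through its dual. Hence a space stable under all \<open>spoX\<close> is stable under
  spo(2n|1).\<close>

lemma spo_act_spoX:
  assumes "X \<in> spo_part n p"
  shows "spo_act n X f = (1/2) \<odot> (\<Sum>k\<in>idx n. \<Sum>l\<in>idx n. X (k, l) \<odot> spoX n k l f)"
proof -
  have "(\<Sum>k\<in>idx n. \<Sum>l\<in>idx n. X (k, l) \<odot> spoX n k l f) = (\<Sum>k\<in>idx n. \<Sum>l\<in>idx n. X (k, l) \<odot> glE n k l f)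
     - (\<Sum>k\<in>idx n. \<Sum>l\<in>idx n. (X (k, l) * dsign n k l) \<odot> glE n (dual n l) (dual n k) f)"
    by (simp add: spoX_def fscale_simps sum_subtractf)
  also have "(\<Sum>k\<in>idx n. \<Sum>l\<in>idx n. (X (k, l) * dsign n k l) \<odot> glE n (dual n l) (dual n k) f)
     = (\<Sum>k\<in>idx n. \<Sum>l\<in>idx n. (- X (dual n l, dual n k)) \<odot> glE n (dual n l) (dual n k) f)"
    using assms by (intro sum.cong) (auto simp: spo_part_iff mult.commute)
  also have "\<dots> = - (\<Sum>k\<in>idx n. \<Sum>l\<in>idx n. X (k, l) \<odot> glE n k l f)"
    using sum_sum_dual[of "\<lambda>k l. (- X (k, l)) \<odot> glE n k l f" n] by (simp add: sum_negf fs.scale_minus_left)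
  finally show ?thesis
    by (simp add: spo_act_glE fun_eq_iff fscale_def)
qed

subsection \<open>The operators of osp(2|2)\<close>

text \<open>\<open>Dop n False\<close> is \<open>D12\<close> and \<open>Dop n True\<close> is
  \<open>D22\<close>: two derivatives, of flags \<open>a\<close> and \<open>True\<close>, joined by
  the form B. The third combination, with both flags \<open>False\<close>, vanishes identically
  (\<open>D11_zero\<close>). Likewise \<open>Fop n False\<close> is \<open>F12\<close> and
  \<open>Fop n True\<close> is \<open>F21\<close>.\<close>

definition Dop :: "nat \<Rightarrow> bool \<Rightarrow> spoly \<Rightarrow> spoly"
  where "Dop n a f = (\<Sum>j\<in>idx n. bsign n j \<odot> derd (zgen n a j) (zgen n True (dual n j)) f)"

definition Fop :: "nat \<Rightarrow> bool \<Rightarrow> spoly \<Rightarrow> spoly"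
  where "Fop n a f = (\<Sum>i\<in>idx n. (- psign n i) \<odot> muld (zgen n a i) (zgen n (\<not> a) i) f)"

definition bdeg :: "nat \<Rightarrow> bool \<Rightarrow> smono \<Rightarrow> nat"
  where "bdeg n a s = (\<Sum>i\<in>idx n. gcount (zgen n a i) s)"

lemma lin_Dop: "lin (Dop n a)" and lin_Fop: "lin (Fop n a)"
  unfolding Dop_def[abs_def] Fop_def[abs_def] by (intro lin_sum_op lin_scale_op lin_derd lin_muld)+

lemmas DF_lins = lin_rules[OF lin_Dop] lin_rules[OF lin_Fop] lin_rules[OF lin_spoX]

lemma bsign_psign_simps:
  "j \<in> {1..n} \<Longrightarrow> bsign n j = 1" "j \<in> {1..n} \<Longrightarrow> bsign n (2*n+1-j) = -1" "bsign n (2*n+1) = 1"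
  "j \<in> {1..n} \<Longrightarrow> psign n j = 1" "j \<in> {1..n} \<Longrightarrow> psign n (2*n+1-j) = 1" "psign n (2*n+1) = -1"
  "j \<in> {1..n} \<Longrightarrow> dual n j = 2*n+1-j" "j \<in> {1..n} \<Longrightarrow> dual n (2*n+1-j) = j" "dual n (2*n+1) = 2*n+1"
  by (auto simp: bsign_def psign_def dual_def spo_par_def)

lemma zgen_simps:
  "j \<in> {1..n} \<Longrightarrow> zgen n False j = GX j" "j \<in> {1..n} \<Longrightarrow> zgen n False (2*n+1-j) = GX (2*n+1-j)"
  "zgen n False (2*n+1) = GH (2*n+1)"
  "j \<in> {1..n} \<Longrightarrow> zgen n True j = GH j" "j \<in> {1..n} \<Longrightarrow> zgen n True (2*n+1-j) = GH (2*n+1-j)"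
  "zgen n True (2*n+1) = GX (2*n+1)"
  by (auto simp: zgen_def gv_def gw_def)

lemma D12_eq: "D12 n f = Dop n False f"
proof -
  have "D12 n f = derd (GX (2*n+1)) (GH (2*n+1)) f
      + (\<Sum>j=1..n. derd (GX j) (GH (2*n+1-j)) f + (-1) \<odot> derd (GX (2*n+1-j)) (GH j) f)"
    by (simp add: D12_def derd_def fs.scale_minus_left)
  also have "derd (GX (2*n+1)) (GH (2*n+1)) f = 1 \<odot> derd (GH (2*n+1)) (GX (2*n+1)) f"
    by (subst derd_swap) (simp add: koszul_def)
  also have "\<dots> + (\<Sum>j=1..n. derd (GX j) (GH (2*n+1-j)) f + (-1) \<odot> derd (GX (2*n+1-j)) (GH j) f)
    = Dop n False f"
    unfolding Dop_def sum_idx by (subst add.commute) (simp add: bsign_psign_simps zgen_simps del: One_nat_def)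
  finally show ?thesis .
qed

lemma D22_eq: "D22 n f = Dop n True f"
proof -
  have "D22 n f = derd (GX (2*n+1)) (GX (2*n+1)) f + (\<Sum>j=1..n. 2 \<odot> derd (GH j) (GH (2*n+1-j)) f)"
    by (simp add: D22_def derd_def fs.scale_sum_right)
  also have "(\<Sum>j=1..n. 2 \<odot> derd (GH j) (GH (2*n+1-j)) f)
    = (\<Sum>j=1..n. derd (GH j) (GH (2*n+1-j)) f + (-1) \<odot> derd (GH (2*n+1-j)) (GH j) f)"
    by (intro sum.cong refl, subst derd_swap[of "GH (2*n+1-_)"])
      (auto simp: koszul_def fun_eq_iff fscale_def)
  also have "derd (GX (2*n+1)) (GX (2*n+1)) f + \<dots> = Dop n True f"
    unfolding Dop_def sum_idx by (subst add.commute) (simp add: bsign_psign_simps zgen_simps del: One_nat_def)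
  finally show ?thesis .
qed

lemma sum_idx_split_last:
  fixes h :: "nat \<Rightarrow> 'a::comm_monoid_add"
  shows "sum h (idx n) = (\<Sum>i=1..2*n. h i) + h (2*n+1)"
  by (simp add: idx_def)

lemma zgen_even: "i \<in> {1..2*n} \<Longrightarrow> zgen n a i = (if a then GH i else GX i)"
  by (auto simp: zgen_def gv_def gw_def)

lemma psign_even: "i \<in> {1..2*n} \<Longrightarrow> psign n i = 1"
  by (auto simp: psign_def spo_par_def)

lemma F12_eq: "F12 n f = Fop n False f"
  unfolding F12_def Fop_def sum_idx_split_last
  by (simp add: zgen_even psign_even bsign_psign_simps zgen_simps muld_def fs.scale_minus_left sum_negf del: One_nat_def)

lemma F21_eq: "F21 n f = Fop n True f"
  unfolding F21_def Fop_def sum_idx_split_last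
  by (simp add: zgen_even psign_even bsign_psign_simps zgen_simps muld_def fs.scale_minus_left sum_negf del: One_nat_def)

lemma sum_fun_apply: "(\<Sum>i\<in>I. f i) s = (\<Sum>i\<in>I. f i s)" for f :: "'i \<Rightarrow> 'a \<Rightarrow> complex"
  by (induction I rule: infinite_finite_induct) auto

lemma degop_apply: "(\<Sum>i\<in>idx n. muld (zgen n a i) (zgen n a i) f) s = of_nat (bdeg n a s) * f s"
  by (simp add: sum_fun_apply muld_diag bdeg_def sum_distrib_right)

lemma F11_apply: "F11 n f s = (of_nat (bdeg n False s) + (2 * of_nat n - 1) / 2) * f s"
proof -
  have "F11 n f = (\<Sum>i\<in>idx n. muld (zgen n False i) (zgen n False i) f) + ((2 * of_nat n - 1) / 2) \<odot> f"
    unfolding F11_def sum_idx_split_last by (simp add: zgen_even zgen_simps muld_def del: One_nat_def)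
  then show ?thesis by (simp add: degop_apply fscale_def distrib_right)
qed

lemma F22_apply: "F22 n f s = (of_nat (bdeg n True s) - (2 * of_nat n - 1) / 2) * f s"
proof -
  have "F22 n f = (\<Sum>i\<in>idx n. muld (zgen n True i) (zgen n True i) f) - ((2 * of_nat n - 1) / 2) \<odot> f"
    unfolding F22_def sum_idx_split_last by (simp add: zgen_even zgen_simps muld_def del: One_nat_def)
  then show ?thesis by (simp add: degop_apply fscale_def left_diff_distrib)
qed

lemma Dop_glE:
  assumes "k \<in> idx n" "l \<in> idx n"
  shows "Dop n a (glE n k l f) = koszul (\<not> a) (spo_par n k \<noteq> spo_par n l) \<odot> glE n k l (Dop n a f)
    + bsign n (dual n k) \<odot> derd (zgen n a (dual n k)) (zgen n True l) f
    + (koszul (\<not> spo_par n k) (a \<noteq> spo_par n k) * bsign n k) \<odot> derd (zgen n True (dual n k)) (zgen n a l) f"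
proof -
  define K where "K = koszul (\<not> a) (spo_par n k \<noteq> spo_par n l)"
  define K' where "K' = koszul (\<not> spo_par n k) (a \<noteq> spo_par n k)"
  have "bsign n j \<odot> derd (zgen n a j) (zgen n True (dual n j)) (muld (zgen n c k) (zgen n c l) f)
     = K \<odot> muld (zgen n c k) (zgen n c l) (bsign n j \<odot> derd (zgen n a j) (zgen n True (dual n j)) f)
      + (if j = dual n k then if c then bsign n (dual n k) \<odot> derd (zgen n a (dual n k)) (zgen n True l) f else 0 else 0)
      + (if j = k then if c = a then (K' * bsign n k) \<odot> derd (zgen n True (dual n k)) (zgen n a l) f else 0 else 0)"
    if j: "j \<in> idx n" for j c
  proof -
    have par: "(gpar (zgen n a j) \<noteq> gpar (zgen n True (dual n j))) = (\<not> a)"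
      "(gpar (zgen n c k) \<noteq> gpar (zgen n c l)) = (spo_par n k \<noteq> spo_par n l)"
      using assms j by auto
    have e: "zgen n True (dual n j) = zgen n c k \<longleftrightarrow> c \<and> j = dual n k" "zgen n a j = zgen n c k \<longleftrightarrow> c = a \<and> j = k"
      using assms j by (auto simp: dual_eq_iff)
    have K': "j = k \<Longrightarrow> c = a \<Longrightarrow> koszul (gpar (zgen n True (dual n j))) (gpar (zgen n c k)) = K'"
      using assms by (simp add: K'_def)
    show ?thesis
      by (subst derd_muld, simp only: par K_def[symmetric] e)
        (use K' in \<open>auto simp: lins fscale_simps mult.commute\<close>)
  qed
  then have "Dop n a (glE n k l f) = (\<Sum>j\<in>idx n. \<Sum>c\<in>UNIV.
      K \<odot> muld (zgen n c k) (zgen n c l) (bsign n j \<odot> derd (zgen n a j) (zgen n True (dual n j)) f)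
      + (if j = dual n k then if c then bsign n (dual n k) \<odot> derd (zgen n a (dual n k)) (zgen n True l) f else 0 else 0)
      + (if j = k then if c = a then (K' * bsign n k) \<odot> derd (zgen n True (dual n k)) (zgen n a l) f else 0 else 0))"
    unfolding Dop_def glE_def lins fs.scale_sum_right by (intro sum.cong refl) blast
  also have "\<dots> = (\<Sum>c\<in>UNIV. \<Sum>j\<in>idx n.
      K \<odot> muld (zgen n c k) (zgen n c l) (bsign n j \<odot> derd (zgen n a j) (zgen n True (dual n j)) f)
      + (if j = dual n k then if c then bsign n (dual n k) \<odot> derd (zgen n a (dual n k)) (zgen n True l) f else 0 else 0)
      + (if j = k then if c = a then (K' * bsign n k) \<odot> derd (zgen n True (dual n k)) (zgen n a l) f else 0 else 0))"
    by (rule sum.swap)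
  also have "\<dots> = K \<odot> glE n k l (Dop n a f)
    + bsign n (dual n k) \<odot> derd (zgen n a (dual n k)) (zgen n True l) f
    + (K' * bsign n k) \<odot> derd (zgen n True (dual n k)) (zgen n a l) f"
    unfolding sum.distrib glE_def Dop_def lins fs.scale_sum_right using assms by (simp add: UNIV_bool)
  finally show ?thesis unfolding K_def K'_def .
qed

text \<open>The correction terms \<open>R k l\<close> of a matrix unit and those of its dual agree
  up to \<open>dsign n k l\<close>, by supersymmetry of the product of two derivatives; they cancel
  in the difference that defines \<open>spoX\<close>.\<close>

lemma Dop_spoX:
  assumes kl: "k \<in> idx n" "l \<in> idx n"
  shows "Dop n a (spoX n k l f) = koszul (\<not> a) (spo_par n k \<noteq> spo_par n l) \<odot> spoX n k l (Dop n a f)"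
proof -
  define R where "R k l = bsign n (dual n k) \<odot> derd (zgen n a (dual n k)) (zgen n True l) f
    + (koszul (\<not> spo_par n k) (a \<noteq> spo_par n k) * bsign n k) \<odot> derd (zgen n True (dual n k)) (zgen n a l) f" for k l
  have 1: "derd (zgen n a l) (zgen n True (dual n k)) f = koszul (\<not> spo_par n k) (a \<noteq> spo_par n l) \<odot> derd (zgen n True (dual n k)) (zgen n a l) f"
    "derd (zgen n True l) (zgen n a (dual n k)) f = koszul (a \<noteq> spo_par n k) (\<not> spo_par n l) \<odot> derd (zgen n a (dual n k)) (zgen n True l) f"
    using kl derd_swap[of "zgen n a l" "zgen n True (dual n k)" f] derd_swap[of "zgen n True l" "zgen n a (dual n k)" f]
    by simp_all
  have c: "bsign n (dual n k) = dsign n k l * (koszul (\<not> spo_par n l) (a \<noteq> spo_par n l) * bsign n (dual n l) * koszul (a \<noteq> spo_par n k) (\<not> spo_par n l))"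
    "koszul (\<not> spo_par n k) (a \<noteq> spo_par n k) * bsign n k = dsign n k l * (bsign n l * koszul (\<not> spo_par n k) (a \<noteq> spo_par n l))"
    using kl unfolding dsign_def
    by (cases a; cases "spo_par n k"; cases "spo_par n l"; simp add: bsign_dual psign_def koszul_def bsign_odd mult.assoc)+
  have "R k l = dsign n k l \<odot> R (dual n l) (dual n k)"
    using kl by (simp only: R_def dual_dual 1 par_dual fs.scale_right_distrib fs.scale_scale c[symmetric] add.commute)
  moreover have "Dop n a (glE n k' l' f) = koszul (\<not> a) (spo_par n k' \<noteq> spo_par n l') \<odot> glE n k' l' (Dop n a f) + R k' l'"
    if "k' \<in> idx n" "l' \<in> idx n" for k' l'
    unfolding Dop_glE[OF that] R_def add.assoc ..
  moreover have "(spo_par n (dual n l) \<noteq> spo_par n (dual n k)) = (spo_par n k \<noteq> spo_par n l)"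
    using kl by auto
  ultimately show ?thesis
    using kl by (simp add: spoX_def DF_lins fscale_simps mult.commute)
qed

text \<open>\<open>Fop\<close> acts through the second tensor factor of E and thus supercommutes
  with all of gl(2n|1). In coordinates, the contraction at \<open>i = l\<close> with flag
  \<open>a\<close> and the one at \<open>i = k\<close> with the other flag give the same operator
  \<open>G\<close> with opposite signs.\<close>

lemma Fop_glE:
  assumes "k \<in> idx n" "l \<in> idx n"
  shows "Fop n a (glE n k l f) = koszul True (spo_par n k \<noteq> spo_par n l) \<odot> glE n k l (Fop n a f)"
proof -
  define K where "K = koszul True (spo_par n k \<noteq> spo_par n l)"
  have K: "K * psign n l = psign n k" by (simp add: K_def koszul_def psign_def)
  define G where "G = psign n k \<odot> muld (zgen n a k) (zgen n (\<not> a) l) f"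
  have "(- psign n i) \<odot> muld (zgen n a i) (zgen n (\<not> a) i) (muld (zgen n c k) (zgen n c l) f)
     = K \<odot> muld (zgen n c k) (zgen n c l) ((- psign n i) \<odot> muld (zgen n a i) (zgen n (\<not> a) i) f)
      + ((if i = l then if c = a then G else 0 else 0) - (if i = k then if c = (\<not> a) then G else 0 else 0))"
    if i: "i \<in> idx n" for i c
  proof -
    have par: "(gpar (zgen n a i) \<noteq> gpar (zgen n (\<not> a) i)) = True"
      "(gpar (zgen n c k) \<noteq> gpar (zgen n c l)) = (spo_par n k \<noteq> spo_par n l)"
      using assms i by auto
    have e: "zgen n (\<not> a) i = zgen n c k \<longleftrightarrow> c = (\<not> a) \<and> i = k" "zgen n a i = zgen n c l \<longleftrightarrow> c = a \<and> i = l"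
      using assms i by auto
    have GK: "(K * psign n l) \<odot> muld (zgen n a k) (zgen n (\<not> a) l) f = G"
      unfolding K G_def ..
    show ?thesis
      by (subst muld_muld, simp only: par K_def[symmetric] e)
        (use GK in \<open>auto simp: lins fscale_simps mult.commute G_def fs.scale_minus_left fs.scale_minus_right\<close>)
  qed
  then have "Fop n a (glE n k l f) = (\<Sum>i\<in>idx n. \<Sum>c\<in>UNIV.
      K \<odot> muld (zgen n c k) (zgen n c l) ((- psign n i) \<odot> muld (zgen n a i) (zgen n (\<not> a) i) f)
      + ((if i = l then if c = a then G else 0 else 0) - (if i = k then if c = (\<not> a) then G else 0 else 0)))"
    unfolding Fop_def glE_def lins fs.scale_sum_right by (intro sum.cong refl) blast
  also have "\<dots> = (\<Sum>c\<in>UNIV. \<Sum>i\<in>idx n.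
      K \<odot> muld (zgen n c k) (zgen n c l) ((- psign n i) \<odot> muld (zgen n a i) (zgen n (\<not> a) i) f)
      + ((if i = l then if c = a then G else 0 else 0) - (if i = k then if c = (\<not> a) then G else 0 else 0)))"
    by (rule sum.swap)
  also have "\<dots> = K \<odot> glE n k l (Fop n a f)"
    unfolding sum.distrib sum_subtractf glE_def Fop_def lins fs.scale_sum_right using assms by (simp add: UNIV_bool)
  finally show ?thesis unfolding K_def .
qed

lemma Fop_spoX:
  assumes kl: "k \<in> idx n" "l \<in> idx n"
  shows "Fop n a (spoX n k l f) = koszul True (spo_par n k \<noteq> spo_par n l) \<odot> spoX n k l (Fop n a f)"
proof -
  have "(spo_par n (dual n l) \<noteq> spo_par n (dual n k)) = (spo_par n k \<noteq> spo_par n l)"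
    using kl by auto
  then show ?thesis
    using kl by (simp add: spoX_def DF_lins Fop_glE fscale_simps mult.commute)
qed

section \<open>Relations among the operators of osp(2|2)\<close>

lemma muld_muld_sum:
  assumes "\<And>i. i \<in> idx n \<Longrightarrow> (gpar (a i) \<noteq> gpar (b i)) = p" "\<And>i. i \<in> idx n \<Longrightarrow> (gpar (c i) \<noteq> gpar (d i)) = q"
  shows "(\<Sum>i\<in>idx n. u i \<odot> muld (a i) (b i) (\<Sum>j\<in>idx n. v j \<odot> muld (c j) (d j) f))
    = (\<Sum>i\<in>idx n. \<Sum>j\<in>idx n. (u i * v j) \<odot> (if b i = c j then muld (a i) (d j) f else 0))
    + koszul p q \<odot> ((\<Sum>j\<in>idx n. v j \<odot> muld (c j) (d j) (\<Sum>i\<in>idx n. u i \<odot> muld (a i) (b i) f))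
      - (\<Sum>i\<in>idx n. \<Sum>j\<in>idx n. (u i * v j) \<odot> (if a i = d j then muld (c j) (b i) f else 0)))"
proof -
  have "u i \<odot> muld (a i) (b i) (v j \<odot> muld (c j) (d j) f) = (u i * v j) \<odot> (if b i = c j then muld (a i) (d j) f else 0)
    + koszul p q \<odot> (v j \<odot> muld (c j) (d j) (u i \<odot> muld (a i) (b i) f)
      - (u i * v j) \<odot> (if a i = d j then muld (c j) (b i) f else 0))"
    if "i \<in> idx n" "j \<in> idx n" for i j
  proof -
    have "muld (a i) (b i) (muld (c j) (d j) f) = (if b i = c j then muld (a i) (d j) f else 0)
      + koszul p q \<odot> (muld (c j) (d j) (muld (a i) (b i) f) - (if a i = d j then muld (c j) (b i) f else 0))"
      by (subst muld_muld) (simp only: assms that)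
    then show ?thesis by (simp add: lins fscale_simps mult.commute mult.left_commute)
  qed
  then have "(\<Sum>i\<in>idx n. u i \<odot> muld (a i) (b i) (\<Sum>j\<in>idx n. v j \<odot> muld (c j) (d j) f))
    = (\<Sum>i\<in>idx n. \<Sum>j\<in>idx n. (u i * v j) \<odot> (if b i = c j then muld (a i) (d j) f else 0)
    + koszul p q \<odot> (v j \<odot> muld (c j) (d j) (u i \<odot> muld (a i) (b i) f)
      - (u i * v j) \<odot> (if a i = d j then muld (c j) (b i) f else 0)))"
    unfolding lin_rules(6)[OF lin_muld] fs.scale_sum_right by (intro sum.cong refl) blast
  also have "\<dots> = (\<Sum>i\<in>idx n. \<Sum>j\<in>idx n. (u i * v j) \<odot> (if b i = c j then muld (a i) (d j) f else 0))
    + koszul p q \<odot> ((\<Sum>i\<in>idx n. \<Sum>j\<in>idx n. v j \<odot> muld (c j) (d j) (u i \<odot> muld (a i) (b i) f))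
      - (\<Sum>i\<in>idx n. \<Sum>j\<in>idx n. (u i * v j) \<odot> (if a i = d j then muld (c j) (b i) f else 0)))"
    by (simp only: sum.distrib sum_subtractf fs.scale_sum_right[symmetric])
  also have "(\<Sum>i\<in>idx n. \<Sum>j\<in>idx n. v j \<odot> muld (c j) (d j) (u i \<odot> muld (a i) (b i) f))
    = (\<Sum>j\<in>idx n. v j \<odot> muld (c j) (d j) (\<Sum>i\<in>idx n. u i \<odot> muld (a i) (b i) f))"
    by (subst sum.swap) (simp only: lin_rules(6)[OF lin_muld] fs.scale_sum_right)
  finally show ?thesis .
qed

lemma sum_sum_delta:
  assumes "\<And>i j. i \<in> idx n \<Longrightarrow> j \<in> idx n \<Longrightarrow> P i j \<longleftrightarrow> i = j"
  shows "(\<Sum>i\<in>idx n. \<Sum>j\<in>idx n. u i j \<odot> (if P i j then g i j else 0)) = (\<Sum>i\<in>idx n. u i i \<odot> g i i)"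
proof (rule sum.cong[OF refl])
  fix i assume "i \<in> idx n"
  then have "(\<Sum>j\<in>idx n. u i j \<odot> (if P i j then g i j else 0)) = (\<Sum>j\<in>idx n. if j = i then u i i \<odot> g i i else 0)"
    using assms by (intro sum.cong) auto
  then show "(\<Sum>j\<in>idx n. u i j \<odot> (if P i j then g i j else 0)) = u i i \<odot> g i i"
    using \<open>i \<in> idx n\<close> by simp
qed

lemma Fop_Fop: "Fop n a (Fop n (\<not> a) f) + Fop n (\<not> a) (Fop n a f) = (\<Sum>i\<in>idx n. glE n i i f)"
proof -
  have "Fop n a (Fop n (\<not> a) f) = (\<Sum>i\<in>idx n. \<Sum>j\<in>idx n. ((- psign n i) * (- psign n j)) \<odot>
        (if zgen n (\<not> a) i = zgen n (\<not> a) j then muld (zgen n a i) (zgen n (\<not> \<not> a) j) f else 0))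
    + koszul True True \<odot> (Fop n (\<not> a) (Fop n a f) - (\<Sum>i\<in>idx n. \<Sum>j\<in>idx n. ((- psign n i) * (- psign n j)) \<odot>
        (if zgen n a i = zgen n (\<not> \<not> a) j then muld (zgen n (\<not> a) j) (zgen n (\<not> a) i) f else 0)))"
    unfolding Fop_def by (rule muld_muld_sum) auto
  moreover have "(\<Sum>i\<in>idx n. \<Sum>j\<in>idx n. ((- psign n i) * (- psign n j)) \<odot>
        (if zgen n (\<not> a) i = zgen n (\<not> a) j then muld (zgen n a i) (zgen n (\<not> \<not> a) j) f else 0))
     = (\<Sum>i\<in>idx n. muld (zgen n a i) (zgen n a i) f)"
    by (subst sum_sum_delta) auto
  moreover have "(\<Sum>i\<in>idx n. \<Sum>j\<in>idx n. ((- psign n i) * (- psign n j)) \<odot>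
        (if zgen n a i = zgen n (\<not> \<not> a) j then muld (zgen n (\<not> a) j) (zgen n (\<not> a) i) f else 0))
     = (\<Sum>i\<in>idx n. muld (zgen n (\<not> a) i) (zgen n (\<not> a) i) f)"
    by (subst sum_sum_delta) auto
  moreover have "(\<Sum>i\<in>idx n. glE n i i f) = (\<Sum>i\<in>idx n. muld (zgen n a i) (zgen n a i) f) + (\<Sum>i\<in>idx n. muld (zgen n (\<not> a) i) (zgen n (\<not> a) i) f)"
    by (cases a) (simp_all add: glE_def UNIV_bool sum.distrib add.commute)
  ultimately show ?thesis by (simp add: koszul_def fs.scale_minus_left)
qed

text \<open>No contraction is possible, since the multiplications and the derivatives in
  \<open>Fop n a\<close> carry different flags; an odd first-order operator without contractions
  anticommutes with itself.\<close>

lemma Fop_square: "Fop n a (Fop n a f) = 0"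
proof -
  have "Fop n a (Fop n a f) = (\<Sum>i\<in>idx n. \<Sum>j\<in>idx n. ((- psign n i) * (- psign n j)) \<odot>
        (if zgen n (\<not> a) i = zgen n a j then muld (zgen n a i) (zgen n (\<not> a) j) f else 0))
    + koszul True True \<odot> (Fop n a (Fop n a f) - (\<Sum>i\<in>idx n. \<Sum>j\<in>idx n. ((- psign n i) * (- psign n j)) \<odot>
        (if zgen n a i = zgen n (\<not> a) j then muld (zgen n a j) (zgen n (\<not> a) i) f else 0)))"
    unfolding Fop_def by (rule muld_muld_sum) auto
  moreover have "(\<Sum>i\<in>idx n. \<Sum>j\<in>idx n. ((- psign n i) * (- psign n j)) \<odot>
        (if zgen n (\<not> a) i = zgen n a j then muld (zgen n a i) (zgen n (\<not> a) j) f else 0)) = 0"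
    by (intro sum.neutral ballI) auto
  moreover have "(\<Sum>i\<in>idx n. \<Sum>j\<in>idx n. ((- psign n i) * (- psign n j)) \<odot>
        (if zgen n a i = zgen n (\<not> a) j then muld (zgen n a j) (zgen n (\<not> a) i) f else 0)) = 0"
    by (intro sum.neutral ballI) auto
  ultimately have "Fop n a (Fop n a f) = - Fop n a (Fop n a f)"
    by (simp add: koszul_def fs.scale_minus_left)
  then show ?thesis by (simp add: fun_eq_iff)
qed

text \<open>A derivative of \<open>Dop\<close> is contracted with a multiplication of
  \<open>Fop\<close> when the flags match: the one of flag \<open>True\<close> if \<open>b\<close>
  holds, the one of flag \<open>a\<close> if \<open>a = b\<close>. The four relations below result
  by identifying the remaining products of derivatives as \<open>D12\<close>, \<open>D22\<close> or
  zero.\<close>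

lemma Dop_Fop:
  "Dop n a (Fop n b f) = koszul (\<not> a) True \<odot> Fop n b (Dop n a f)
    + (if b then \<Sum>j\<in>idx n. (- psign n j * bsign n j) \<odot> derd (zgen n a j) (zgen n False (dual n j)) f else 0)
    + (if a = b then \<Sum>j\<in>idx n. (if a then bsign n j else - psign n j * bsign n j) \<odot> derd (zgen n True (dual n j)) (zgen n (\<not> a) j) f else 0)"
proof -
  define K where "K = koszul (\<not> a) True"
  define G where "G j = (- psign n j * bsign n j) \<odot> derd (zgen n a j) (zgen n False (dual n j)) f" for j
  define H where "H j = (if a then bsign n j else - psign n j * bsign n j) \<odot> derd (zgen n True (dual n j)) (zgen n (\<not> a) j) f" for j
  have "bsign n j \<odot> derd (zgen n a j) (zgen n True (dual n j)) ((- psign n i) \<odot> muld (zgen n b i) (zgen n (\<not> b) i) f)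
    = K \<odot> ((- psign n i) \<odot> muld (zgen n b i) (zgen n (\<not> b) i) (bsign n j \<odot> derd (zgen n a j) (zgen n True (dual n j)) f))
     + (if i = dual n j then if b then G j else 0 else 0) + (if i = j then if a = b then H j else 0 else 0)"
    if ij: "i \<in> idx n" "j \<in> idx n" for i j
  proof -
    have par: "(gpar (zgen n a j) \<noteq> gpar (zgen n True (dual n j))) = (\<not> a)"
      "(gpar (zgen n b i) \<noteq> gpar (zgen n (\<not> b) i)) = True"
      using ij by auto
    have e: "zgen n True (dual n j) = zgen n b i \<longleftrightarrow> b \<and> i = dual n j" "zgen n a j = zgen n b i \<longleftrightarrow> a = b \<and> i = j"
      using ij by auto
    have H': "- (psign n j * bsign n j * koszul (gpar (zgen n True (dual n j))) (gpar (zgen n a j))) = (if a then bsign n j else - psign n j * bsign n j)"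
      using ij by (cases "spo_par n j") (auto simp: koszul_def psign_def)
    have H'': "H j = (- (psign n j * bsign n j * koszul (gpar (zgen n True (dual n j))) (gpar (zgen n a j))))
        \<odot> derd (zgen n True (dual n j)) (zgen n (\<not> a) j) f"
      unfolding H_def H' ..
    show ?thesis
      by (subst lin_rules(2)[OF lin_derd], subst derd_muld, simp only: par K_def[symmetric] e)
        (use ij in \<open>auto simp: lins fscale_simps G_def H'' mult_ac fs.scale_minus_left fs.scale_minus_right\<close>)
  qed
  then have "Dop n a (Fop n b f) = (\<Sum>j\<in>idx n. \<Sum>i\<in>idx n.
     K \<odot> ((- psign n i) \<odot> muld (zgen n b i) (zgen n (\<not> b) i) (bsign n j \<odot> derd (zgen n a j) (zgen n True (dual n j)) f))
     + (if i = dual n j then if b then G j else 0 else 0) + (if i = j then if a = b then H j else 0 else 0))"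
    unfolding Dop_def Fop_def lin_rules(6)[OF lin_derd] fs.scale_sum_right by (intro sum.cong refl) blast
  also have "\<dots> = K \<odot> (\<Sum>j\<in>idx n. \<Sum>i\<in>idx n.
     (- psign n i) \<odot> muld (zgen n b i) (zgen n (\<not> b) i) (bsign n j \<odot> derd (zgen n a j) (zgen n True (dual n j)) f))
     + (\<Sum>j\<in>idx n. if b then G j else 0) + (\<Sum>j\<in>idx n. if a = b then H j else 0)"
    unfolding sum.distrib fs.scale_sum_right by (simp cong: sum.cong)
  also have "\<dots> = K \<odot> Fop n b (Dop n a f) + (\<Sum>j\<in>idx n. if b then G j else 0) + (\<Sum>j\<in>idx n. if a = b then H j else 0)"
    unfolding Fop_def Dop_def lin_rules(6)[OF lin_muld] fs.scale_sum_right by (subst sum.swap) (rule refl)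
  finally show ?thesis unfolding K_def G_def H_def by (cases b; cases "a = b") simp_all
qed

lemma Dop_swap: "(\<Sum>j\<in>idx n. (psign n j * bsign n j) \<odot> derd (zgen n True (dual n j)) (zgen n True j) f) = - Dop n True f"
proof -
  have "Dop n True f = (\<Sum>j\<in>idx n. bsign n (dual n j) \<odot> derd (zgen n True (dual n j)) (zgen n True (dual n (dual n j))) f)"
    unfolding Dop_def by (rule sum_dual[symmetric])
  then show ?thesis
    by (simp add: bsign_dual fs.scale_minus_left sum_negf cong: sum.cong)
qed

lemma D12_F12: "Dop n False (Fop n False f) = - Fop n False (Dop n False f) + Dop n True f"
  using Dop_swap[of n f] by (simp add: Dop_Fop koszul_def fs.scale_minus_left sum_negf)

lemma D22_F12: "Dop n True (Fop n False f) = Fop n False (Dop n True f)"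
  by (simp add: Dop_Fop koszul_def)

text \<open>B is skew on the even basis vectors, whereas the derivatives of flag
  \<open>False\<close> commute there; for the last index the derivative is odd and squares to zero.
  So every term cancels against its dual.\<close>

lemma D11_zero: "(\<Sum>j\<in>idx n. (psign n j * bsign n j) \<odot> derd (zgen n False j) (zgen n False (dual n j)) f) = 0"
proof -
  let ?S = "\<Sum>j\<in>idx n. (psign n j * bsign n j) \<odot> derd (zgen n False j) (zgen n False (dual n j)) f"
  have "?S = (\<Sum>j\<in>idx n. (psign n (dual n j) * bsign n (dual n j)) \<odot> derd (zgen n False (dual n j)) (zgen n False (dual n (dual n j))) f)"
    by (rule sum_dual[symmetric])
  also have "\<dots> = (\<Sum>j\<in>idx n. - ((psign n j * bsign n j) \<odot> derd (zgen n False j) (zgen n False (dual n j)) f))"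
  proof (rule sum.cong[OF refl])
    fix j assume j: "j \<in> idx n"
    show "(psign n (dual n j) * bsign n (dual n j)) \<odot> derd (zgen n False (dual n j)) (zgen n False (dual n (dual n j))) f
      = - ((psign n j * bsign n j) \<odot> derd (zgen n False j) (zgen n False (dual n j)) f)"
      using j by (subst derd_swap) (auto simp: koszul_def bsign_dual psign_def fs.scale_minus_left)
  qed
  also have "\<dots> = - ?S" by (rule sum_negf)
  finally show ?thesis by (simp add: fun_eq_iff)
qed

lemma D12_F21: "Dop n False (Fop n True f) = - Fop n True (Dop n False f)"
  using D11_zero[of n f] by (simp add: Dop_Fop koszul_def fs.scale_minus_left sum_negf)

lemma Dop_mixed: "(\<Sum>j\<in>idx n. bsign n j \<odot> derd (zgen n True (dual n j)) (zgen n False j) f) = Dop n False f"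
  unfolding Dop_def
proof (rule sum.cong[OF refl])
  fix j assume "j \<in> idx n"
  then show "bsign n j \<odot> derd (zgen n True (dual n j)) (zgen n False j) f = bsign n j \<odot> derd (zgen n False j) (zgen n True (dual n j)) f"
    by (subst derd_swap) (auto simp: koszul_def)
qed

lemma Dop_mixed': "(\<Sum>j\<in>idx n. (psign n j * bsign n j) \<odot> derd (zgen n True j) (zgen n False (dual n j)) f) = - Dop n False f"
proof -
  have "(\<Sum>j\<in>idx n. (psign n j * bsign n j) \<odot> derd (zgen n True j) (zgen n False (dual n j)) f)
    = (\<Sum>j\<in>idx n. (psign n (dual n j) * bsign n (dual n j)) \<odot> derd (zgen n True (dual n j)) (zgen n False (dual n (dual n j))) f)"
    by (rule sum_dual[symmetric])
  also have "\<dots> = - (\<Sum>j\<in>idx n. bsign n j \<odot> derd (zgen n True (dual n j)) (zgen n False j) f)"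
    unfolding sum_negf[symmetric]
    by (rule sum.cong[OF refl]) (simp add: bsign_dual fs.scale_minus_left)
  finally show ?thesis unfolding Dop_mixed .
qed

text \<open>The factor 2 arises because both derivatives in \<open>D22\<close> can be contracted.
  The correction vanishes on the kernel of \<open>D12\<close>, so \<open>F21\<close> preserves the
  joint kernel of \<open>D12\<close> and \<open>D22\<close>.\<close>

lemma D22_F21: "Dop n True (Fop n True f) = Fop n True (Dop n True f) + 2 \<odot> Dop n False f"
  using Dop_mixed'[of n f] Dop_mixed[of n f]
  by (simp add: Dop_Fop koszul_def fs.scale_minus_left sum_negf) (simp add: fun_eq_iff fscale_def)

subsection \<open>The Casimir operator\<close>

lemma glE_glE_normal:
  assumes "i \<in> idx n" "j \<in> idx n" "k \<in> idx n" "l \<in> idx n"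
  shows "glE n k l (glE n i j f) = (if l = i then glE n k j f else 0)
    + (\<Sum>c\<in>UNIV. \<Sum>d\<in>UNIV. koszul (gpar (zgen n c l)) (gpar (zgen n d i)) \<odot> mmdd (zgen n c k) (zgen n d i) (zgen n c l) (zgen n d j) f)"
proof -
  have "muld (zgen n c k) (zgen n c l) (muld (zgen n d i) (zgen n d j) f)
    = (if d = c then if l = i then muld (zgen n c k) (zgen n c j) f else 0 else 0)
     + koszul (gpar (zgen n c l)) (gpar (zgen n d i)) \<odot> mmdd (zgen n c k) (zgen n d i) (zgen n c l) (zgen n d j) f" for c d
    unfolding muld_muld_normal using assms by simp
  then show ?thesis
    unfolding glE_def[of n k l] glE_def[of n i j] lins
    by (simp only: sum.distrib) (simp add: glE_def)
qed

lemma dsign_swap: "k \<in> idx n \<Longrightarrow> l \<in> idx n \<Longrightarrow> spoX n l k f = (- dsign n l k) \<odot> spoX n (dual n k) (dual n l) f"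
  using dsign_dual[of l n k] by (simp add: spoX_def fscale_simps fs.scale_minus_left mult.commute)

text \<open>Up to a sign, \<open>spoX n l k\<close> equals
  \<open>spoX n (dual n k) (dual n l)\<close>. So the second term of the left factor, combined with
  it, is the first term of the summand with indices \<open>dual n l\<close> and
  \<open>dual n k\<close>, and the two halves of the sum coincide.\<close>

lemma casimir_halve:
  "(\<Sum>k\<in>idx n. \<Sum>l\<in>idx n. psign n l \<odot> spoX n k l (spoX n l k f))
    = 2 \<odot> (\<Sum>k\<in>idx n. \<Sum>l\<in>idx n. psign n l \<odot> glE n k l (spoX n l k f))"
proof -
  have "psign n l \<odot> spoX n k l (spoX n l k f) = psign n l \<odot> glE n k l (spoX n l k f)
      + psign n (dual n k) \<odot> glE n (dual n l) (dual n k) (spoX n (dual n k) (dual n l) f)"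
    if "k \<in> idx n" "l \<in> idx n" for k l
  proof -
    have "psign n l * (dsign n k l * dsign n l k) = psign n (dual n k)"
      using that by (cases "spo_par n k"; cases "spo_par n l")
        (simp_all add: dsign_def koszul_def bsign_dual psign_def bsign_odd mult.assoc)
    moreover have "spoX n k l (spoX n l k f) = glE n k l (spoX n l k f)
      + (dsign n k l * dsign n l k) \<odot> glE n (dual n l) (dual n k) (spoX n (dual n k) (dual n l) f)"
      using that dsign_swap[of k n l f] by (simp add: spoX_def[of n k l] glE_lins fs.scale_minus_left)
    ultimately show ?thesis by (simp add: fscale_simps)
  qed
  then have "(\<Sum>k\<in>idx n. \<Sum>l\<in>idx n. psign n l \<odot> spoX n k l (spoX n l k f))
    = (\<Sum>k\<in>idx n. \<Sum>l\<in>idx n. psign n l \<odot> glE n k l (spoX n l k f))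
     + (\<Sum>k\<in>idx n. \<Sum>l\<in>idx n. psign n (dual n k) \<odot> glE n (dual n l) (dual n k) (spoX n (dual n k) (dual n l) f))"
    by (simp add: sum.distrib cong: sum.cong)
  then show ?thesis
    unfolding sum_sum_dual[of "\<lambda>k l. psign n l \<odot> glE n k l (spoX n l k f)"]
    by (simp add: fun_eq_iff fscale_def)
qed

definition degop :: "nat \<Rightarrow> bool \<Rightarrow> spoly \<Rightarrow> spoly"
  where "degop n a f = (\<Sum>i\<in>idx n. muld (zgen n a i) (zgen n a i) f)"

text \<open>The superdimension of V, the source of the factor \<open>2 * n - 1\<close> in the
  Casimir operator of gl(2n|1).\<close>

lemma sum_psign: "(\<Sum>l\<in>idx n. psign n l) = 2 * of_nat n - 1"
  unfolding sum_idx_split_last by (simp add: psign_even bsign_psign_simps del: One_nat_def)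

lemma sum_glE_diag: "(\<Sum>i\<in>idx n. glE n i i f) = degop n False f + degop n True f"
  by (simp add: glE_def degop_def UNIV_bool sum.distrib add.commute)

lemma muld_muld_normal_sum:
  assumes "\<And>i j. i \<in> idx n \<Longrightarrow> j \<in> idx n \<Longrightarrow> b i = c j \<longleftrightarrow> i = j"
  shows "(\<Sum>i\<in>idx n. u i \<odot> muld (a i) (b i) (\<Sum>j\<in>idx n. v j \<odot> muld (c j) (d j) f))
    = (\<Sum>i\<in>idx n. (u i * v i) \<odot> muld (a i) (d i) f)
    + (\<Sum>i\<in>idx n. \<Sum>j\<in>idx n. (u i * v j * koszul (gpar (b i)) (gpar (c j))) \<odot> mmdd (a i) (c j) (b i) (d j) f)"
proof -
  have "(\<Sum>i\<in>idx n. u i \<odot> muld (a i) (b i) (\<Sum>j\<in>idx n. v j \<odot> muld (c j) (d j) f))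
    = (\<Sum>i\<in>idx n. \<Sum>j\<in>idx n. (u i * v j) \<odot> (if b i = c j then muld (a i) (d j) f else 0)
       + (u i * v j * koszul (gpar (b i)) (gpar (c j))) \<odot> mmdd (a i) (c j) (b i) (d j) f)"
    by (simp add: lins muld_muld_normal fs.scale_sum_right fs.scale_right_distrib mult.assoc)
  also have "\<dots> = (\<Sum>i\<in>idx n. (u i * v i) \<odot> muld (a i) (d i) f)
    + (\<Sum>i\<in>idx n. \<Sum>j\<in>idx n. (u i * v j * koszul (gpar (b i)) (gpar (c j))) \<odot> mmdd (a i) (c j) (b i) (d j) f)"
    unfolding sum.distrib by (subst sum_sum_delta) (use assms in auto)
  finally show ?thesis .
qed

text \<open>The normally ordered part, for flags \<open>c\<close> and \<open>d\<close>, of the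
  Casimir operator of gl(2n|1). Exchanging its two derivatives matches the indices of
  multiplications and derivatives: for \<open>c = d\<close> it becomes the normally ordered part of
  the square of \<open>degop\<close>, otherwise that of a product of the two \<open>Fop\<close>.
  This is the Howe duality between gl(2n|1) and gl(1|1).\<close>

definition Qop :: "nat \<Rightarrow> bool \<Rightarrow> bool \<Rightarrow> spoly \<Rightarrow> spoly"
  where "Qop n c d f = (\<Sum>k\<in>idx n. \<Sum>l\<in>idx n. (psign n l * koszul (gpar (zgen n c l)) (gpar (zgen n d l)))
    \<odot> mmdd (zgen n c k) (zgen n d l) (zgen n c l) (zgen n d k) f)"

lemma Qop_same: "Qop n c c f = (if c then -1 else 1) \<odot> (degop n c (degop n c f) - degop n c f)"
proof -
  have "degop n c (degop n c f) = degop n c f + (\<Sum>k\<in>idx n. \<Sum>l\<in>idx n.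
     koszul (gpar (zgen n c k)) (gpar (zgen n c l)) \<odot> mmdd (zgen n c k) (zgen n c l) (zgen n c k) (zgen n c l) f)"
    using muld_muld_normal_sum[of n "zgen n c" "zgen n c" "\<lambda>_. 1" "zgen n c" "\<lambda>_. 1" "zgen n c" f] by (simp add: degop_def)
  moreover have "(psign n l * koszul (gpar (zgen n c l)) (gpar (zgen n c l))) \<odot> mmdd (zgen n c k) (zgen n c l) (zgen n c l) (zgen n c k) f
    = (if c then -1 else 1) \<odot> koszul (gpar (zgen n c k)) (gpar (zgen n c l)) \<odot> mmdd (zgen n c k) (zgen n c l) (zgen n c k) (zgen n c l) f"
    if "k \<in> idx n" "l \<in> idx n" for k l
  proof -
    have "mmdd (zgen n c k) (zgen n c l) (zgen n c l) (zgen n c k) f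
      = koszul (gpar (zgen n c k)) (gpar (zgen n c l)) \<odot> mmdd (zgen n c k) (zgen n c l) (zgen n c k) (zgen n c l) f"
      unfolding mmdd_def by (subst gder_gder[of "zgen n c l"]) (simp add: lins koszul_def)
    moreover have "psign n l * koszul (gpar (zgen n c l)) (gpar (zgen n c l)) = (if c then -1 else 1)"
      using that by (auto simp: koszul_def psign_def)
    ultimately show ?thesis by simp
  qed
  ultimately show ?thesis
    by (simp add: Qop_def fs.scale_sum_right cong: sum.cong)
qed

lemma Qop_diff: "Qop n c (\<not> c) f = (if c then 1 else -1) \<odot> (Fop n c (Fop n (\<not> c) f) - degop n c f)"
proof -
  have "Fop n c (Fop n (\<not> c) f) = degop n c f + (\<Sum>k\<in>idx n. \<Sum>l\<in>idx n.
     ((- psign n k) * (- psign n l) * koszul (gpar (zgen n (\<not> c) k)) (gpar (zgen n (\<not> c) l))) \<odot> mmdd (zgen n c k) (zgen n (\<not> c) l) (zgen n (\<not> c) k) (zgen n c l) f)"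
    using muld_muld_normal_sum[of n "zgen n (\<not> c)" "zgen n (\<not> c)" "\<lambda>i. - psign n i" "zgen n c" "\<lambda>i. - psign n i" "zgen n c" f]
    by (simp add: degop_def Fop_def)
  moreover have "(psign n l * koszul (gpar (zgen n c l)) (gpar (zgen n (\<not> c) l))) \<odot> mmdd (zgen n c k) (zgen n (\<not> c) l) (zgen n c l) (zgen n (\<not> c) k) f
    = (if c then 1 else -1) \<odot> ((- psign n k) * (- psign n l) * koszul (gpar (zgen n (\<not> c) k)) (gpar (zgen n (\<not> c) l))) \<odot> mmdd (zgen n c k) (zgen n (\<not> c) l) (zgen n (\<not> c) k) (zgen n c l) f"
    if "k \<in> idx n" "l \<in> idx n" for k l
  proof -
    have "mmdd (zgen n c k) (zgen n (\<not> c) l) (zgen n c l) (zgen n (\<not> c) k) f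
      = koszul (gpar (zgen n (\<not> c) k)) (gpar (zgen n c l)) \<odot> mmdd (zgen n c k) (zgen n (\<not> c) l) (zgen n (\<not> c) k) (zgen n c l) f"
      unfolding mmdd_def by (subst gder_gder[of "zgen n c l"]) (simp add: lins koszul_def)
    moreover have "psign n l * koszul (gpar (zgen n c l)) (gpar (zgen n (\<not> c) l)) * koszul (gpar (zgen n (\<not> c) k)) (gpar (zgen n c l))
      = (if c then 1 else -1) * ((- psign n k) * (- psign n l) * koszul (gpar (zgen n (\<not> c) k)) (gpar (zgen n (\<not> c) l)))"
      using that by (cases c; cases "spo_par n k"; cases "spo_par n l") (simp_all add: koszul_def psign_def)
    ultimately show ?thesis by simp
  qed
  ultimately show ?thesis
    by (simp add: Qop_def fs.scale_sum_right cong: sum.cong)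
qed

lemma casimir_first:
  "(\<Sum>k\<in>idx n. \<Sum>l\<in>idx n. psign n l \<odot> glE n k l (glE n l k f))
   = (2 * of_nat n - 1) \<odot> (degop n False f + degop n True f)
     + (Qop n False False f + Qop n False True f + Qop n True False f + Qop n True True f)"
proof -
  have "(\<Sum>k\<in>idx n. \<Sum>l\<in>idx n. psign n l \<odot> glE n k l (glE n l k f))
    = (\<Sum>k\<in>idx n. \<Sum>l\<in>idx n. psign n l \<odot> glE n k k f)
     + (\<Sum>k\<in>idx n. \<Sum>l\<in>idx n. \<Sum>c\<in>UNIV. \<Sum>d\<in>UNIV. (psign n l * koszul (gpar (zgen n c l)) (gpar (zgen n d l)))
    \<odot> mmdd (zgen n c k) (zgen n d l) (zgen n c l) (zgen n d k) f)"
    unfolding sum.distrib[symmetric]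
    by (intro sum.cong refl) (simp add: glE_glE_normal fscale_simps fs.scale_sum_right del: gpar_zgen)
  moreover have "(\<Sum>k\<in>idx n. \<Sum>l\<in>idx n. psign n l \<odot> glE n k k f) = (2 * of_nat n - 1) \<odot> (degop n False f + degop n True f)"
    unfolding fs.scale_sum_left[symmetric] sum_psign fs.scale_sum_right[symmetric] sum_glE_diag ..
  moreover have "(\<Sum>k\<in>idx n. \<Sum>l\<in>idx n. \<Sum>c\<in>UNIV. \<Sum>d\<in>UNIV. (psign n l * koszul (gpar (zgen n c l)) (gpar (zgen n d l)))
    \<odot> mmdd (zgen n c k) (zgen n d l) (zgen n c l) (zgen n d k) f)
    = Qop n False False f + Qop n False True f + Qop n True False f + Qop n True True f"
    unfolding Qop_def UNIV_bool by (simp add: sum.distrib del: gpar_zgen)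
  ultimately show ?thesis by simp
qed

text \<open>The derivatives in the normally ordered part carry the indices \<open>l\<close> and
  \<open>dual n l\<close>. Summed over \<open>l\<close> they form \<open>D22\<close>,
  \<open>D12\<close> or the vanishing combination, and they act on \<open>f\<close> first, so they
  contribute nothing; only the contraction at \<open>l = dual n k\<close> remains.\<close>

lemma casimir_second:
  assumes "Dop n False f = 0" "Dop n True f = 0"
  shows "(\<Sum>k\<in>idx n. \<Sum>l\<in>idx n. (psign n l * dsign n l k) \<odot> glE n k l (glE n (dual n k) (dual n l) f))
   = - (degop n False f + degop n True f)"
proof -
  have van: "(\<Sum>k\<in>idx n. \<Sum>l\<in>idx n. (psign n l * dsign n l k * koszul (gpar (zgen n c l)) (gpar (zgen n d (dual n k))))
    \<odot> mmdd (zgen n c k) (zgen n d (dual n k)) (zgen n c l) (zgen n d (dual n l)) f) = 0" for c d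
  proof (rule sum.neutral, rule ballI)
    fix k assume k: "k \<in> idx n"
    \<comment> \<open>The part of the sign that is independent of \<open>l\<close> and can leave the
      inner sum.\<close>
    define u where "u = - (bsign n (dual n k) * koszul c d * koszul c (spo_par n k))"
    have "(psign n l * dsign n l k * koszul (gpar (zgen n c l)) (gpar (zgen n d (dual n k))))
       \<odot> mmdd (zgen n c k) (zgen n d (dual n k)) (zgen n c l) (zgen n d (dual n l)) f
      = u \<odot> gmul (zgen n c k) (gmul (zgen n d (dual n k)) ((if d then bsign n l else psign n l * bsign n l) \<odot> derd (zgen n c l) (zgen n d (dual n l)) f))"
      if l: "l \<in> idx n" for l
    proof -
      have "psign n l * dsign n l k * koszul (gpar (zgen n c l)) (gpar (zgen n d (dual n k))) = u * (if d then bsign n l else psign n l * bsign n l)"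
        using k l by (cases c; cases d; cases "spo_par n k"; cases "spo_par n l")
          (simp_all add: dsign_def u_def koszul_def psign_def bsign_dual bsign_odd)
      then show ?thesis by (simp add: mmdd_def derd_def lins)
    qed
    then have "(\<Sum>l\<in>idx n. (psign n l * dsign n l k * koszul (gpar (zgen n c l)) (gpar (zgen n d (dual n k))))
       \<odot> mmdd (zgen n c k) (zgen n d (dual n k)) (zgen n c l) (zgen n d (dual n l)) f)
      = u \<odot> gmul (zgen n c k) (gmul (zgen n d (dual n k)) (\<Sum>l\<in>idx n. (if d then bsign n l else psign n l * bsign n l) \<odot> derd (zgen n c l) (zgen n d (dual n l)) f))"
      unfolding lin_rules(6)[OF lin_gmul] fs.scale_sum_right by (intro sum.cong refl) blast
    moreover have "(\<Sum>l\<in>idx n. (if d then bsign n l else psign n l * bsign n l) \<odot> derd (zgen n c l) (zgen n d (dual n l)) f) = 0"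
      using assms D11_zero[of n f] Dop_mixed'[of n f] by (cases c; cases d) (simp_all add: Dop_def)
    ultimately show "(\<Sum>l\<in>idx n. (psign n l * dsign n l k * koszul (gpar (zgen n c l)) (gpar (zgen n d (dual n k))))
       \<odot> mmdd (zgen n c k) (zgen n d (dual n k)) (zgen n c l) (zgen n d (dual n l)) f) = 0"
      by (simp only: lin_rules(3)[OF lin_gmul] fs.scale_zero_right)
  qed
  have "(\<Sum>k\<in>idx n. \<Sum>l\<in>idx n. (psign n l * dsign n l k) \<odot> glE n k l (glE n (dual n k) (dual n l) f))
    = (\<Sum>k\<in>idx n. \<Sum>l\<in>idx n. if l = dual n k then - glE n k k f else 0)
     + (\<Sum>k\<in>idx n. \<Sum>l\<in>idx n. \<Sum>c\<in>UNIV. \<Sum>d\<in>UNIV. (psign n l * dsign n l k * koszul (gpar (zgen n c l)) (gpar (zgen n d (dual n k))))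
    \<odot> mmdd (zgen n c k) (zgen n d (dual n k)) (zgen n c l) (zgen n d (dual n l)) f)"
    unfolding sum.distrib[symmetric]
  proof (intro sum.cong refl)
    fix k l assume kl: "k \<in> idx n" "l \<in> idx n"
    have "psign n (dual n k) * dsign n (dual n k) k = -1"
      using kl by (cases "spo_par n k") (simp_all add: dsign_def psign_def koszul_def bsign_dual bsign_odd)
    then have "(psign n l * dsign n l k) \<odot> (if l = dual n k then glE n k (dual n l) f else 0) = (if l = dual n k then - glE n k k f else 0)"
      by (auto simp: fs.scale_minus_left)
    then show "(psign n l * dsign n l k) \<odot> glE n k l (glE n (dual n k) (dual n l) f)
      = (if l = dual n k then - glE n k k f else 0) + (\<Sum>c\<in>UNIV. \<Sum>d\<in>UNIV. (psign n l * dsign n l k * koszul (gpar (zgen n c l)) (gpar (zgen n d (dual n k))))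
    \<odot> mmdd (zgen n c k) (zgen n d (dual n k)) (zgen n c l) (zgen n d (dual n l)) f)"
      using kl by (simp add: glE_glE_normal fs.scale_right_distrib fs.scale_sum_right del: gpar_zgen)
  qed
  moreover have "(\<Sum>k\<in>idx n. \<Sum>l\<in>idx n. \<Sum>c\<in>UNIV. \<Sum>d\<in>UNIV. (psign n l * dsign n l k * koszul (gpar (zgen n c l)) (gpar (zgen n d (dual n k))))
    \<odot> mmdd (zgen n c k) (zgen n d (dual n k)) (zgen n c l) (zgen n d (dual n l)) f) = 0"
    unfolding UNIV_bool by (simp add: sum.distrib van del: gpar_zgen)
  moreover have "(\<Sum>k\<in>idx n. \<Sum>l\<in>idx n. if l = dual n k then - glE n k k f else 0) = - (degop n False f + degop n True f)"
    unfolding sum_glE_diag[symmetric] sum_negf[symmetric] by simp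
  ultimately show ?thesis by simp
qed

text \<open>Before doubling, the scalar is the sum of \<open>(2*n-1) * (p+r)\<close> from the
  superdimension, \<open>p * (p-1)\<close> and \<open>- r * (r-1)\<close> from the flags
  \<open>c = d\<close>, \<open>p\<close> from each of the two mixed products (using that
  \<open>F21\<close> kills \<open>f\<close> and hence \<open>F21 F12 f = (p+r) f\<close>), and
  \<open>p + r\<close> from \<open>casimir_second\<close>.\<close>

lemma casimir:
  assumes D: "Dop n False f = 0" "Dop n True f = 0" and F: "Fop n True f = 0"
    and deg: "\<And>s. f s \<noteq> 0 \<Longrightarrow> bdeg n False s = p \<and> bdeg n True s = r"
  shows "(\<Sum>k\<in>idx n. \<Sum>l\<in>idx n. psign n l \<odot> spoX n k l (spoX n l k f))
    = (2 * (of_nat p * (of_nat p + 2 * of_nat n + 1) + of_nat r * (2 * of_nat n + 1 - of_nat r))) \<odot> f"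
proof -
  have deg: "degop n False f = of_nat p \<odot> f" "degop n True f = of_nat r \<odot> f"
    using deg by (fastforce simp: degop_def degop_apply fun_eq_iff fscale_def)+
  have degs: "degop n a (c \<odot> f) = c \<odot> degop n a f" for a c
    by (simp add: degop_def lins fs.scale_sum_right)
  have Fop: "Fop n True (Fop n False f) = of_nat p \<odot> f + of_nat r \<odot> f"
    using Fop_Fop[of n True f] F by (simp add: sum_glE_diag deg DF_lins)
  have "(\<Sum>k\<in>idx n. \<Sum>l\<in>idx n. psign n l \<odot> glE n k l (spoX n l k f))
    = (\<Sum>k\<in>idx n. \<Sum>l\<in>idx n. psign n l \<odot> glE n k l (glE n l k f))
      - (\<Sum>k\<in>idx n. \<Sum>l\<in>idx n. (psign n l * dsign n l k) \<odot> glE n k l (glE n (dual n k) (dual n l) f))"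
    unfolding sum_subtractf[symmetric] spoX_def by (simp add: glE_lins fscale_simps)
  also have "\<dots> = (of_nat p * (of_nat p + 2 * of_nat n + 1) + of_nat r * (2 * of_nat n + 1 - of_nat r)) \<odot> f"
    unfolding casimir_first casimir_second[OF D] Qop_same
      Qop_diff[of n False, simplified] Qop_diff[of n True, simplified] deg degs Fop F
    by (simp add: DF_lins fun_eq_iff fscale_def algebra_simps)
  finally show ?thesis by (simp add: casimir_halve)
qed

subsection \<open>Weights\<close>

definition index_count :: "nat \<Rightarrow> nat \<Rightarrow> smono \<Rightarrow> nat"
  where "index_count n j s = gcount (zgen n False j) s + gcount (zgen n True j) s"

text \<open>Kept for every index of V: the value at \<open>dual n j\<close> is the negative and the
  value at \<open>2*n+1\<close> is zero. Sums over all indices then respect the duality.\<close>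

definition wt :: "nat \<Rightarrow> nat \<Rightarrow> smono \<Rightarrow> int"
  where "wt n j s = int (index_count n j s) - int (index_count n (dual n j) s)"

definition wvec :: "nat \<Rightarrow> (nat \<Rightarrow> int) \<Rightarrow> spoly \<Rightarrow> bool"
  where "wvec n \<mu> f \<longleftrightarrow> (\<forall>s. f s \<noteq> 0 \<longrightarrow> (\<forall>j\<in>idx n. wt n j s = \<mu> j))"

text \<open>Restricted to the indices of V so that it is a finite sum on every monomial; on S(E) its
  parity is that of the number of odd generators (\<open>hpar_SE\<close>).\<close>

definition hdeg :: "nat \<Rightarrow> smono \<Rightarrow> nat"
  where "hdeg n s = (\<Sum>i\<in>idx n. gcount (GH i) s)"

lemma sum_of_bool_zgen: "k \<in> idx n \<Longrightarrow> (\<Sum>i\<in>idx n. of_bool (zgen n a i = zgen n c k)) = (of_bool (a = c) :: nat)"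
proof -
  assume k: "k \<in> idx n"
  then have "(\<Sum>i\<in>idx n. of_bool (zgen n a i = zgen n c k)) = (\<Sum>i\<in>idx n. if i = k then of_bool (a = c) else 0 :: nat)"
    by (intro sum.cong) auto
  with k show ?thesis by simp
qed

lemma sum_of_bool_GH: "k \<in> idx n \<Longrightarrow> (\<Sum>i\<in>idx n. of_bool (GH i = zgen n c k)) = (of_bool (c \<noteq> spo_par n k) :: nat)"
proof -
  assume k: "k \<in> idx n"
  then have "(\<Sum>i\<in>idx n. of_bool (GH i = zgen n c k)) = (\<Sum>i\<in>idx n. if i = k then of_bool (c \<noteq> spo_par n k) else 0 :: nat)"
    by (intro sum.cong) (auto simp: zgen_def gv_def gw_def spo_par_def idx_def)
  with k show ?thesis by simp
qed

lemma muld_zgen_supp: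
  assumes "muld (zgen n c k) (zgen n d l) f s \<noteq> 0" "k \<in> idx n" "l \<in> idx n"
  obtains s' where "f s' \<noteq> 0" "\<And>a. bdeg n a s + of_bool (a = d) = bdeg n a s' + of_bool (a = c)"
    "hdeg n s + of_bool (d \<noteq> spo_par n l) = hdeg n s' + of_bool (c \<noteq> spo_par n k)"
    "\<And>j. j \<in> idx n \<Longrightarrow> index_count n j s + of_bool (j = l) = index_count n j s' + of_bool (j = k)"
proof -
  obtain s' where s': "f s' \<noteq> 0" and g: "\<And>g. gcount g s + of_bool (g = zgen n d l) = gcount g s' + of_bool (g = zgen n c k)"
    using assms(1) by (rule muld_supp) blast
  have "bdeg n a s + of_bool (a = d) = bdeg n a s' + of_bool (a = c)" for a
    unfolding bdeg_def sum_of_bool_zgen[OF assms(2), of a c, symmetric] sum_of_bool_zgen[OF assms(3), of a d, symmetric]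
      sum.distrib[symmetric] by (simp only: g)
  moreover have "hdeg n s + of_bool (d \<noteq> spo_par n l) = hdeg n s' + of_bool (c \<noteq> spo_par n k)"
    unfolding hdeg_def sum_of_bool_GH[OF assms(2), of c, symmetric] sum_of_bool_GH[OF assms(3), of d, symmetric]
      sum.distrib[symmetric] by (simp only: g)
  moreover have "index_count n j s + of_bool (j = l) = index_count n j s' + of_bool (j = k)" if "j \<in> idx n" for j
    using g[of "zgen n False j"] g[of "zgen n True j"] that assms(2,3) by (cases c; cases d) (auto simp: index_count_def)
  ultimately show ?thesis using that s' by blast
qed

lemma glE_supp:
  assumes "glE n k l f s \<noteq> 0" "k \<in> idx n" "l \<in> idx n"
  obtains s' where "f s' \<noteq> 0" "\<And>a. bdeg n a s = bdeg n a s'"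
    "odd (hdeg n s) \<longleftrightarrow> odd (hdeg n s') \<noteq> (spo_par n k \<noteq> spo_par n l)"
    "\<And>j. j \<in> idx n \<Longrightarrow> index_count n j s + of_bool (j = l) = index_count n j s' + of_bool (j = k)"
proof -
  obtain c where "muld (zgen n c k) (zgen n c l) f s \<noteq> 0"
    using assms(1) unfolding glE_def sum_fun_apply by (meson sum.neutral)
  then obtain s' where s': "f s' \<noteq> 0" "\<And>a. bdeg n a s + of_bool (a = c) = bdeg n a s' + of_bool (a = c)"
    "hdeg n s + of_bool (c \<noteq> spo_par n l) = hdeg n s' + of_bool (c \<noteq> spo_par n k)"
    "\<And>j. j \<in> idx n \<Longrightarrow> index_count n j s + of_bool (j = l) = index_count n j s' + of_bool (j = k)"
    by (rule muld_zgen_supp[OF _ assms(2,3)]) blast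
  have "odd (hdeg n s) \<longleftrightarrow> odd (hdeg n s') \<noteq> (spo_par n k \<noteq> spo_par n l)"
    using arg_cong[OF s'(3), of odd] by (cases c; cases "spo_par n k"; cases "spo_par n l") auto
  with s' show ?thesis using that by simp
qed

text \<open>Both terms of \<open>spoX\<close> shift the weight by the same root, as
  \<open>wt\<close> changes sign under \<open>dual\<close>; the four indicators are this root, read
  at every index.\<close>

lemma spoX_supp:
  assumes "spoX n k l f s \<noteq> 0" "k \<in> idx n" "l \<in> idx n"
  obtains s' where "f s' \<noteq> 0" "\<And>a. bdeg n a s = bdeg n a s'"
    "odd (hdeg n s) \<longleftrightarrow> odd (hdeg n s') \<noteq> (spo_par n k \<noteq> spo_par n l)"
    "\<And>j. j \<in> idx n \<Longrightarrow> wt n j s = wt n j s' + of_bool (j = k) - of_bool (j = l) - of_bool (j = dual n k) + of_bool (j = dual n l)"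
proof -
  have dj: "dual n j = i \<longleftrightarrow> j = dual n i" for i j by (rule dual_eq_iff)
  have "glE n k l f s \<noteq> 0 \<or> glE n (dual n l) (dual n k) f s \<noteq> 0"
    using assms(1) by (auto simp: spoX_def fscale_def)
  then consider "glE n k l f s \<noteq> 0" | "glE n (dual n l) (dual n k) f s \<noteq> 0" by blast
  then show ?thesis
  proof cases
    case 1
    then obtain s' where s': "f s' \<noteq> 0" "\<And>a. bdeg n a s = bdeg n a s'"
      "odd (hdeg n s) \<longleftrightarrow> odd (hdeg n s') \<noteq> (spo_par n k \<noteq> spo_par n l)"
      "\<And>j. j \<in> idx n \<Longrightarrow> index_count n j s + of_bool (j = l) = index_count n j s' + of_bool (j = k)"
      by (rule glE_supp[OF _ assms(2,3)]) blast
    have "wt n j s = wt n j s' + of_bool (j = k) - of_bool (j = l) - of_bool (j = dual n k) + of_bool (j = dual n l)"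
      if j: "j \<in> idx n" for j
    proof -
      have "int (index_count n j s) + of_bool (j = l) = int (index_count n j s') + of_bool (j = k)"
        using arg_cong[OF s'(4)[OF j], of int] by simp
      moreover have "int (index_count n (dual n j) s) + of_bool (j = dual n l) = int (index_count n (dual n j) s') + of_bool (j = dual n k)"
        using arg_cong[OF s'(4)[of "dual n j"], of int] j by (simp add: dj)
      ultimately show ?thesis by (simp add: wt_def)
    qed
    with s' show ?thesis using that by blast
  next
    case 2
    then obtain s' where s': "f s' \<noteq> 0" "\<And>a. bdeg n a s = bdeg n a s'"
      "odd (hdeg n s) \<longleftrightarrow> odd (hdeg n s') \<noteq> (spo_par n (dual n l) \<noteq> spo_par n (dual n k))"
      "\<And>j. j \<in> idx n \<Longrightarrow> index_count n j s + of_bool (j = dual n k) = index_count n j s' + of_bool (j = dual n l)"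
      by (rule glE_supp) (use assms in auto)
    have "wt n j s = wt n j s' + of_bool (j = k) - of_bool (j = l) - of_bool (j = dual n k) + of_bool (j = dual n l)"
      if j: "j \<in> idx n" for j
    proof -
      have "int (index_count n j s) + of_bool (j = dual n k) = int (index_count n j s') + of_bool (j = dual n l)"
        using arg_cong[OF s'(4)[OF j], of int] by simp
      moreover have "int (index_count n (dual n j) s) + of_bool (j = k) = int (index_count n (dual n j) s') + of_bool (j = l)"
        using arg_cong[OF s'(4)[of "dual n j"], of int] j by simp
      ultimately show ?thesis by (simp add: wt_def)
    qed
    moreover have "odd (hdeg n s) \<longleftrightarrow> odd (hdeg n s') \<noteq> (spo_par n k \<noteq> spo_par n l)"
      using s'(3) assms by auto
    ultimately show ?thesis using that s' by blast
  qed
qed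

lemma Fop_supp:
  assumes "Fop n a f s \<noteq> 0"
  obtains s' where "f s' \<noteq> 0" "bdeg n a s = bdeg n a s' + 1" "bdeg n (\<not> a) s + 1 = bdeg n (\<not> a) s'"
    "odd (hdeg n s) \<longleftrightarrow> \<not> odd (hdeg n s')"
proof -
  obtain k where "k \<in> idx n" "((- psign n k) \<odot> muld (zgen n a k) (zgen n (\<not> a) k) f) s \<noteq> 0"
    using assms unfolding Fop_def sum_fun_apply by (meson sum.neutral)
  then have k: "k \<in> idx n" and m: "muld (zgen n a k) (zgen n (\<not> a) k) f s \<noteq> 0" by (auto simp: fscale_def)
  from m obtain s' where s': "f s' \<noteq> 0" "\<And>b. bdeg n b s + of_bool (b = (\<not> a)) = bdeg n b s' + of_bool (b = a)"
    "hdeg n s + of_bool ((\<not> a) \<noteq> spo_par n k) = hdeg n s' + of_bool (a \<noteq> spo_par n k)"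
    by (rule muld_zgen_supp[OF _ k k]) blast
  have "odd (hdeg n s) \<longleftrightarrow> \<not> odd (hdeg n s')"
    using arg_cong[OF s'(3), of odd] by (cases a; cases "spo_par n k") auto
  with s'(1) s'(2)[of a] s'(2)[of "\<not> a"] show ?thesis using that by auto
qed

lemma derd_supp:
  assumes "derd a b f s \<noteq> 0"
  obtains s' where "f s' \<noteq> 0" "\<And>g. gcount g s' = gcount g s + of_bool (g = a) + of_bool (g = b)"
proof -
  obtain t where t: "gder b f t \<noteq> 0" "\<And>g. gcount g t = gcount g s + of_bool (g = a)"
    using assms unfolding derd_def by (rule gder_supp) blast
  obtain s' where "f s' \<noteq> 0" "\<And>g. gcount g s' = gcount g t + of_bool (g = b)"
    using t(1) by (rule gder_supp) blast
  then show ?thesis using that t(2) by simp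
qed

lemma Dop_supp:
  assumes "Dop n a f s \<noteq> 0"
  obtains s' where "f s' \<noteq> 0" "\<And>b. bdeg n b s' = bdeg n b s + of_bool (b = a) + of_bool b"
    "odd (hdeg n s) \<longleftrightarrow> odd (hdeg n s') \<noteq> (\<not> a)"
proof -
  obtain j where "j \<in> idx n" "(bsign n j \<odot> derd (zgen n a j) (zgen n True (dual n j)) f) s \<noteq> 0"
    using assms unfolding Dop_def sum_fun_apply by (meson sum.neutral)
  then have j: "j \<in> idx n" "dual n j \<in> idx n" and derd: "derd (zgen n a j) (zgen n True (dual n j)) f s \<noteq> 0" by (auto simp: fscale_def)
  obtain s' where s': "f s' \<noteq> 0"
    and g: "\<And>g. gcount g s' = gcount g s + of_bool (g = zgen n a j) + of_bool (g = zgen n True (dual n j))"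
    using derd by (rule derd_supp) blast
  have 1: "bdeg n b s' = bdeg n b s + of_bool (b = a) + of_bool b" for b
    unfolding bdeg_def g sum.distrib sum_of_bool_zgen[OF j(1)] sum_of_bool_zgen[OF j(2)] by simp
  have "hdeg n s' = hdeg n s + of_bool (a \<noteq> spo_par n j) + of_bool (True \<noteq> spo_par n (dual n j))"
    unfolding hdeg_def g sum.distrib sum_of_bool_GH[OF j(1)] sum_of_bool_GH[OF j(2)] ..
  then have "odd (hdeg n s) \<longleftrightarrow> odd (hdeg n s') \<noteq> (\<not> a)"
    using j by (cases a; cases "spo_par n j") auto
  with s' 1 show ?thesis using that by blast
qed

lemma SE_muld: "f \<in> SE n \<Longrightarrow> k \<in> idx n \<Longrightarrow> muld (zgen n c k) b f \<in> SE n"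
  unfolding muld_def by (intro SE_gmul SE_gder zgen_gens)

lemma SE_glE: "f \<in> SE n \<Longrightarrow> k \<in> idx n \<Longrightarrow> glE n k l f \<in> SE n"
  unfolding glE_def by (intro fs.subspace_sum subspace_SE SE_muld)

lemma SE_spoX: "f \<in> SE n \<Longrightarrow> k \<in> idx n \<Longrightarrow> l \<in> idx n \<Longrightarrow> spoX n k l f \<in> SE n"
  unfolding spoX_def by (intro fs.subspace_diff fs.subspace_scale subspace_SE SE_glE) auto

lemma SE_Fop: "f \<in> SE n \<Longrightarrow> Fop n a f \<in> SE n"
  unfolding Fop_def by (intro fs.subspace_sum fs.subspace_scale subspace_SE SE_muld)

lemma glE_diag: "glE n j j f s = of_nat (index_count n j s) * f s"
  by (simp add: glE_def UNIV_bool muld_diag index_count_def algebra_simps)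

lemma spoX_diag: "spoX n j j f s = of_int (wt n j s) * f s"
  by (simp add: spoX_def glE_diag fscale_def dsign_def koszul_def wt_def algebra_simps)

subsection \<open>The space of lowest vectors for gl(1|1)\<close>

definition Low :: "nat \<Rightarrow> nat \<Rightarrow> nat \<Rightarrow> spoly set"
  where "Low n p r = {f \<in> SE n. Dop n False f = 0 \<and> Dop n True f = 0 \<and> Fop n True f = 0 \<and>
    (\<forall>s. f s \<noteq> 0 \<longrightarrow> bdeg n False s = p \<and> bdeg n True s = r)}"

text \<open>Asks for closure under the spanning operators, without a splitting by parity, so that
  irreducibility is shown even against ungraded subspaces.\<close>

definition spo_stable :: "nat \<Rightarrow> spoly set \<Rightarrow> bool"
  where "spo_stable n U \<longleftrightarrow> fs.subspace U \<and> (\<forall>k\<in>idx n. \<forall>l\<in>idx n. \<forall>f\<in>U. spoX n k l f \<in> U)"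

lemma subspace_Low: "fs.subspace (Low n p r)"
proof -
  have 1: "Low n p r = SE n \<inter> {f. Dop n False f = 0} \<inter> {f. Dop n True f = 0} \<inter> {f. Fop n True f = 0}
    \<inter> {f. \<forall>s. f s \<noteq> 0 \<longrightarrow> bdeg n False s = p \<and> bdeg n True s = r}"
    by (auto simp: Low_def)
  have ker: "fs.subspace {f. T f = 0}" if "lin T" for T :: "spoly \<Rightarrow> spoly"
    using that by (auto simp: fs.subspace_def lin_rules)
  then show ?thesis
    unfolding 1 by (intro fs.subspace_inter subspace_SE subspace_supported ker lin_Dop lin_Fop)
qed

lemma spo_stable_Low: "spo_stable n (Low n p r)"
  unfolding spo_stable_def
proof (intro conjI ballI subspace_Low)
  fix k l f assume kl: "k \<in> idx n" "l \<in> idx n" and f: "f \<in> Low n p r"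
  then have "Dop n a (spoX n k l f) = 0" "Fop n True (spoX n k l f) = 0" for a
    by (cases a; simp add: Dop_spoX Fop_spoX Low_def DF_lins)+
  moreover have "bdeg n False s = p \<and> bdeg n True s = r" if "spoX n k l f s \<noteq> 0" for s
    using that kl by (rule spoX_supp) (use f in \<open>auto simp: Low_def\<close>)
  ultimately show "spoX n k l f \<in> Low n p r"
    using f kl by (simp add: Low_def SE_spoX)
qed

lemma spo_stable_spo_act:
  assumes U: "spo_stable n U" and "X \<in> spo n" "f \<in> U"
  shows "spo_act n X f \<in> U"
proof -
  have sub: "fs.subspace U" using U by (simp add: spo_stable_def)
  have part: "spo_act n Y f \<in> U" if "Y \<in> spo_part n p" for Y p
    unfolding spo_act_spoX[OF that]
    using U \<open>f \<in> U\<close> by (intro fs.subspace_scale fs.subspace_sum sub) (simp add: spo_stable_def)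
  have "X \<in> fs.span (\<Union>p. spo_part n p)" using assms(2) by (simp add: spo_def)
  then show ?thesis
  proof (induction rule: fs.span_induct)
    case base
    have "spo_act n 0 f = 0" by (simp add: spo_act_def)
    then show ?case
      by (auto simp: fs.subspace_def spo_act_mat_linear intro: fs.subspace_0 fs.subspace_add fs.subspace_scale sub)
  next
    case (step Y)
    then show ?case using part by auto
  qed
qed

subsection \<open>Projection onto eigenspaces of diagonal operators\<close>

text \<open>The projection to an eigenspace is a polynomial in the operator, by Lagrange
  interpolation: only the finitely many other eigenvalues on the support of \<open>f\<close> have to
  be removed.\<close>

lemma diagonal_projection:
  fixes f :: "'a \<Rightarrow> complex"
  assumes U: "fs.subspace U" and w: "\<And>f. f \<in> U \<Longrightarrow> (\<lambda>s. w s * f s) \<in> U"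
    and f: "f \<in> U" "finite {s. f s \<noteq> 0}"
  shows "(\<lambda>s. if w s = a then f s else 0) \<in> U"
proof -
  have poly: "(\<lambda>s. (\<Prod>b\<in>B. w s - b) * f s) \<in> U" if "finite B" for B
    using that
  proof induction
    case empty
    then show ?case using f by simp
  next
    case (insert b B)
    have "(\<lambda>s. w s * ((\<Prod>b\<in>B. w s - b) * f s)) - b \<odot> (\<lambda>s. (\<Prod>b\<in>B. w s - b) * f s) \<in> U"
      by (intro fs.subspace_diff fs.subspace_scale U w insert.IH)
    also have "(\<lambda>s. w s * ((\<Prod>b\<in>B. w s - b) * f s)) - b \<odot> (\<lambda>s. (\<Prod>b\<in>B. w s - b) * f s)
      = (\<lambda>s. (\<Prod>b\<in>insert b B. w s - b) * f s)"
      using insert.hyps by (auto simp: fun_eq_iff fscale_def algebra_simps)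
    finally show ?case .
  qed
  define B where "B = w ` {s. f s \<noteq> 0} - {a}"
  define c where "c = (\<Prod>b\<in>B. a - b)"
  have "finite B" using f by (simp add: B_def)
  then have c: "c \<noteq> 0" by (auto simp: c_def B_def)
  have "(1 / c) \<odot> (\<lambda>s. (\<Prod>b\<in>B. w s - b) * f s) \<in> U"
    using poly \<open>finite B\<close> by (intro fs.subspace_scale U)
  also have "(1 / c) \<odot> (\<lambda>s. (\<Prod>b\<in>B. w s - b) * f s) = (\<lambda>s. if w s = a then f s else 0)"
  proof
    fix s
    show "((1 / c) \<odot> (\<lambda>s. (\<Prod>b\<in>B. w s - b) * f s)) s = (if w s = a then f s else 0)"
    proof (cases "w s = a \<or> f s = 0")
      case True
      then show ?thesis using c by (auto simp: fscale_def c_def)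
    next
      case False
      then have "w s \<in> B" by (auto simp: B_def)
      then have "(\<Prod>b\<in>B. w s - b) = 0" using \<open>finite B\<close> by auto
      then show ?thesis using False by (simp add: fscale_def)
    qed
  qed
  finally show ?thesis .
qed

text \<open>Set to zero outside \<open>idx n\<close>, so that a weight is one function and weights
  can be compared and collected by equality.\<close>

definition wtf :: "nat \<Rightarrow> smono \<Rightarrow> nat \<Rightarrow> int"
  where "wtf n s = (\<lambda>j. if j \<in> idx n then wt n j s else 0)"

text \<open>One coordinate at a time: \<open>spoX n k k\<close> is diagonal with eigenvalue
  \<open>wt n k\<close>, so the eigenspace projections for \<open>k\<close> in \<open>idx n\<close>
  are applied in succession.\<close>

lemma weight_projection:
  assumes U: "spo_stable n U" and f: "f \<in> U" "finite {s. f s \<noteq> 0}"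
  shows "(\<lambda>s. if wtf n s = \<mu> then f s else 0) \<in> U"
proof -
  have sub: "fs.subspace U" using U by (simp add: spo_stable_def)
  have K: "(\<lambda>s. if \<forall>j\<in>K. wt n j s = \<mu> j then f s else 0) \<in> U" if "finite K" "K \<subseteq> idx n" for K
    using that
  proof induction
    case empty
    then show ?case using f by simp
  next
    case (insert k K)
    define g where "g = (\<lambda>s. if \<forall>j\<in>K. wt n j s = \<mu> j then f s else 0)"
    have "(\<lambda>s. if of_int (wt n k s) = (of_int (\<mu> k) :: complex) then g s else 0) \<in> U"
    proof (rule diagonal_projection[OF sub])
      fix h assume "h \<in> U"
      then have "spoX n k k h \<in> U" using U insert.prems by (simp add: spo_stable_def)
      moreover have "spoX n k k h = (\<lambda>s. of_int (wt n k s) * h s)" by (rule ext) (rule spoX_diag)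
      ultimately show "(\<lambda>s. of_int (wt n k s) * h s) \<in> U" by simp
    next
      show "g \<in> U" using insert by (simp add: g_def)
      show "finite {s. g s \<noteq> 0}"
        by (rule finite_subset[OF _ f(2)]) (auto simp: g_def)
    qed
    also have "(\<lambda>s. if of_int (wt n k s) = (of_int (\<mu> k) :: complex) then g s else 0)
      = (\<lambda>s. if \<forall>j\<in>insert k K. wt n j s = \<mu> j then f s else 0)"
      by (auto simp: g_def fun_eq_iff)
    finally show ?case .
  qed
  show ?thesis
  proof (cases "\<forall>j. j \<notin> idx n \<longrightarrow> \<mu> j = 0")
    case True
    then have "(wtf n s = \<mu>) = (\<forall>j\<in>idx n. wt n j s = \<mu> j)" for s
      by (auto simp: wtf_def fun_eq_iff)
    then show ?thesis using K[of "idx n"] by simp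
  next
    case False
    then have "wtf n s \<noteq> \<mu>" for s by (auto simp: wtf_def)
    then show ?thesis using fs.subspace_0[OF sub] by (simp add: zero_fun_def)
  qed
qed

lemma exists_weight_vector:
  assumes U: "spo_stable n U" "spo_stable n U'" "U' \<subseteq> SE n" and g: "g \<in> U'" "g \<notin> U"
  obtains f \<mu> where "f \<in> U'" "f \<notin> U" "wvec n \<mu> f"
proof -
  define M where "M = wtf n ` {s. g s \<noteq> 0}"
  have fin: "finite {s. g s \<noteq> 0}" using g U by (auto simp: SE_def)
  define h where "h \<mu> = (\<lambda>s. if wtf n s = \<mu> then g s else 0)" for \<mu>
  have "g = (\<Sum>\<mu>\<in>M. h \<mu>)"
  proof
    fix s
    have "(\<Sum>\<mu>\<in>M. h \<mu> s) = (\<Sum>\<mu>\<in>M. if \<mu> = wtf n s then g s else 0)"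
      by (intro sum.cong) (auto simp: h_def)
    also have "\<dots> = g s" using fin by (auto simp: M_def)
    finally show "g s = (\<Sum>\<mu>\<in>M. h \<mu>) s" by (simp add: sum_fun_apply)
  qed
  moreover have "(\<Sum>\<mu>\<in>M. h \<mu>) \<in> U" if "\<And>\<mu>. h \<mu> \<in> U"
    using that U by (intro fs.subspace_sum) (auto simp: spo_stable_def)
  ultimately obtain \<mu> where "h \<mu> \<notin> U" using g by auto
  moreover have "h \<mu> \<in> U'"
    unfolding h_def by (rule weight_projection) (use U g fin in auto)
  moreover have "wvec n \<mu> (h \<mu>)"
    by (auto simp: wvec_def h_def wtf_def split: if_splits)
  ultimately show ?thesis using that by blast
qed

subsection \<open>Maximal vectors modulo a submodule\<close>

text \<open>The values are \<open>n, ..., 1\<close> for the indices \<open>1, ..., n\<close>, then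
  \<open>-1, ..., -n\<close>, and \<open>0\<close> for the odd index. So the odd basis vector is
  placed in the middle, as the Borel subalgebra demands, and the raising operators are the
  \<open>spoX n k l\<close> with \<open>height n k > height n l\<close>.\<close>

definition height :: "nat \<Rightarrow> nat \<Rightarrow> int"
  where "height n j = (if j \<le> n then int n + 1 - int j else if j \<le> 2*n then int n - int j else 0)"

definition mono_height :: "nat \<Rightarrow> smono \<Rightarrow> int"
  where "mono_height n s = (\<Sum>j\<in>idx n. height n j * wt n j s)"

lemma height_dual: "j \<in> idx n \<Longrightarrow> height n (dual n j) = - height n j"
  by (auto simp: height_def dual_def idx_def)

lemma height_inj: "j \<in> idx n \<Longrightarrow> k \<in> idx n \<Longrightarrow> height n j = height n k \<Longrightarrow> j = k"
  by (auto simp: height_def idx_def split: if_splits)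

lemma mono_height_bound:
  assumes "f \<in> Low n p r" "f s \<noteq> 0"
  shows "mono_height n s \<le> int (2 * n * (p + r))"
proof -
  have "mono_height n s \<le> (\<Sum>j\<in>idx n. int n * (int (index_count n j s) + int (index_count n (dual n j) s)))"
    unfolding mono_height_def
  proof (rule sum_mono)
    fix j assume "j \<in> idx n"
    then have height: "\<bar>height n j\<bar> \<le> int n" by (auto simp: height_def idx_def)
    have "height n j * wt n j s \<le> \<bar>height n j\<bar> * \<bar>wt n j s\<bar>" by (metis abs_ge_self abs_mult)
    also have "\<dots> \<le> int n * (int (index_count n j s) + int (index_count n (dual n j) s))"
      by (rule mult_mono[OF height]) (auto simp: wt_def)
    finally show "height n j * wt n j s \<le> int n * (int (index_count n j s) + int (index_count n (dual n j) s))" .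
  qed
  also have "\<dots> = int n * (\<Sum>j\<in>idx n. int (index_count n j s)) + int n * (\<Sum>j\<in>idx n. int (index_count n (dual n j) s))"
    by (simp add: sum.distrib sum_distrib_left algebra_simps)
  also have "\<dots> = 2 * int n * (\<Sum>j\<in>idx n. int (index_count n j s))"
    unfolding sum_dual[of "\<lambda>j. int (index_count n j s)"] by simp
  also have "(\<Sum>j\<in>idx n. int (index_count n j s)) = int (p + r)"
  proof -
    have "bdeg n False s = p" "bdeg n True s = r" using assms unfolding Low_def by blast+
    then show ?thesis by (simp add: index_count_def sum.distrib bdeg_def flip: of_nat_sum)
  qed
  finally show ?thesis by simp
qed

lemma sum_mult_of_bool:
  "k \<in> idx n \<Longrightarrow> (\<Sum>j\<in>idx n. h j * of_bool (j = k)) = (h k :: int)"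
proof -
  assume "k \<in> idx n"
  moreover have "(\<Sum>j\<in>idx n. h j * of_bool (j = k)) = (\<Sum>j\<in>idx n. if j = k then h k else 0)"
    by (intro sum.cong) auto
  ultimately show ?thesis by simp
qed

text \<open>The factor 2 appears because \<open>mono_height\<close> sums over an index and its dual,
  while \<open>height\<close> and \<open>wt\<close> both change sign under
  \<open>dual\<close>.\<close>

lemma spoX_raise:
  assumes f: "wvec n \<mu> f" and kl: "k \<in> idx n" "l \<in> idx n"
  shows "\<exists>\<mu>'. wvec n \<mu>' (spoX n k l f)"
    and "spoX n k l f s \<noteq> 0 \<Longrightarrow> f t \<noteq> 0 \<Longrightarrow> mono_height n s = mono_height n t + 2 * (height n k - height n l)"
proof -
  let ?d = "\<lambda>j. of_bool (j = k) - of_bool (j = l) - of_bool (j = dual n k) + of_bool (j = dual n l) :: int"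
  have w: "wt n j s = \<mu> j + ?d j" if s: "spoX n k l f s \<noteq> 0" and "j \<in> idx n" for s j
    using s kl by (rule spoX_supp) (use that f in \<open>auto simp: wvec_def\<close>)
  then show "\<exists>\<mu>'. wvec n \<mu>' (spoX n k l f)" by (auto simp: wvec_def intro: exI[of _ "\<lambda>j. \<mu> j + ?d j"])
  assume s: "spoX n k l f s \<noteq> 0" and t: "f t \<noteq> 0"
  have "mono_height n s = (\<Sum>j\<in>idx n. height n j * \<mu> j + height n j * of_bool (j = k) - height n j * of_bool (j = l)
     - height n j * of_bool (j = dual n k) + height n j * of_bool (j = dual n l))"
    unfolding mono_height_def by (intro sum.cong refl) (simp add: w[OF s] algebra_simps)
  also have "\<dots> = (\<Sum>j\<in>idx n. height n j * \<mu> j) + height n k - height n l - height n (dual n k) + height n (dual n l)"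
    using kl by (simp only: sum.distrib sum_subtractf sum_mult_of_bool dual_idx)
  also have "(\<Sum>j\<in>idx n. height n j * \<mu> j) = mono_height n t"
  proof -
    have "wt n j t = \<mu> j" if "j \<in> idx n" for j
      using f t that unfolding wvec_def by blast
    then show ?thesis by (simp add: mono_height_def)
  qed
  finally show "mono_height n s = mono_height n t + 2 * (height n k - height n l)"
    using kl by (simp add: height_dual)
qed

lemma exists_maximal_vector:
  assumes U: "spo_stable n U" "spo_stable n U'" "U' \<subseteq> Low n p r" and ne: "\<not> U' \<subseteq> U"
  obtains f \<mu> where "f \<in> U'" "f \<notin> U" "wvec n \<mu> f"
    "\<And>k l. k \<in> idx n \<Longrightarrow> l \<in> idx n \<Longrightarrow> height n k > height n l \<Longrightarrow> spoX n k l f \<in> U"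
proof -
  \<comment> \<open>The height is read off a monomial, so a candidate is a weight vector together
    with one monomial of its support. Maximal height is turned into a least natural number by
    \<open>m\<close>; \<open>mono_height_bound\<close> keeps \<open>nat\<close> from
    truncating.\<close>
  define P where "P = (\<lambda>(f, s). f \<in> U' \<and> f \<notin> U \<and> (\<exists>\<mu>. wvec n \<mu> f) \<and> f s \<noteq> 0)"
  define m where "m = (\<lambda>(f :: spoly, s). nat (int (2 * n * (p + r)) - mono_height n s))"
  have U0: "0 \<in> U" using U fs.subspace_0 by (auto simp: spo_stable_def)
  obtain g where "g \<in> U'" "g \<notin> U" using ne by blast
  moreover have "U' \<subseteq> SE n" using U by (auto simp: Low_def)
  ultimately obtain f \<mu> where "f \<in> U'" "f \<notin> U" "wvec n \<mu> f"
    using exists_weight_vector U by metis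
  moreover have "\<exists>s. f s \<noteq> 0" using \<open>f \<notin> U\<close> U0 by (metis ext zero_fun_apply)
  ultimately have "\<exists>x. P x" by (auto simp: P_def)
  then obtain x where x: "P x" "\<And>y. P y \<Longrightarrow> m x \<le> m y"
    using ex_has_least_nat[of P _ m] by blast
  obtain f s where fs: "x = (f, s)" by (cases x) auto
  obtain \<mu> where f: "f \<in> U'" "f \<notin> U" "wvec n \<mu> f" "f s \<noteq> 0" using x fs by (auto simp: P_def)
  show ?thesis
  proof (rule that[OF f(1-3)], rule ccontr)
    fix k l assume kl: "k \<in> idx n" "l \<in> idx n" "height n k > height n l" and nU: "spoX n k l f \<notin> U"
    have U': "spoX n k l f \<in> U'" using U kl f by (simp add: spo_stable_def)
    obtain t where t: "spoX n k l f t \<noteq> 0" using nU U0 by (metis ext zero_fun_apply)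
    have "P (spoX n k l f, t)" using spoX_raise(1)[OF f(3) kl(1,2)] U' nU t by (auto simp: P_def)
    then have "m (f, s) \<le> m (spoX n k l f, t)" using x fs by blast
    moreover have "mono_height n t > mono_height n s" using spoX_raise(2)[OF f(3) kl(1,2) t f(4)] kl by simp
    moreover have "mono_height n t \<le> int (2 * n * (p + r))"
      using mono_height_bound[of "spoX n k l f" n p r t] t U U' by blast
    ultimately show False by (simp add: m_def)
  qed
qed

text \<open>If \<open>l = dual n k\<close>, the root is long: the two terms of
  \<open>spoX n k l\<close> coincide, the operator is twice a matrix unit, and the Cartan term
  doubles.\<close>

lemma spoX_spoX_opposite:
  assumes kl: "k \<in> idx n" "l \<in> idx n" "k \<noteq> l"
  defines "K \<equiv> psign n k * psign n l"
  shows "spoX n k l (spoX n l k f) = K \<odot> spoX n l k (spoX n k l f)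
    + (if l = dual n k then 2 else 1) \<odot> (spoX n k k f - K \<odot> spoX n l l f)"
proof -
  have idx: "dual n k \<in> idx n" "dual n l \<in> idx n" using kl by simp_all
  have K: "koszul (spo_par n k \<noteq> spo_par n l) (spo_par n k \<noteq> spo_par n l) = K"
    "koszul (spo_par n l \<noteq> spo_par n k) (spo_par n l \<noteq> spo_par n k) = K"
    "koszul (spo_par n k \<noteq> spo_par n l) (spo_par n l \<noteq> spo_par n k) = K"
    "koszul (spo_par n l \<noteq> spo_par n k) (spo_par n k \<noteq> spo_par n l) = K"
    by (cases "spo_par n k"; cases "spo_par n l"; simp add: K_def koszul_def psign_def)+
  have c: "dsign n k l * dsign n l k = K" "dsign n k k = 1" "dsign n l l = 1"
    using kl by (cases "spo_par n k"; cases "spo_par n l";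
      simp add: dsign_def K_def koszul_def psign_def bsign_dual bsign_odd mult.assoc)+
  have d: "k = dual n l \<longleftrightarrow> l = dual n k" "dual n l = k \<longleftrightarrow> l = dual n k" "dual n k = l \<longleftrightarrow> l = dual n k"
    by (metis dual_dual)+
  have 1: "glE n k l (glE n l k f) = glE n k k f + K \<odot> (glE n l k (glE n k l f) - glE n l l f)"
    using glE_glE[of k n l l k f, unfolded K] kl by simp
  have 2: "glE n k l (glE n (dual n k) (dual n l) f) = (if l = dual n k then glE n k k f else 0)
     + K \<odot> (glE n (dual n k) (dual n l) (glE n k l f) - (if l = dual n k then glE n l l f else 0))"
    using glE_glE[of k n l "dual n k" "dual n l" f, unfolded par_dual[OF kl(1)] par_dual[OF kl(2)] K] kl idx by (auto simp: d)
  have 3: "glE n (dual n l) (dual n k) (glE n l k f) = (if l = dual n k then glE n k k f else 0)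
     + K \<odot> (glE n l k (glE n (dual n l) (dual n k) f) - (if l = dual n k then glE n l l f else 0))"
    using glE_glE[of "dual n l" n "dual n k" l k f, unfolded par_dual[OF kl(1)] par_dual[OF kl(2)] K] kl idx by (auto simp: d)
  have 4: "glE n (dual n l) (dual n k) (glE n (dual n k) (dual n l) f) = glE n (dual n l) (dual n l) f
     + K \<odot> (glE n (dual n k) (dual n l) (glE n (dual n l) (dual n k) f) - glE n (dual n k) (dual n k) f)"
    using glE_glE[of "dual n l" n "dual n k" "dual n k" "dual n l" f, unfolded par_dual[OF kl(1)] par_dual[OF kl(2)] K] kl idx by (simp)
  have KK: "K * K = 1" by (simp add: K_def psign_def)
  show ?thesis
  proof (cases "l = dual n k")
    case True
    then have ev: "\<not> spo_par n k" "\<not> spo_par n l"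
      using kl by (auto simp: spo_par_def dual_def idx_def split: if_splits)
    have cm: "dsign n k l = -1" "dsign n l k = -1" "K = 1"
      using kl True ev by (simp_all add: dsign_def koszul_def psign_def bsign_dual K_def)
    show ?thesis
    proof -
      have l: "dual n k = l" "dual n l = k" using True by simp_all
      have "spoX n k l g = 2 \<odot> glE n k l g" "spoX n l k g = 2 \<odot> glE n l k g" for g
        unfolding spoX_def cm l by (simp_all add: fun_eq_iff fscale_def)
      then have A: "spoX n k l (spoX n l k f) = 4 \<odot> glE n k l (glE n l k f)" "spoX n l k (spoX n k l f) = 4 \<odot> glE n l k (glE n k l f)"
        by (simp_all add: glE_lins)
      have B: "spoX n k k f = glE n k k f - glE n l l f" "spoX n l l f = glE n l l f - glE n k k f"
        unfolding spoX_def c l by simp_all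
      show ?thesis
        unfolding A B 1 cm if_P[OF True] by (simp add: fun_eq_iff fscale_def algebra_simps)
    qed
  next
    case False
    have A: "spoX n k l (spoX n l k f) = glE n k l (glE n l k f) - dsign n l k \<odot> glE n k l (glE n (dual n k) (dual n l) f)
       - dsign n k l \<odot> glE n (dual n l) (dual n k) (glE n l k f)
       + K \<odot> glE n (dual n l) (dual n k) (glE n (dual n k) (dual n l) f)"
      by (simp add: spoX_def glE_lins fscale_simps c(1)[symmetric])
    have B: "spoX n l k (spoX n k l f) = glE n l k (glE n k l f) - dsign n k l \<odot> glE n l k (glE n (dual n l) (dual n k) f)
       - dsign n l k \<odot> glE n (dual n k) (dual n l) (glE n k l f)
       + K \<odot> glE n (dual n k) (dual n l) (glE n (dual n l) (dual n k) f)"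
      by (simp add: spoX_def glE_lins fscale_simps c(1)[symmetric] mult.commute)
    have C: "spoX n k k f = glE n k k f - glE n (dual n k) (dual n k) f" "spoX n l l f = glE n l l f - glE n (dual n l) (dual n l) f"
      unfolding spoX_def c by simp_all
    have "K = 1 \<or> K = -1" by (auto simp: K_def psign_def)
    then show ?thesis
      unfolding A B C 1 2 3 4 if_not_P[OF False]
      by (elim disjE) (simp_all only:, simp_all add: fun_eq_iff fscale_def algebra_simps)
  qed
qed

text \<open>
  The value \<open>(\<mu>, \<mu> + 2 \<rho>)\<close> of the Casimir operator at a highest weight \<open>\<mu>\<close>, where
  \<open>2 \<rho>\<^sub>i = 2 n + 1 - 2 i\<close>.
\<close>

definition cas_val :: "nat \<Rightarrow> (nat \<Rightarrow> int) \<Rightarrow> int"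
  where "cas_val n \<mu> = (\<Sum>i=1..n. \<mu> i ^ 2 + (2 * int n + 1 - 2 * int i) * \<mu> i)"

text \<open>The multiple of a maximal vector produced, modulo \<open>U\<close>, by the summand
  \<open>(k, l)\<close> of the Casimir sum: a square on the diagonal, the Cartan term of the
  supercommutator if \<open>spoX n k l\<close> raises, and nothing if \<open>spoX n l k\<close>,
  which is applied first, raises.\<close>

definition cas_val_coeff :: "nat \<Rightarrow> (nat \<Rightarrow> int) \<Rightarrow> nat \<Rightarrow> nat \<Rightarrow> complex"
  where "cas_val_coeff n \<mu> k l = (if k = l then psign n k * of_int (\<mu> k ^ 2)
    else if height n k > height n l then (if l = dual n k then 2 else 1) * (psign n l * of_int (\<mu> k) - psign n k * of_int (\<mu> l))
    else 0)"

text \<open>\<open>\<mu> i\<close> occurs with a plus sign for the \<open>n - i\<close> larger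
  indices and with a minus sign for the \<open>i - 1\<close> smaller ones.\<close>

lemma sum_triangle:
  fixes \<mu> :: "nat \<Rightarrow> 'a::comm_ring_1"
  shows "(\<Sum>i=1..n. \<Sum>j=1..n. if i < j then \<mu> i - \<mu> j else 0) = (\<Sum>i=1..n. (of_nat n + 1 - 2 * of_nat i) * \<mu> i)"
proof -
  have "(\<Sum>i=1..n. \<Sum>j=1..n. if i < j then \<mu> i - \<mu> j else 0)
     = (\<Sum>i=1..n. \<Sum>j=1..n. if i < j then \<mu> i else 0) - (\<Sum>i=1..n. \<Sum>j=1..n. if i < j then \<mu> j else 0)"
    by (simp add: sum_subtractf[symmetric] if_distrib cong: if_cong)
  also have "(\<Sum>i=1..n. \<Sum>j=1..n. if i < j then \<mu> i else 0) = (\<Sum>i=1..n. (of_nat n - of_nat i) * \<mu> i)"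
  proof (rule sum.cong[OF refl])
    fix i assume i: "i \<in> {1..n}"
    have "(\<Sum>j=1..n. if i < j then \<mu> i else 0) = (\<Sum>j\<in>{i+1..n}. \<mu> i)"
      by (rule sum.mono_neutral_cong_right) (use i in auto)
    also have "\<dots> = (of_nat n - of_nat i) * \<mu> i" using i by (simp add: of_nat_diff)
    finally show "(\<Sum>j=1..n. if i < j then \<mu> i else 0) = (of_nat n - of_nat i) * \<mu> i" .
  qed
  also have "(\<Sum>i=1..n. \<Sum>j=1..n. if i < j then \<mu> j else 0) = (\<Sum>j=1..n. (of_nat j - 1) * \<mu> j)"
  proof (subst sum.swap, rule sum.cong[OF refl])
    fix j assume j: "j \<in> {1..n}"
    have "(\<Sum>i=1..n. if i < j then \<mu> j else 0) = (\<Sum>i\<in>{1..j-1}. \<mu> j)"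
      by (rule sum.mono_neutral_cong_right) (use j in auto)
    also have "\<dots> = (of_nat j - 1) * \<mu> j" using j by (simp add: of_nat_diff)
    finally show "(\<Sum>i=1..n. if i < j then \<mu> j else 0) = (of_nat j - 1) * \<mu> j" .
  qed
  finally show ?thesis by (simp add: sum_subtractf[symmetric] algebra_simps)
qed

text \<open>Linear coefficient of the \<open>i\<close>-th coordinate: the roots
  \<open>e_i - e_j\<close> give \<open>2 * (n + 1 - 2 * i)\<close>, the roots
  \<open>e_i + e_j\<close> together with the long root give \<open>2 * n + 2\<close>, and the odd
  root \<open>e_i\<close> gives \<open>-2\<close>. The total is twice
  \<open>2 * n + 1 - 2 * i\<close>.\<close>

lemma sum_cas_val_coeff:
  assumes \<mu>: "\<And>i. i \<in> idx n \<Longrightarrow> \<mu> (dual n i) = - \<mu> i"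
  shows "(\<Sum>k\<in>idx n. \<Sum>l\<in>idx n. cas_val_coeff n \<mu> k l) = 2 * of_int (cas_val n \<mu>)"
proof -
  let ?d = "\<lambda>i. 2*n+1-i"
  let ?o = "2*n+1"
  let ?m = "\<lambda>i. of_int (\<mu> i) :: complex"
  have m0: "\<mu> ?o = 0" using \<mu>[of ?o] by (simp add: idx_def dual_def)
  have m': "\<mu> (?d i) = - \<mu> i" if "i \<in> {1..n}" for i
    using \<mu>[of i] that by (simp add: idx_def dual_def)
  have g: "cas_val_coeff n \<mu> i j = (if i = j then ?m i ^ 2 else if i < j then ?m i - ?m j else 0)"
    "cas_val_coeff n \<mu> i (?d j) = (if i = j then 2 else 1) * (?m i + ?m j)"
    "cas_val_coeff n \<mu> (?d i) j = 0"
    "cas_val_coeff n \<mu> (?d i) (?d j) = (if i = j then ?m i ^ 2 else if j < i then ?m j - ?m i else 0)"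
    if ij: "i \<in> {1..n}" "j \<in> {1..n}" for i j
  proof -
    have e: "?d i = ?d j \<longleftrightarrow> i = j" "i \<noteq> ?d j" "?d i \<noteq> j" "?d j = ?d i \<longleftrightarrow> i = j" "j = i \<longleftrightarrow> i = j"
      using ij by auto
    have lt: "height n i > height n j \<longleftrightarrow> i < j" "height n i > height n (?d j)" "\<not> height n (?d i) > height n j"
      "height n (?d i) > height n (?d j) \<longleftrightarrow> j < i"
      using ij by (auto simp: height_def)
    show "cas_val_coeff n \<mu> i j = (if i = j then ?m i ^ 2 else if i < j then ?m i - ?m j else 0)"
      "cas_val_coeff n \<mu> i (?d j) = (if i = j then 2 else 1) * (?m i + ?m j)"
      "cas_val_coeff n \<mu> (?d i) j = 0"
      "cas_val_coeff n \<mu> (?d i) (?d j) = (if i = j then ?m i ^ 2 else if j < i then ?m j - ?m i else 0)"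
      unfolding cas_val_coeff_def bsign_psign_simps(4,5,7,8)[OF ij(1)] bsign_psign_simps(4,5,7,8)[OF ij(2)]
        m'[OF ij(1)] m'[OF ij(2)]
      using e lt by simp_all
  qed
  have g0: "cas_val_coeff n \<mu> i ?o = - ?m i" "cas_val_coeff n \<mu> (?d i) ?o = 0"
     "cas_val_coeff n \<mu> ?o i = 0" "cas_val_coeff n \<mu> ?o (?d i) = - ?m i" if i: "i \<in> {1..n}" for i
  proof -
    have e: "i \<noteq> ?o" "?d i \<noteq> ?o" "?o \<noteq> i" "?o \<noteq> ?d i" using i by auto
    have lt: "height n i > height n ?o" "\<not> height n (?d i) > height n ?o" "\<not> height n ?o > height n i" "height n ?o > height n (?d i)"
      using i by (auto simp: height_def)
    show "cas_val_coeff n \<mu> i ?o = - ?m i" "cas_val_coeff n \<mu> (?d i) ?o = 0"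
     "cas_val_coeff n \<mu> ?o i = 0" "cas_val_coeff n \<mu> ?o (?d i) = - ?m i"
      unfolding cas_val_coeff_def bsign_psign_simps(4,5,7,8)[OF i] bsign_psign_simps(6,9) m'[OF i] m0
      using e lt by simp_all
  qed
  have g00: "cas_val_coeff n \<mu> ?o ?o = 0" using m0 by (simp add: cas_val_coeff_def)
  have "(\<Sum>k\<in>idx n. \<Sum>l\<in>idx n. cas_val_coeff n \<mu> k l)
    = (\<Sum>i=1..n. (\<Sum>j=1..n. cas_val_coeff n \<mu> i j + cas_val_coeff n \<mu> i (?d j) + (cas_val_coeff n \<mu> (?d i) j + cas_val_coeff n \<mu> (?d i) (?d j)))
       + (cas_val_coeff n \<mu> i ?o + cas_val_coeff n \<mu> (?d i) ?o + (cas_val_coeff n \<mu> ?o i + cas_val_coeff n \<mu> ?o (?d i)))) + cas_val_coeff n \<mu> ?o ?o"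
    unfolding sum_idx by (simp add: sum.distrib add_ac)
  also have "\<dots> = (\<Sum>i=1..n. (\<Sum>j=1..n. (if i < j then ?m i - ?m j else 0) + (if j < i then ?m j - ?m i else 0)
       + (if i = j then 2 * ?m i ^ 2 + 2 * ?m i else 0) + (?m i + ?m j)) - 2 * ?m i)"
    unfolding g00 add_0_right
  proof (intro sum.cong refl)
    fix i assume i: "i \<in> {1..n}"
    have "(\<Sum>j=1..n. cas_val_coeff n \<mu> i j + cas_val_coeff n \<mu> i (?d j) + (cas_val_coeff n \<mu> (?d i) j + cas_val_coeff n \<mu> (?d i) (?d j)))
      = (\<Sum>j=1..n. (if i < j then ?m i - ?m j else 0) + (if j < i then ?m j - ?m i else 0)
       + (if i = j then 2 * ?m i ^ 2 + 2 * ?m i else 0) + (?m i + ?m j))"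
      by (intro sum.cong refl, subst g[OF i], assumption, subst g[OF i], assumption, subst g[OF i], assumption, subst g[OF i], assumption) auto
    then show "(\<Sum>j=1..n. cas_val_coeff n \<mu> i j + cas_val_coeff n \<mu> i (?d j) + (cas_val_coeff n \<mu> (?d i) j + cas_val_coeff n \<mu> (?d i) (?d j)))
       + (cas_val_coeff n \<mu> i ?o + cas_val_coeff n \<mu> (?d i) ?o + (cas_val_coeff n \<mu> ?o i + cas_val_coeff n \<mu> ?o (?d i)))
      = (\<Sum>j=1..n. (if i < j then ?m i - ?m j else 0) + (if j < i then ?m j - ?m i else 0)
       + (if i = j then 2 * ?m i ^ 2 + 2 * ?m i else 0) + (?m i + ?m j)) - 2 * ?m i"
      unfolding g0[OF i] by simp
  qed
  also have "\<dots> = (\<Sum>i=1..n. \<Sum>j=1..n. if i < j then ?m i - ?m j else 0) + (\<Sum>i=1..n. \<Sum>j=1..n. if j < i then ?m j - ?m i else 0)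
       + (\<Sum>i=1..n. 2 * ?m i ^ 2 + 2 * ?m i) + (\<Sum>i=1..n. of_nat n * ?m i) + of_nat n * (\<Sum>i=1..n. ?m i) - (\<Sum>i=1..n. 2 * ?m i)"
    by (simp add: sum.distrib sum_subtractf)
  also have "(\<Sum>i=1..n. \<Sum>j=1..n. if j < i then ?m j - ?m i else 0) = (\<Sum>i=1..n. \<Sum>j=1..n. if i < j then ?m i - ?m j else 0)"
    by (rule sum.swap)
  also have "(\<Sum>i=1..n. \<Sum>j=1..n. if i < j then ?m i - ?m j else 0) = (\<Sum>i=1..n. (of_nat n + 1 - 2 * of_nat i) * ?m i)"
    by (rule sum_triangle)
  finally show ?thesis
    by (simp add: cas_val_def sum_distrib_left algebra_simps flip: sum.distrib sum_subtractf)
qed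

lemma wvec_spoX_diag: "wvec n \<mu> f \<Longrightarrow> k \<in> idx n \<Longrightarrow> spoX n k k f = of_int (\<mu> k) \<odot> f"
  by (rule ext) (auto simp: spoX_diag fscale_def wvec_def)

lemma wvec_dual:
  assumes "wvec n \<mu> f" "f s \<noteq> 0" "i \<in> idx n"
  shows "\<mu> (dual n i) = - \<mu> i"
proof -
  have "wt n i s = \<mu> i" "wt n (dual n i) s = \<mu> (dual n i)"
    using assms by (auto simp: wvec_def simp del: split_paired_All)
  then show ?thesis by (simp add: wt_def)
qed

lemma maximal_vector_casimir:
  assumes U: "spo_stable n U" and f: "f \<in> Low n p r" "f \<notin> U" "wvec n \<mu> f"
    and raise: "\<And>k l. k \<in> idx n \<Longrightarrow> l \<in> idx n \<Longrightarrow> height n k > height n l \<Longrightarrow> spoX n k l f \<in> U"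
  shows "cas_val n \<mu> = int p * (int p + 2 * int n + 1) + int r * (2 * int n + 1 - int r)"
proof -
  have sub: "fs.subspace U" using U by (simp add: spo_stable_def)
  define c where "c = int p * (int p + 2 * int n + 1) + int r * (2 * int n + 1 - int r)"
  have "f \<noteq> 0" using f sub fs.subspace_0 by blast
  then obtain s where s: "f s \<noteq> 0" by (metis ext zero_fun_apply)
  have "psign n l \<odot> spoX n k l (spoX n l k f) - cas_val_coeff n \<mu> k l \<odot> f \<in> U"
    if kl: "k \<in> idx n" "l \<in> idx n" for k l
  proof -
    consider "k = l" | "height n k < height n l" | "height n k > height n l" "k \<noteq> l"
      using height_inj[OF kl] by force
    then show ?thesis
    proof cases
      case 1
      then have "psign n l \<odot> spoX n k l (spoX n l k f) - cas_val_coeff n \<mu> k l \<odot> f = 0"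
        using kl by (simp add: wvec_spoX_diag[OF f(3)] DF_lins cas_val_coeff_def power2_eq_square)
      then show ?thesis using fs.subspace_0[OF sub] by simp
    next
      case 2
      then have "spoX n l k f \<in> U" using raise kl by blast
      then have "psign n l \<odot> spoX n k l (spoX n l k f) \<in> U"
        using U kl by (intro fs.subspace_scale sub) (simp add: spo_stable_def)
      then show ?thesis using 2 by (auto simp: cas_val_coeff_def)
    next
      case 3
      then have "spoX n k l f \<in> U" using raise kl by blast
      then have "psign n k \<odot> spoX n l k (spoX n k l f) \<in> U"
        using U kl by (intro fs.subspace_scale sub) (simp add: spo_stable_def)
      \<comment> \<open>The supercommutator read backwards: multiplying by \<open>psign n l\<close>
        turns its sign \<open>K\<close> into \<open>psign n k\<close>, so the difference is a
        lowering operator applied to an element of \<open>U\<close>.\<close>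
      also have "psign n k \<odot> spoX n l k (spoX n k l f) = psign n l \<odot> spoX n k l (spoX n l k f) - cas_val_coeff n \<mu> k l \<odot> f"
        using 3 kl by (simp add: spoX_spoX_opposite[OF kl 3(2)] wvec_spoX_diag[OF f(3)] cas_val_coeff_def
            fscale_simps mult_ac)
      finally show ?thesis .
    qed
  qed
  then have "(\<Sum>k\<in>idx n. \<Sum>l\<in>idx n. psign n l \<odot> spoX n k l (spoX n l k f) - cas_val_coeff n \<mu> k l \<odot> f) \<in> U"
    by (intro fs.subspace_sum sub)
  also have "(\<Sum>k\<in>idx n. \<Sum>l\<in>idx n. psign n l \<odot> spoX n k l (spoX n l k f) - cas_val_coeff n \<mu> k l \<odot> f)
    = (\<Sum>k\<in>idx n. \<Sum>l\<in>idx n. psign n l \<odot> spoX n k l (spoX n l k f)) - (\<Sum>k\<in>idx n. \<Sum>l\<in>idx n. cas_val_coeff n \<mu> k l) \<odot> f"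
    by (simp only: sum_subtractf fs.scale_sum_left)
  also have "(\<Sum>k\<in>idx n. \<Sum>l\<in>idx n. cas_val_coeff n \<mu> k l) = 2 * of_int (cas_val n \<mu>)"
    by (rule sum_cas_val_coeff) (rule wvec_dual[OF f(3) s])
  also have "(\<Sum>k\<in>idx n. \<Sum>l\<in>idx n. psign n l \<odot> spoX n k l (spoX n l k f)) = (2 * of_int c) \<odot> f"
    using casimir[of n f p r] f(1) by (simp add: Low_def c_def del: split_paired_All)
  finally have "(2 * of_int c) \<odot> f - (2 * of_int (cas_val n \<mu>)) \<odot> f \<in> U" .
  then have "(of_int (2 * (c - cas_val n \<mu>)) :: complex) \<odot> f \<in> U"
    by (simp add: right_diff_distrib flip: fs.scale_left_diff_distrib)
  then have x: "x \<odot> f \<in> U" if "x = of_int (2 * (c - cas_val n \<mu>))" for x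
    using that by simp
  have "c = cas_val n \<mu>"
  proof (rule ccontr)
    assume ne: "c \<noteq> cas_val n \<mu>"
    define x :: complex where "x = of_int (2 * (c - cas_val n \<mu>))"
    have "x \<noteq> 0" using ne unfolding x_def of_int_eq_0_iff by simp
    moreover have "(1 / x) \<odot> x \<odot> f \<in> U" by (rule fs.subspace_scale[OF sub x[OF x_def]])
    ultimately show False using f(2) by simp
  qed
  then show ?thesis by (simp add: c_def)
qed

subsection \<open>The extremal monomial\<close>

text \<open>Induction by removing the maximum, which is at least \<open>card S\<close> because
  \<open>S\<close> consists of positive integers. Equality forces the maximum to be
  \<open>card S\<close> and the rest to be an initial segment.\<close>

lemma sum_card_bound:
  assumes "finite S" "0 \<notin> S"
  shows "card S * (card S + 1) \<le> 2 * \<Sum>S"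
    and "card S * (card S + 1) = 2 * \<Sum>S \<Longrightarrow> S = {1..card S}"
proof -
  have "card S * (card S + 1) \<le> 2 * \<Sum>S \<and> (card S * (card S + 1) = 2 * \<Sum>S \<longrightarrow> S = {1..card S})"
    using assms
  proof (induction "card S" arbitrary: S)
    case 0
    then show ?case by simp
  next
    case (Suc z)
    define M where "M = Max S"
    have ne: "S \<noteq> {}" using Suc.hyps by auto
    then have M: "M \<in> S" using Suc.prems by (simp add: M_def)
    have z: "z = card (S - {M})" using Suc M by (simp add: card_Diff_singleton)
    have IH: "z * (z + 1) \<le> 2 * \<Sum>(S - {M})" "z * (z + 1) = 2 * \<Sum>(S - {M}) \<Longrightarrow> S - {M} = {1..z}"
      using Suc.hyps(1)[OF z] Suc.prems z by auto
    have "S \<subseteq> {1..M}"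
      using Suc.prems by (auto simp: M_def Suc_le_eq intro: gr0I)
    then have "card S \<le> M" using card_mono[of "{1..M}" S] by simp
    then have zM: "Suc z \<le> M" using Suc.hyps by simp
    have sum: "\<Sum>S = M + \<Sum>(S - {M})" using M Suc.prems by (simp add: sum.remove)
    have e: "card S * (card S + 1) = z * (z + 1) + 2 * Suc z"
      using Suc.hyps by (simp flip: Suc.hyps(2))
    show ?case
    proof
      have sum2: "2 * \<Sum>S = 2 * M + 2 * \<Sum>(S - {M})" using sum by simp
      show "card S * (card S + 1) \<le> 2 * \<Sum>S" unfolding e sum2 using IH(1) zM by simp
      show "card S * (card S + 1) = 2 * \<Sum>S \<longrightarrow> S = {1..card S}"
      proof
        assume "card S * (card S + 1) = 2 * \<Sum>S"
        then have eq: "z * (z + 1) + 2 * Suc z = 2 * M + 2 * \<Sum>(S - {M})" unfolding e sum2 .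
        have "M = Suc z \<and> a = b" if "a + 2 * Suc z = 2 * M + b" "a \<le> b" for a b
          using that zM by arith
        note M_eq = conjunct1[OF this[OF eq IH(1)]] conjunct2[OF this[OF eq IH(1)]]
        have "S - {M} = {1..z}" by (rule IH(2)[OF M_eq(2)])
        then have "S = insert (Suc z) {1..z}" using M M_eq(1) by blast
        then have "S = {1..Suc z}" by auto
        then show "S = {1..card S}" unfolding Suc.hyps(2)[symmetric] .
      qed
    qed
  qed
  then show "card S * (card S + 1) \<le> 2 * \<Sum>S" "card S * (card S + 1) = 2 * \<Sum>S \<Longrightarrow> S = {1..card S}"
    by auto
qed

lemma sum_eq_imp_eq:
  fixes f g :: "'a \<Rightarrow> int"
  assumes "finite I" "\<And>i. i \<in> I \<Longrightarrow> f i \<le> g i" "sum g I \<le> sum f I" "i \<in> I"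
  shows "f i = g i"
proof (rule ccontr)
  assume "f i \<noteq> g i"
  then have "sum f I < sum g I" using assms by (intro sum_strict_mono_ex1) force+
  with assms(3) show False by simp
qed

text \<open>
  A weight of S(E) is \<open>\<nu> + \<epsilon>\<close> with contributions \<open>\<nu>\<close> of the even and \<open>\<epsilon>\<close> of the odd variables. As the
  bounds on \<open>\<nu>\<close> and \<open>\<epsilon>\<close> are insensitive to signs, dominance of the weight is not required.
\<close>

lemma cas_val_bound:
  fixes \<nu> \<epsilon> :: "nat \<Rightarrow> int"
  assumes n: "n \<ge> 1" and \<epsilon>: "\<And>i. i \<in> {1..n} \<Longrightarrow> \<epsilon> i \<in> {-1, 0, 1}" and \<nu>: "(\<Sum>i=1..n. \<bar>\<nu> i\<bar>) \<le> int p"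
  defines "z \<equiv> card {i \<in> {1..n}. \<epsilon> i \<noteq> 0}"
  shows "cas_val n (\<lambda>i. \<nu> i + \<epsilon> i) \<le> int p * (int p + 2 * int n + 1) + int z * (2 * int n + 1 - int z)"
    and "cas_val n (\<lambda>i. \<nu> i + \<epsilon> i) = int p * (int p + 2 * int n + 1) + int z * (2 * int n + 1 - int z) \<Longrightarrow>
      (\<forall>i\<in>{1..n}. \<epsilon> i = of_bool (i \<le> z)) \<and> (p = 0 \<or> z \<ge> 1) \<and> (\<forall>i\<in>{1..n}. \<nu> i = (if i = 1 then int p else 0))"
proof -
  let ?c = "\<lambda>i. 2 * int n + 1 - 2 * int i"
  \<comment> \<open>Expanding the square, \<open>u\<close> is the contribution of
    \<open>\<epsilon>\<close> alone and \<open>t\<close> collects all that is divisible by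
    \<open>\<nu>\<close>. \<open>B\<close> is the value of the other factor of \<open>t\<close> at
    \<open>i = 1\<close> with \<open>\<nu> 1 = p\<close> and \<open>\<epsilon> 1 = 1\<close>, the
    extreme case.\<close>
  define t where "t i = \<nu> i * (\<nu> i + 2 * \<epsilon> i + ?c i)" for i
  define u where "u i = \<epsilon> i ^ 2 + ?c i * \<epsilon> i" for i
  define S where "S = {i \<in> {1..n}. \<epsilon> i \<noteq> 0}"
  define B where "B = int p + 2 * int n + 1"
  have cas_val: "cas_val n (\<lambda>i. \<nu> i + \<epsilon> i) = (\<Sum>i=1..n. t i) + (\<Sum>i=1..n. u i)"
    unfolding cas_val_def t_def u_def sum.distrib[symmetric]
    by (rule sum.cong) (simp_all add: power2_eq_square algebra_simps)
  have t1: "t i \<le> \<bar>\<nu> i\<bar> * (B - 2 * (int i - 1))" if i: "i \<in> {1..n}" for i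
  proof -
    have "\<bar>\<nu> i\<bar> \<le> (\<Sum>i=1..n. \<bar>\<nu> i\<bar>)" using i by (intro member_le_sum) auto
    then have "\<bar>\<nu> i\<bar> \<le> int p" using \<nu> by linarith
    then have "\<nu> i \<le> int p" "- int p \<le> \<nu> i" by linarith+
    moreover have "\<epsilon> i \<le> 1" "-1 \<le> \<epsilon> i" using \<epsilon>[OF i] by auto
    moreover have "int i \<le> int n" using i by simp
    ultimately have "\<bar>\<nu> i + 2 * \<epsilon> i + ?c i\<bar> \<le> B - 2 * (int i - 1)"
      unfolding B_def abs_le_iff by simp
    then have "\<bar>\<nu> i\<bar> * \<bar>\<nu> i + 2 * \<epsilon> i + ?c i\<bar> \<le> \<bar>\<nu> i\<bar> * (B - 2 * (int i - 1))"
      by (intro mult_left_mono) auto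
    moreover have "t i \<le> \<bar>\<nu> i\<bar> * \<bar>\<nu> i + 2 * \<epsilon> i + ?c i\<bar>"
      unfolding t_def abs_mult[symmetric] by (rule abs_ge_self)
    ultimately show ?thesis by (rule order_trans[rotated])
  qed
  have t2: "t i \<le> \<bar>\<nu> i\<bar> * B" if i: "i \<in> {1..n}" for i
  proof -
    have "\<bar>\<nu> i\<bar> * (B - 2 * (int i - 1)) \<le> \<bar>\<nu> i\<bar> * B" using i by (intro mult_left_mono) auto
    with t1[OF i] show ?thesis by linarith
  qed
  have st: "(\<Sum>i=1..n. t i) \<le> (\<Sum>i=1..n. \<bar>\<nu> i\<bar> * B)" using t2 by (rule sum_mono)
  have sB: "(\<Sum>i=1..n. \<bar>\<nu> i\<bar> * B) \<le> int p * B"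
    unfolding sum_distrib_right[symmetric] using \<nu> by (rule mult_right_mono) (simp add: B_def)
  have u1: "u i \<le> (if \<epsilon> i \<noteq> 0 then 2 * int n + 2 - 2 * int i else 0)" if i: "i \<in> {1..n}" for i
    using \<epsilon>[OF i] i by (auto simp: u_def)
  have su: "(\<Sum>i=1..n. u i) \<le> (\<Sum>i=1..n. if \<epsilon> i \<noteq> 0 then 2 * int n + 2 - 2 * int i else 0)"
    using u1 by (rule sum_mono)
  have S: "(\<Sum>i=1..n. if \<epsilon> i \<noteq> 0 then 2 * int n + 2 - 2 * int i else 0) = int z * (2 * int n + 2) - 2 * int (\<Sum>S)"
  proof -
    have "(\<Sum>i=1..n. if \<epsilon> i \<noteq> 0 then 2 * int n + 2 - 2 * int i else 0) = (\<Sum>i\<in>S. 2 * int n + 2 - 2 * int i)"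
      unfolding S_def by (rule sum.mono_neutral_cong_right) auto
    then show ?thesis by (simp add: sum_subtractf z_def S_def sum_distrib_left)
  qed
  have zS: "z = card S" "finite S" "0 \<notin> S" by (auto simp: z_def S_def)
  have "int (z * (z + 1)) \<le> int (2 * \<Sum>S)" using sum_card_bound(1)[OF zS(2,3)] zS(1) by (simp only: of_nat_le_iff)
  then have sS: "int z * (2 * int n + 2) - 2 * int (\<Sum>S) \<le> int z * (2 * int n + 1 - int z)"
    by (simp add: algebra_simps)
  show "cas_val n (\<lambda>i. \<nu> i + \<epsilon> i) \<le> int p * (int p + 2 * int n + 1) + int z * (2 * int n + 1 - int z)"
    using cas_val st sB su S sS by (simp add: B_def add.assoc)
  assume "cas_val n (\<lambda>i. \<nu> i + \<epsilon> i) = int p * (int p + 2 * int n + 1) + int z * (2 * int n + 1 - int z)"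
  then have eq: "(\<Sum>i=1..n. t i) + (\<Sum>i=1..n. u i) = int p * B + int z * (2 * int n + 1 - int z)"
    using cas_val by (simp add: B_def add.assoc)
  have eq1: "(\<Sum>i=1..n. \<bar>\<nu> i\<bar> * B) \<le> (\<Sum>i=1..n. t i)" "int p * B \<le> (\<Sum>i=1..n. \<bar>\<nu> i\<bar> * B)"
    "(\<Sum>i=1..n. if \<epsilon> i \<noteq> 0 then 2 * int n + 2 - 2 * int i else 0) \<le> (\<Sum>i=1..n. u i)"
    "int z * (2 * int n + 1 - int z) = int z * (2 * int n + 2) - 2 * int (\<Sum>S)"
    using eq st sB su S sS by linarith+
  have "int (z * (z + 1)) = int (2 * \<Sum>S)" using eq1(4) by (simp add: algebra_simps)
  then have "S = {1..z}" using sum_card_bound(2)[OF zS(2,3)] zS(1) by (simp only: of_nat_eq_iff)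
  have \<epsilon>z: "\<epsilon> i = of_bool (i \<le> z)" if i: "i \<in> {1..n}" for i
  proof -
    have "u i = (if \<epsilon> i \<noteq> 0 then 2 * int n + 2 - 2 * int i else 0)"
      by (rule sum_eq_imp_eq[OF _ u1 eq1(3) i]) auto
    moreover have "\<epsilon> i \<noteq> 0 \<longleftrightarrow> i \<le> z" using \<open>S = {1..z}\<close> i by (auto simp: S_def set_eq_iff)
    ultimately show ?thesis using \<epsilon>[OF i] i by (auto simp: u_def)
  qed
  have tB: "t i = \<bar>\<nu> i\<bar> * B" if i: "i \<in> {1..n}" for i
    by (rule sum_eq_imp_eq[OF _ t2 eq1(1) i]) auto
  \<comment> \<open>The bound \<open>t1\<close> loses \<open>2 * (i - 1)\<close> against
    \<open>B\<close>, so equality allows a nonzero \<open>\<nu> i\<close> only for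
    \<open>i = 1\<close>.\<close>
  have \<nu>0: "\<nu> i = 0" if i: "i \<in> {1..n}" "i \<noteq> 1" for i
  proof -
    have "\<bar>\<nu> i\<bar> * B \<le> \<bar>\<nu> i\<bar> * B - \<bar>\<nu> i\<bar> * (2 * (int i - 1))"
      using t1[OF i(1)] tB[OF i(1)] by (simp add: algebra_simps)
    then have "\<bar>\<nu> i\<bar> * (2 * (int i - 1)) \<le> 0" by linarith
    then show ?thesis using i by (auto simp: mult_le_0_iff)
  qed
  have "(\<Sum>i=1..n. \<bar>\<nu> i\<bar>) * B \<ge> int p * B" using eq1(2) by (simp only: sum_distrib_right)
  then have "(\<Sum>i=1..n. \<bar>\<nu> i\<bar>) \<ge> int p" by (simp add: B_def)
  moreover have "(\<Sum>i=1..n. \<bar>\<nu> i\<bar>) = (\<Sum>i=1..n. if i = 1 then \<bar>\<nu> 1\<bar> else 0)"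
    using \<nu>0 by (intro sum.cong) auto
  ultimately have p: "\<bar>\<nu> 1\<bar> = int p" using \<nu> n by simp
  have one: "1 \<in> {1..n}" using n by simp
  have "\<nu> 1 = int p \<and> (p = 0 \<or> \<epsilon> 1 = 1)"
  proof (cases "p = 0")
    case False
    have tB1: "\<nu> 1 * (\<nu> 1 + 2 * \<epsilon> 1 + 2 * int n - 1) = int p * B"
      using tB[OF one] p by (simp add: t_def add_diff_eq)
    from p consider "\<nu> 1 = int p" | "\<nu> 1 = - int p" by linarith
    then show ?thesis
    proof cases
      case 1
      then have "int p + 2 * \<epsilon> 1 + 2 * int n - 1 = B" using tB1 False by simp
      then show ?thesis using 1 by (simp add: B_def)
    next
      \<comment> \<open>This would need \<open>\<epsilon> 1 = - 2 * n\<close>, which is impossible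
        for a value in \<open>{-1, 0, 1}\<close>.\<close>
      case 2
      then have "int p * (int p - 2 * \<epsilon> 1 - 2 * int n + 1) = int p * B" using tB1 by (simp add: algebra_simps)
      then have "int p - 2 * \<epsilon> 1 - 2 * int n + 1 = B" using False by simp
      then show ?thesis using \<epsilon>[OF one] n by (auto simp: B_def)
    qed
  qed (use p in auto)
  then show "(\<forall>i\<in>{1..n}. \<epsilon> i = of_bool (i \<le> z)) \<and> (p = 0 \<or> z \<ge> 1) \<and> (\<forall>i\<in>{1..n}. \<nu> i = (if i = 1 then int p else 0))"
    using \<epsilon>z \<nu>0 one by (auto simp: of_bool_def split: if_splits)
qed

text \<open>
  For \<open>r \<le> n\<close> this is \<open>x\<^sub>1 ^ p * \<eta>\<^sub>1 * \<dots> * \<eta>\<^sub>r\<close>; for \<open>r > n\<close> it is \<open>x\<^sub>1 ^ p * t * \<eta>\<^sub>1 * \<dots> * \<eta>\<^bsub>r-1\<^esub>\<close>, where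
  \<open>t\<close> is the last even variable.
\<close>

definition topmono :: "nat \<Rightarrow> nat \<Rightarrow> nat \<Rightarrow> smono"
  where "topmono n p r = ((\<lambda>i. if i = 1 then p else if i = 2*n+1 \<and> n < r then 1 else 0),
    if n < r then {1..r-1} else {1..r})"

text \<open>\<open>r * (2*n+1-r)\<close> takes the same value at \<open>r\<close> and at
  \<open>2*n+1-r\<close>; this is the representative that is at most \<open>n\<close>. It is the
  number of entries that the odd variables raise by 1 in the extremal weight.\<close>

definition rbar :: "nat \<Rightarrow> nat \<Rightarrow> nat"
  where "rbar n r = (if n < r then 2*n+1-r else r)"

text \<open>The bidegrees for which \<open>Low n p r\<close> is nonzero
  (\<open>Low_not_admissible\<close>, \<open>Low_admissible\<close>). For \<open>p > 0\<close> the
  condition amounts to \<open>rbar n r >= 1\<close>: the equality case of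
  \<open>cas_val_bound\<close> needs an odd contribution at the first index.\<close>

definition admissible :: "nat \<Rightarrow> nat \<Rightarrow> nat \<Rightarrow> bool"
  where "admissible n p r \<longleftrightarrow> r \<le> 2*n+1 \<and> (p = 0 \<or> 1 \<le> r \<and> r \<le> 2*n)"

lemma bdeg_expand:
  "bdeg n False (m, A) = (\<Sum>i=1..n. m i + m (2*n+1-i)) + of_bool (2*n+1 \<in> A)"
  "bdeg n True (m, A) = (\<Sum>i=1..n. of_bool (i \<in> A) + of_bool (2*n+1-i \<in> A)) + m (2*n+1)"
  unfolding bdeg_def sum_idx zgen_simps(3,6) by (simp_all add: zgen_simps del: One_nat_def)

lemma wt_expand:
  assumes "i \<in> {1..n}"
  shows "wt n i (m, A) = (int (m i) - int (m (2*n+1-i))) + (of_bool (i \<in> A) - of_bool (2*n+1-i \<in> A))"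
  unfolding wt_def index_count_def bsign_psign_simps(7)[OF assms] zgen_simps(1)[OF assms] zgen_simps(2)[OF assms]
    zgen_simps(4)[OF assms] zgen_simps(5)[OF assms] by simp

text \<open>Let \<open>z\<close> be the number of indices at which the odd variables contribute to
  the weight. \<open>cas_val_bound\<close> gives the Casimir value with \<open>z\<close> in place of
  \<open>r\<close> as an upper bound, while counting variables gives \<open>z <= r\<close> and
  \<open>z <= 2*n+1-r\<close>, so that the value with \<open>r\<close> is at least as large. Hence
  equality holds, with \<open>z = r\<close> or \<open>z = 2*n+1-r\<close>.\<close>

lemma topmono_unique:
  assumes n: "n \<ge> 1"
    and range: "\<And>g. gcount g s \<noteq> 0 \<Longrightarrow> g \<in> gens n"
    and deg: "bdeg n False s = p" "bdeg n True s = r" and t: "fst s (2*n+1) \<le> 1"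
    and cas_val: "cas_val n (\<lambda>i. wt n i s) = int p * (int p + 2 * int n + 1) + int r * (2 * int n + 1 - int r)"
  shows "s = topmono n p r \<and> admissible n p r \<and> (\<forall>i\<in>{1..n}. wt n i s = (if i = 1 then int p else 0) + of_bool (i \<le> rbar n r))"
proof -
  obtain m A where s: "s = (m, A)" by force
  let ?d = "\<lambda>i. 2*n+1-i" and ?o = "2*n+1"
  define a b where "a i = (of_bool (i \<in> A) :: nat)" and "b i = (of_bool (?d i \<in> A) :: nat)" for i
  define \<nu> where "\<nu> i = int (m i) - int (m (?d i))" for i
  define \<epsilon> where "\<epsilon> i = int (a i) - int (b i)" for i
  define z where "z = card {i \<in> {1..n}. \<epsilon> i \<noteq> 0}"
  have ab: "a i \<le> 1" "b i \<le> 1" for i by (simp_all add: a_def b_def)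
  have w: "wt n i s = \<nu> i + \<epsilon> i" if "i \<in> {1..n}" for i
    unfolding s wt_expand[OF that] \<nu>_def \<epsilon>_def a_def b_def by simp
  have p: "(\<Sum>i=1..n. m i + m (?d i)) + of_bool (?o \<in> A) = p" using deg(1) unfolding s bdeg_expand .
  have r: "(\<Sum>i=1..n. a i + b i) + m ?o = r" using deg(2) unfolding s bdeg_expand a_def b_def .
  have T: "m ?o \<le> 1" using t s by simp
  have "(\<Sum>i=1..n. \<bar>\<nu> i\<bar>) \<le> (\<Sum>i=1..n. int (m i + m (?d i)))" by (rule sum_mono) (simp add: \<nu>_def)
  also have "\<dots> \<le> int p" unfolding p[symmetric] by simp
  finally have \<nu>p: "(\<Sum>i=1..n. \<bar>\<nu> i\<bar>) \<le> int p" .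
  have \<epsilon>1: "\<epsilon> i \<in> {-1, 0, 1}" for i by (auto simp: \<epsilon>_def a_def b_def)
  have zsum: "z = (\<Sum>i=1..n. of_bool (\<epsilon> i \<noteq> 0))"
    unfolding z_def by (simp add: Int_def of_bool_def sum.If_cases)
  have z1: "z \<le> (\<Sum>i=1..n. a i + b i)" unfolding zsum
    by (rule sum_mono) (auto simp: \<epsilon>_def a_def b_def)
  have z2: "z + (\<Sum>i=1..n. a i + b i) \<le> 2 * n"
  proof -
    have "z + (\<Sum>i=1..n. a i + b i) = (\<Sum>i=1..n. of_bool (\<epsilon> i \<noteq> 0) + (a i + b i))" unfolding zsum sum.distrib ..
    also have "\<dots> \<le> (\<Sum>i=1..n. 2)" by (rule sum_mono) (auto simp: \<epsilon>_def a_def b_def)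
    finally show ?thesis by simp
  qed
  have cas_val': "cas_val n (\<lambda>i. \<nu> i + \<epsilon> i) = int p * (int p + 2 * int n + 1) + int r * (2 * int n + 1 - int r)"
    unfolding cas_val[symmetric] cas_val_def by (rule sum.cong) (simp_all add: w)
  have le: "cas_val n (\<lambda>i. \<nu> i + \<epsilon> i) \<le> int p * (int p + 2 * int n + 1) + int z * (2 * int n + 1 - int z)"
    unfolding z_def by (rule cas_val_bound(1)[OF n \<epsilon>1 \<nu>p])
  \<comment> \<open>\<open>x * y\<close> is the difference of the Casimir terms of \<open>r\<close>
    and of \<open>z\<close>; \<open>y >= 0\<close> is where the bound on the exponent of the last
    even variable enters.\<close>
  define x y where "x = int r - int z" and "y = 2 * int n + 1 - int r - int z"
  have xy: "x \<ge> 0" "y \<ge> 0" using z1 z2 r T by (simp_all add: x_def y_def)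
  have "x * y = int r * (2 * int n + 1 - int r) - int z * (2 * int n + 1 - int z)"
    by (simp add: x_def y_def algebra_simps)
  then have "x * y \<le> 0" using cas_val' le by linarith
  then have xy0: "x = 0 \<or> y = 0" using xy by (simp add: mult_le_0_iff) linarith
  then have "int z * (2 * int n + 1 - int z) = int r * (2 * int n + 1 - int r)"
    using \<open>x * y = _\<close> by auto
  then have top: "(\<forall>i\<in>{1..n}. \<epsilon> i = of_bool (i \<le> z)) \<and> (p = 0 \<or> z \<ge> 1) \<and> (\<forall>i\<in>{1..n}. \<nu> i = (if i = 1 then int p else 0))"
    unfolding z_def by (intro cas_val_bound(2)[OF n \<epsilon>1 \<nu>p]) (simp add: cas_val' z_def)
  have "\<nu> 1 = int p" using top n by auto
  then have m1: "m 1 \<ge> p" unfolding \<nu>_def by linarith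
  have sum1: "(\<Sum>i=1..n. m i + m (?d i)) = m 1 + m (?d 1) + (\<Sum>i\<in>{1..n} - {1}. m i + m (?d i))"
    using n by (subst sum.remove[of _ 1]) auto
  have "m 1 = p" "m (?d 1) = 0" "?o \<notin> A" "(\<Sum>i\<in>{1..n} - {1}. m i + m (?d i)) = 0"
    using p m1 unfolding sum1 by (auto split: if_splits)
  then have m0: "m i = 0 \<and> m (?d i) = 0" if "i \<in> {1..n}" "i \<noteq> 1" for i using that by auto
  have mi: "m i = (if i = 1 then p else 0)" if "i \<noteq> ?o" for i
  proof -
    have "i \<in> {1..n} \<or> (?d i \<in> {1..n} \<and> ?d (?d i) = i) \<or> i \<notin> {1..?o}"
      using that by auto
    then consider "i \<in> {1..n}" | "?d i \<in> {1..n}" "?d (?d i) = i" | "i \<notin> {1..?o}"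
      by blast
    then show ?thesis
    proof cases
      case 1
      then show ?thesis using m0 \<open>m 1 = p\<close> by auto
    next
      case 2
      then have "i \<noteq> 1" using n by auto
      moreover have "m i = 0"
      proof (cases "?d i = 1")
        case True
        then show ?thesis using \<open>m (?d 1) = 0\<close> 2(2) by metis
      next
        case False
        then show ?thesis using m0[OF 2(1)] 2(2) by metis
      qed
      ultimately show ?thesis by simp
    next
      case 3
      then have "GX i \<notin> gens n" by (auto simp: gens_def)
      then have "m i = 0" using range[of "GX i"] s by auto
      then show ?thesis using 3 n by auto
    qed
  qed
  have A_range: "i \<in> {1..2*n}" if "i \<in> A" for i
  proof -
    have "GH i \<in> gens n" using range[of "GH i"] s that by auto
    then have "i \<in> {1..?o}" by (auto simp: gens_def)
    then show ?thesis using that \<open>?o \<notin> A\<close> by (cases "i = ?o") auto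
  qed
  have A_iff: "A = {i \<in> {1..2*n}. if i \<le> n then a i = 1 else b (?d i) = 1}"
  proof (rule set_eqI)
    fix i
    show "i \<in> A \<longleftrightarrow> i \<in> {i \<in> {1..2*n}. if i \<le> n then a i = 1 else b (?d i) = 1}"
      using A_range[of i] by (auto simp: a_def b_def)
  qed
  have \<epsilon>z: "int (a i) - int (b i) = of_bool (i \<le> z)" if "i \<in> {1..n}" for i
    using top that unfolding \<epsilon>_def by blast
  have ai: "a i = 1" "b i = 0" if "i \<in> {1..n}" "i \<le> z" for i
    using \<epsilon>z[OF that(1)] that(2) ab[of i] by simp_all
  have aib: "a i = b i" if "i \<in> {1..n}" "\<not> i \<le> z" for i
    using \<epsilon>z[OF that(1)] that(2) by simp
  have zn: "z \<le> n" using z1 z2 by linarith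
  from xy0 have res: "(r \<le> n \<and> z = r \<and> m ?o = 0 \<and> A = {1..r}) \<or> (n < r \<and> z = 2*n+1-r \<and> r \<le> 2*n+1 \<and> m ?o = 1 \<and> A = {1..r-1})"
  proof
    \<comment> \<open>All \<open>r\<close> factors are used up by the \<open>z\<close> weight
      contributions: no pair \<open>i\<close>, \<open>?d i\<close> is full and the last even
      variable is absent.\<close>
    assume "x = 0"
    then have "z = r" by (simp add: x_def)
    then have o: "m ?o = 0" "(\<Sum>i=1..n. a i + b i) \<le> z" using z1 r by simp_all
    have "int (of_bool (\<epsilon> i \<noteq> 0)) = int (a i + b i)" if i: "i \<in> {1..n}" for i
    proof (rule sum_eq_imp_eq[OF _ _ _ i])
      show "int (of_bool (\<epsilon> j \<noteq> 0)) \<le> int (a j + b j)" for j by (auto simp: \<epsilon>_def a_def b_def)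
      show "(\<Sum>i=1..n. int (a i + b i)) \<le> (\<Sum>i=1..n. int (of_bool (\<epsilon> i \<noteq> 0)))"
        using o zsum by (simp only: of_nat_sum[symmetric] of_nat_le_iff)
    qed auto
    then have sum: "of_bool (\<epsilon> i \<noteq> 0) = a i + b i" if "i \<in> {1..n}" for i
      using that by (simp only: of_nat_eq_iff)
    have ab0: "a i = 0" "b i = 0" if "i \<in> {1..n}" "\<not> i \<le> z" for i
      using sum[OF that(1)] aib[OF that] by (simp_all add: \<epsilon>_def)
    have a: "a i = 1 \<longleftrightarrow> i \<le> z" and b: "b i \<noteq> 1" if "i \<in> {1..n}" for i
      using ab0[OF that] ai[OF that] by (cases "i \<le> z"; simp)+
    have "i \<in> A \<longleftrightarrow> i \<in> {1..r}" for i
    proof (cases "i \<in> {1..2*n} \<and> n < i")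
      case True
      then have "?d i \<in> {1..n}" by auto
      then have "b (?d i) \<noteq> 1" by (rule b)
      then show ?thesis unfolding A_iff using True zn \<open>z = r\<close> by auto
    next
      case False
      then show ?thesis unfolding A_iff using a[of i] zn \<open>z = r\<close> by auto
    qed
    then have "A = {1..r}" by blast
    then show ?thesis using \<open>z = r\<close> zn o by simp
  next
    \<comment> \<open>Here the last even variable occurs and every pair \<open>i\<close>,
      \<open>?d i\<close> holds as many odd variables as possible: both for \<open>i > z\<close>,
      only the first for \<open>i <= z\<close>. Together these are the indices up to
      \<open>r - 1\<close>.\<close>
    assume "y = 0"
    then have z: "int z = 2 * int n + 1 - int r" by (simp add: y_def)
    then have o: "m ?o = 1" "(\<Sum>i=1..n. a i + b i) + z = 2 * n" using z2 r T by linarith+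
    have "int (of_bool (\<epsilon> i \<noteq> 0) + (a i + b i)) = 2" if i: "i \<in> {1..n}" for i
    proof (rule sum_eq_imp_eq[OF _ _ _ i])
      show "int (of_bool (\<epsilon> j \<noteq> 0) + (a j + b j)) \<le> 2" for j by (auto simp: \<epsilon>_def a_def b_def)
      have "(\<Sum>i=1..n. of_bool (\<epsilon> i \<noteq> 0) + (a i + b i)) = 2 * n" using o zsum by (simp add: sum.distrib)
      then have "int (\<Sum>i=1..n. of_bool (\<epsilon> i \<noteq> 0) + (a i + b i)) = 2 * int n" by simp
      then show "(\<Sum>i=1..n. 2) \<le> (\<Sum>i=1..n. int (of_bool (\<epsilon> i \<noteq> 0) + (a i + b i)))"
        by (simp only: of_nat_sum) simp
    qed auto
    note sum2 = this
    have ab1: "a i = 1" "b i = 1" if "i \<in> {1..n}" "\<not> i \<le> z" for i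
      using sum2[OF that(1)] aib[OF that] by (simp_all add: \<epsilon>_def)
    then have ai1: "a i = 1" if "i \<in> {1..n}" for i using ai that by blast
    have "i \<in> A \<longleftrightarrow> i \<in> {1..r-1}" for i
    proof (cases "i \<in> {1..2*n} \<and> n < i")
      case True
      then have "?d i \<in> {1..n}" by auto
      then have b: "b (?d i) = 1 \<longleftrightarrow> \<not> ?d i \<le> z" using ai(2)[of "?d i"] ab1(2)[of "?d i"] by (cases "?d i \<le> z") simp_all
      have "\<not> ?d i \<le> z \<longleftrightarrow> i \<le> r - 1" using True z by linarith
      then show ?thesis unfolding A_iff using True b by simp
    next
      case False
      have "n \<le> r - 1" "r - 1 \<le> 2 * n" using z zn by linarith+
      with False show ?thesis unfolding A_iff using ai1[of i] by auto
    qed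
    then have "A = {1..r-1}" by blast
    moreover have "n < r" "z = 2*n+1-r" "r \<le> 2*n+1" using z zn by linarith+
    ultimately show ?thesis using o by blast
  qed
  have "m i = (if i = 1 then p else if i = ?o \<and> n < r then 1 else 0)" for i
  proof (cases "i = ?o")
    case True
    then show ?thesis using res n by auto
  next
    case False
    then show ?thesis using mi[OF False] by simp
  qed
  moreover have "A = (if n < r then {1..r-1} else {1..r})" using res by auto
  ultimately have "s = topmono n p r"
    unfolding s topmono_def by (simp add: fun_eq_iff)
  moreover have "z = rbar n r" using res by (auto simp: rbar_def)
  moreover have "admissible n p r" using res top by (auto simp: admissible_def)
  ultimately show ?thesis using w top by auto
qed

text \<open>\<open>D22\<close> is the second derivative in the last even variable \<open>t\<close>
  plus terms that do not involve \<open>t\<close>. The equation \<open>D22 f = 0\<close> thus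
  expresses the coefficients at \<open>t^j\<close> by those at \<open>t^(j-2)\<close>.\<close>

lemma D22_determined:
  assumes D: "Dop n True f = 0" and f: "\<And>s. fst s (2*n+1) \<le> 1 \<Longrightarrow> f s = 0"
  shows "f = 0"
proof -
  let ?o = "2*n+1"
  have "\<forall>m A. m ?o = j \<longrightarrow> f (m, A) = 0" for j
  proof (induction j rule: less_induct)
    case (less j)
    show ?case
    proof (intro allI impI)
      fix m A assume m: "m ?o = j"
      show "f (m, A) = 0"
      proof (cases "j \<le> 1")
        case True
        then show ?thesis using f m by simp
      next
        case False
        define m' where "m' = m(?o := j - 2)"
        have m'0: "f (m', B) = 0" for B using less.IH[of "j - 2"] False by (simp add: m'_def)
        have "gder (GH i) (gder (GH k) f) (m', A) = 0" for i k
          using m'0 by simp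
        then have "(2 \<odot> (\<Sum>i=1..n. gder (GH i) (gder (GH (2*n+1-i)) f))) (m', A) = 0"
          by (simp add: fscale_def sum_fun_apply del: gder.simps)
        moreover have "D22 n f (m', A) = 0" using D by (simp add: D22_eq)
        ultimately have "gder (GX ?o) (gder (GX ?o) f) (m', A) = 0"
          by (simp add: D22_def del: gder.simps)
        moreover have "m'(?o := m' ?o + 1 + 1) = m" using m False by (auto simp: m'_def fun_eq_iff)
        moreover have "gder (GX ?o) (gder (GX ?o) f) (m', A)
          = of_nat (m' ?o + 1) * (of_nat (m' ?o + 1 + 1) * f (m'(?o := m' ?o + 1 + 1), A))"
          by simp
        ultimately have "of_nat (m' ?o + 1) * (of_nat (m' ?o + 1 + 1) * f (m, A)) = (0 :: complex)" by simp
        then show ?thesis unfolding mult_eq_0_iff of_nat_eq_0_iff by simp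
      qed
    qed
  qed
  then show ?thesis by (auto simp: fun_eq_iff)
qed

text \<open>A description of extremal vectors that does not refer to a submodule, so that vectors
  found in different subquotients can be compared.\<close>

definition topvec :: "nat \<Rightarrow> nat \<Rightarrow> nat \<Rightarrow> spoly \<Rightarrow> bool"
  where "topvec n p r f \<longleftrightarrow> f \<in> Low n p r \<and> (\<forall>s. f s \<noteq> 0 \<longrightarrow> fst s (2*n+1) \<le> 1 \<longrightarrow> s = topmono n p r)"

lemma topvec_proportional:
  assumes "topvec n p r f" "topvec n p r g" "f \<noteq> 0"
  shows "\<exists>c. g = c \<odot> f"
proof -
  have D: "Dop n True f = 0" "Dop n True g = 0" using assms by (auto simp: topvec_def Low_def)
  have "f (topmono n p r) \<noteq> 0"
  proof
    assume "f (topmono n p r) = 0"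
    then have "f = 0" using assms by (intro D22_determined[OF D(1)]) (auto simp: topvec_def)
    with assms show False by simp
  qed
  define c where "c = g (topmono n p r) / f (topmono n p r)"
  have "g - c \<odot> f = 0"
  proof (rule D22_determined)
    show "Dop n True (g - c \<odot> f) = 0" using D by (simp add: DF_lins)
    fix s :: smono assume s: "fst s (2*n+1) \<le> 1"
    show "(g - c \<odot> f) s = 0"
    proof (cases "s = topmono n p r")
      case True
      then show ?thesis using \<open>f (topmono n p r) \<noteq> 0\<close> by (simp add: c_def fscale_def)
    next
      case False
      then have "f s = 0" "g s = 0" using assms s by (auto simp: topvec_def simp del: split_paired_All)
      then show ?thesis by (simp add: fscale_def)
    qed
  qed
  then show ?thesis by auto
qed

lemma spo_stable_zero: "spo_stable n {0}"
  by (simp add: spo_stable_def DF_lins fs.subspace_0 fs.subspace_def)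

lemma exists_topvec:
  assumes n: "n \<ge> 1" and U: "spo_stable n U" "spo_stable n U'" "U' \<subseteq> Low n p r" and ne: "\<not> U' \<subseteq> U"
  obtains f \<mu> where "f \<in> U'" "f \<notin> U" "wvec n \<mu> f" "topvec n p r f" "admissible n p r"
    "\<And>i. i \<in> {1..n} \<Longrightarrow> \<mu> i = (if i = 1 then int p else 0) + of_bool (i \<le> rbar n r)"
    "\<And>k l. k \<in> idx n \<Longrightarrow> l \<in> idx n \<Longrightarrow> height n k > height n l \<Longrightarrow> spoX n k l f \<in> U"
proof -
  obtain f \<mu> where f: "f \<in> U'" "f \<notin> U" "wvec n \<mu> f"
    and raise: "\<And>k l. k \<in> idx n \<Longrightarrow> l \<in> idx n \<Longrightarrow> height n k > height n l \<Longrightarrow> spoX n k l f \<in> U"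
    using exists_maximal_vector[OF U ne] by metis
  have n1: "i \<in> idx n" if "i \<in> {1..n}" for i using that by (auto simp: idx_def)
  have fL: "f \<in> Low n p r" using f U by blast
  have cas_val: "cas_val n \<mu> = int p * (int p + 2 * int n + 1) + int r * (2 * int n + 1 - int r)"
    by (rule maximal_vector_casimir[OF U(1) fL f(2,3) raise])
  have top: "s = topmono n p r \<and> admissible n p r \<and> (\<forall>i\<in>{1..n}. wt n i s = (if i = 1 then int p else 0) + of_bool (i \<le> rbar n r))"
    if s: "f s \<noteq> 0" "fst s (2*n+1) \<le> 1" for s
  proof (rule topmono_unique[OF n _ _ _ s(2)])
    show "g \<in> gens n" if "gcount g s \<noteq> 0" for g
      using fL s that unfolding Low_def SE_iff by blast
    show "bdeg n False s = p" "bdeg n True s = r" using fL s unfolding Low_def by blast+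
    have "wt n i s = \<mu> i" if "i \<in> {1..n}" for i
      using f(3) s n1[OF that] unfolding wvec_def by blast
    then show "cas_val n (\<lambda>i. wt n i s) = int p * (int p + 2 * int n + 1) + int r * (2 * int n + 1 - int r)"
      unfolding cas_val[symmetric] cas_val_def by (intro sum.cong) auto
  qed
  have "f \<noteq> 0" using f U fs.subspace_0 unfolding spo_stable_def by blast
  \<comment> \<open>A nonzero \<open>f\<close> has a coefficient of degree at most 1 in the last
    even variable. It can only sit at \<open>topmono n p r\<close>, from which weight and
    admissibility are read off.\<close>
  have "\<exists>s. f s \<noteq> 0 \<and> fst s (2*n+1) \<le> 1"
    using D22_determined[of n f] fL \<open>f \<noteq> 0\<close> unfolding Low_def by blast
  then obtain s where s: "f s \<noteq> 0" "fst s (2*n+1) \<le> 1" by blast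
  have "\<mu> i = (if i = 1 then int p else 0) + of_bool (i \<le> rbar n r)" if "i \<in> {1..n}" for i
  proof -
    have "wt n i s = \<mu> i" using f(3) s n1[OF that] unfolding wvec_def by blast
    then show ?thesis using top[OF s] that by auto
  qed
  moreover have "topvec n p r f" using fL top unfolding topvec_def by blast
  ultimately show ?thesis using that f raise top[OF s] by blast
qed

lemma Low_irreducible:
  assumes n: "n \<ge> 1" and U: "spo_stable n U" "U \<subseteq> Low n p r" "U \<noteq> {0}"
  shows "U = Low n p r"
proof (rule ccontr)
  assume "U \<noteq> Low n p r"
  then have "\<not> Low n p r \<subseteq> U" using U by blast
  then obtain w where w: "w \<in> Low n p r" "w \<notin> U" "topvec n p r w"
    using exists_topvec[OF n U(1) spo_stable_Low order_refl] by metis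
  have "0 \<in> U" using U fs.subspace_0 unfolding spo_stable_def by blast
  then have "\<not> U \<subseteq> {0}" using U by blast
  then obtain v where v: "v \<in> U" "v \<notin> {0}" "topvec n p r v"
    using exists_topvec[OF n spo_stable_zero U(1,2)] by metis
  then obtain c where "w = c \<odot> v" using topvec_proportional w by blast
  then show False using v w U fs.subspace_scale unfolding spo_stable_def by blast
qed

lemma Low_not_admissible: "n \<ge> 1 \<Longrightarrow> \<not> admissible n p r \<Longrightarrow> Low n p r = {0}"
  using exists_topvec[OF _ spo_stable_zero spo_stable_Low order_refl, of n p r] fs.subspace_0[OF subspace_Low[of n p r]]
  by blast

subsection \<open>Existence of extremal vectors\<close>

declare gder.simps [simp del] gmul.simps [simp del] One_nat_def [simp del]

lemma gder_derd: "gder e (derd a b f) = koszul (gpar e) (gpar a \<noteq> gpar b) \<odot> derd a b (gder e f)"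
  unfolding derd_def
  by (subst gder_gder[of e a], subst gder_gder[of e b]) (simp add: lins koszul_def)

lemma gder_D22: "gder e (Dop n True f) = Dop n True (gder e f)"
proof -
  have "gder e (derd (zgen n True j) (zgen n True (dual n j)) f) = derd (zgen n True j) (zgen n True (dual n j)) (gder e f)"
    if "j \<in> idx n" for j
    unfolding gder_derd using that by (simp add: koszul_def)
  then show ?thesis unfolding Dop_def lins by (intro sum.cong refl) simp
qed

lemma D12_D22: "Dop n False (Dop n True f) = Dop n True (Dop n False f)"
  by (simp add: Dop_def[of n False] derd_def gder_D22 DF_lins)

section \<open>Powers of the last even variable\<close>

definition tpow :: "nat \<Rightarrow> nat \<Rightarrow> spoly \<Rightarrow> spoly"
  where "tpow n k f = (gmul (GX (2*n+1)) ^^ k) f"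

lemma tpow_0 [simp]: "tpow n 0 f = f"
  and tpow_Suc: "tpow n (Suc k) f = gmul (GX (2*n+1)) (tpow n k f)"
  by (simp_all add: tpow_def)

lemma lin_tpow: "lin (tpow n k)"
proof (induction k)
  case 0
  then show ?case by (rule linI) (simp_all only: tpow_0)
next
  case (Suc k)
  then show ?case unfolding tpow_Suc[abs_def] by (rule lin_compose[OF lin_gmul])
qed

lemmas tpow_lins = lin_rules[OF lin_tpow]

lemma gmul_tpow: "gmul e (tpow n k f) = tpow n k (gmul e f)"
proof (induction k)
  case (Suc k)
  have "gmul e (gmul (GX (2*n+1)) (tpow n k f)) = gmul (GX (2*n+1)) (gmul e (tpow n k f))"
    by (subst gmul_gmul) (simp add: koszul_def)
  then show ?case using Suc by (simp only: tpow_Suc)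
qed simp

lemma gder_tpow:
  assumes "e \<noteq> GX (2*n+1)"
  shows "gder e (tpow n k f) = tpow n k (gder e f)"
proof (induction k)
  case (Suc k)
  then show ?case using assms by (simp add: tpow_Suc gder_gmul koszul_def)
qed simp

text \<open>At \<open>k = 0\<close> the factor \<open>of_nat k\<close> vanishes, so the truncated
  \<open>k - 1\<close> is harmless; likewise for \<open>k - 2\<close> in
  \<open>D22_tpow\<close>.\<close>

lemma gder_t_tpow:
  assumes "gder (GX (2*n+1)) f = 0"
  shows "gder (GX (2*n+1)) (tpow n k f) = of_nat k \<odot> tpow n (k - 1) f"
proof (induction k)
  case 0
  then show ?case using assms by simp
next
  case (Suc k)
  have "gmul (GX (2*n+1)) (of_nat k \<odot> tpow n (k - 1) f) = of_nat k \<odot> tpow n k f"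
    by (cases k) (simp_all add: lins tpow_Suc[symmetric])
  then show ?case using Suc
    by (simp add: tpow_Suc gder_gmul koszul_def) (simp add: fscale_simps)
qed

lemma D22_tpow:
  assumes "gder (GX (2*n+1)) f = 0"
  shows "Dop n True (tpow n k f) = (of_nat k * of_nat (k - 1)) \<odot> tpow n (k - 2) f + tpow n k (Dop n True f)"
proof -
  have "gder (GX (2*n+1)) (gder (GX (2*n+1)) (tpow n k f)) = (of_nat k * of_nat (k - 1)) \<odot> tpow n (k - 2) f"
    using assms by (simp add: gder_t_tpow lins)
  then show ?thesis
    using assms by (simp add: D22_eq[symmetric] D22_def gder_tpow tpow_lins lins)
qed

lemma D12_tpow:
  assumes "gder (GX (2*n+1)) f = 0" "gder (GH (2*n+1)) f = 0"
  shows "Dop n False (tpow n k f) = tpow n k (Dop n False f)"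
proof -
  have "gder (GX i) (gder (GH j) (tpow n k f)) = tpow n k (gder (GX i) (gder (GH j) f))" if "i \<noteq> 2*n+1" for i j
    using that by (simp add: gder_tpow)
  then have "(\<Sum>i=1..n. gder (GX i) (gder (GH (2*n+1-i)) (tpow n k f)) - gder (GX (2*n+1-i)) (gder (GH i) (tpow n k f)))
    = tpow n k (\<Sum>i=1..n. gder (GX i) (gder (GH (2*n+1-i)) f) - gder (GX (2*n+1-i)) (gder (GH i) f))"
    unfolding tpow_lins(6) by (intro sum.cong refl) (subst tpow_lins(5), auto)
  moreover have "gder (GH (2*n+1)) (tpow n k f) = 0"
    using assms(2) by (simp add: gder_tpow tpow_lins)
  ultimately show ?thesis
    using assms by (simp only: D12_eq[symmetric] D12_def tpow_lins lins add_0_left)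
qed

lemma F21_tpow: "Fop n True (tpow n k f) = tpow n k (Fop n True f)"
proof -
  have "(\<Sum>i=1..2*n. gmul (GH i) (gder (GX i) (tpow n k f))) = tpow n k (\<Sum>i=1..2*n. gmul (GH i) (gder (GX i) f))"
    unfolding tpow_lins(6)
  proof (intro sum.cong refl)
    fix i assume "i \<in> {1..2*n}"
    then show "gmul (GH i) (gder (GX i) (tpow n k f)) = tpow n k (gmul (GH i) (gder (GX i) f))"
      by (subst gder_tpow) (auto simp: gmul_tpow)
  qed
  then show ?thesis
    by (simp add: F21_eq[symmetric] F21_def gder_tpow gmul_tpow tpow_lins)
qed

lemma tpow_apply:
  "tpow n k f (m, A) = (if m (2*n+1) < k then 0 else f (m(2*n+1 := m (2*n+1) - k), A))"
proof (induction k arbitrary: m)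
  case (Suc k)
  then show ?case
    by (cases "m (2*n+1)") (auto simp: tpow_Suc gmul.simps, simp add: fun_upd_def)
qed simp

lemma tpow_supp:
  assumes "tpow n k f s \<noteq> 0"
  obtains s' where "f s' \<noteq> 0" "bdeg n False s = bdeg n False s'" "bdeg n True s = bdeg n True s' + k"
proof -
  obtain m A where s: "s = (m, A)" by force
  let ?m = "m(2*n+1 := m (2*n+1) - k)"
  have *: "\<not> m (2*n+1) < k" "f (?m, A) \<noteq> 0" using assms s by (auto simp: tpow_apply split: if_splits)
  have "(\<Sum>i=1..n. ?m i + ?m (2*n+1-i)) = (\<Sum>i=1..n. m i + m (2*n+1-i))"
    by (intro sum.cong) auto
  then have "bdeg n False s = bdeg n False (?m, A)" unfolding s bdeg_expand by simp
  moreover have "bdeg n True s = bdeg n True (?m, A) + k" unfolding s bdeg_expand using *(1) by simp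
  ultimately show ?thesis using that *(2) by blast
qed

lemma SE_tpow: "f \<in> SE n \<Longrightarrow> tpow n k f \<in> SE n"
  by (induction k) (auto simp: tpow_Suc gens_def intro!: SE_gmul)

lemma SE_Dop: "f \<in> SE n \<Longrightarrow> Dop n a f \<in> SE n"
  unfolding Dop_def derd_def by (intro fs.subspace_sum fs.subspace_scale subspace_SE SE_gder)

section \<open>The monomials that are extended to the kernel of \<open>D22\<close>\<close>

definition basemono :: "nat \<Rightarrow> nat \<Rightarrow> smono"
  where "basemono p k = (\<lambda>i. if i = 1 then p else 0, {1..k})"

definition base :: "nat \<Rightarrow> nat \<Rightarrow> spoly"
  where "base p k = (\<lambda>s. if s = basemono p k then 1 else 0)"

lemma gder_GX_base: "i \<noteq> 1 \<or> p = 0 \<Longrightarrow> gder (GX i) (base p k) = 0"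
  by (auto simp: gder.simps gmul.simps fun_eq_iff base_def basemono_def dest: fun_cong[of _ _ i])

lemma gder_GH_base: "i \<notin> {1..k} \<Longrightarrow> gder (GH i) (base p k) = 0"
  by (auto simp: gder.simps gmul.simps fun_eq_iff base_def basemono_def)

lemma gmul_GH_base: "i \<in> {1..k} \<Longrightarrow> gmul (GH i) (base p k) = 0"
  by (auto simp: gder.simps gmul.simps fun_eq_iff base_def basemono_def)

text \<open>The only even variable in \<open>base p k\<close> is \<open>x_1\<close>, whose
  derivative is paired with that of \<open>eta_(2n)\<close>; this variable is absent if
  \<open>k < 2*n\<close>.\<close>

lemma D12_base:
  assumes "n \<ge> 1" "p = 0 \<or> k < 2*n" "k \<le> 2*n"
  shows "Dop n False (base p k) = 0"
proof -
  have *: "gder (GX i) (gder (GH (2*n+1-i)) (base p k)) = 0" if "i \<in> {1..2*n+1}" for i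
  proof (cases "i = 1 \<and> p \<noteq> 0")
    case True
    then show ?thesis using assms that by (subst gder_GH_base) (auto simp: lins)
  next
    case False
    then have "gder (GX i) (base p k) = 0" by (intro gder_GX_base) auto
    then show ?thesis by (subst gder_gder) (simp add: lins)
  qed
  have **: "gder (GX i) (gder (GH (2*n+1-i)) (base p k)) - gder (GX (2*n+1-i)) (gder (GH i) (base p k)) = 0"
    if "i \<in> {1..n}" for i
  proof -
    have "2*n+1-i \<in> {1..2*n+1}" "i \<in> {1..2*n+1}" "2*n+1-(2*n+1-i) = i" using that by auto
    then show ?thesis using *[of i] *[of "2*n+1-i"] by simp
  qed
  have "(\<Sum>i=1..n. gder (GX i) (gder (GH (2*n+1-i)) (base p k)) - gder (GX (2*n+1-i)) (gder (GH i) (base p k))) = 0"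
    by (intro sum.neutral ballI **)
  moreover have "gder (GH (2*n+1)) (base p k) = 0" using assms by (intro gder_GH_base) auto
  ultimately show ?thesis
    unfolding D12_eq[symmetric] D12_def by (simp only: lins add_0_left)
qed

text \<open>Only the term replacing \<open>x_1\<close> by \<open>eta_1\<close> could be nonzero, and
  \<open>eta_1\<close> already occurs if \<open>k >= 1\<close>.\<close>

lemma F21_base:
  assumes "p = 0 \<or> k \<ge> 1" "k \<le> 2*n"
  shows "Fop n True (base p k) = 0"
proof -
  have "gmul (GH i) (gder (GX i) (base p k)) = 0" for i
  proof (cases "i = 1 \<and> p \<noteq> 0")
    case True
    then have "gmul (GH i) (base p k) = 0" using assms by (intro gmul_GH_base) auto
    then have "gder (GX i) (gmul (GH i) (base p k)) = 0" by (simp add: lins)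
    then show ?thesis unfolding gder_gmul by (simp add: koszul_def)
  next
    case False
    then show ?thesis by (subst gder_GX_base) (auto simp: lins)
  qed
  moreover have "gder (GH (2*n+1)) (base p k) = 0" using assms by (intro gder_GH_base) auto
  ultimately show ?thesis
    unfolding F21_eq[symmetric] F21_def by (simp add: lins)
qed

lemma base_SE: "n \<ge> 1 \<Longrightarrow> k \<le> 2*n \<Longrightarrow> base p k \<in> SE n"
proof -
  assume n: "n \<ge> 1" "k \<le> 2*n"
  have "{s. base p k s \<noteq> 0} = {basemono p k}" by (auto simp: base_def)
  moreover have "g \<in> gens n" if "gcount g (basemono p k) \<noteq> 0" for g
    using that n by (cases g) (auto simp: basemono_def gens_def split: if_splits)
  ultimately show ?thesis by (auto simp: SE_iff base_def split: if_splits)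
qed

lemma bdeg_basemono:
  assumes "n \<ge> 1" "k \<le> 2*n"
  shows "bdeg n False (basemono p k) = p" "bdeg n True (basemono p k) = k"
proof -
  have "(\<Sum>i=1..2*n. gcount (zgen n False i) (basemono p k)) = (\<Sum>i=1..2*n. if i = 1 then p else 0)"
    by (intro sum.cong refl) (simp add: zgen_even basemono_def)
  then show "bdeg n False (basemono p k) = p"
    using assms unfolding bdeg_def sum_idx_split_last by (simp add: zgen_simps basemono_def)
  have "(\<Sum>i=1..2*n. gcount (zgen n True i) (basemono p k)) = (\<Sum>i=1..2*n. of_bool (i \<in> {1..k}))"
    by (intro sum.cong refl) (simp add: zgen_even basemono_def)
  also have "\<dots> = (\<Sum>i\<in>{1..k}. 1)"
    by (rule sum.mono_neutral_cong_right) (use assms in auto)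
  finally show "bdeg n True (basemono p k) = k"
    using assms unfolding bdeg_def sum_idx_split_last by (simp add: zgen_simps basemono_def)
qed

text \<open>
  With \<open>t\<close> the last even variable, the harmonic extension of \<open>t ^ b * g\<close>, where \<open>g\<close> is free of \<open>t\<close>, is
  \<open>\<Sum>j. (-1) ^ j * t ^ (2 * j + b) / (2 * j + b)! * D\<^sub>2\<^sub>2 ^ j g\<close>.
\<close>

definition harm :: "nat \<Rightarrow> nat \<Rightarrow> nat \<Rightarrow> nat \<Rightarrow> spoly"
  where "harm n b p k = (\<Sum>j\<le>k. ((-1) ^ j / fact (2*j+b)) \<odot> tpow n (2*j+b) ((Dop n True ^^ j) (base p k)))"

text \<open>\<open>D22\<close> commutes with all derivatives and with \<open>D12\<close>. For
  \<open>F21\<close> the correction term in \<open>D22_F21\<close> is \<open>D12\<close>, so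
  vanishing under \<open>D12\<close> and under \<open>F21\<close> has to be carried through the
  induction together.\<close>

lemma D22_power_base:
  assumes "n \<ge> 1" "p = 0 \<or> k < 2*n" "k \<le> 2*n" "p = 0 \<or> k \<ge> 1"
  defines "g \<equiv> \<lambda>j. (Dop n True ^^ j) (base p k)"
  shows "gder (GX (2*n+1)) (g j) = 0" "gder (GH (2*n+1)) (g j) = 0" "Dop n False (g j) = 0" "Fop n True (g j) = 0"
    "g j \<in> SE n" "g j s \<noteq> 0 \<Longrightarrow> bdeg n False s = p \<and> bdeg n True s + 2 * j = k"
proof -
  have "gder (GX (2*n+1)) (g j) = 0 \<and> gder (GH (2*n+1)) (g j) = 0 \<and> Dop n False (g j) = 0 \<and> Fop n True (g j) = 0
    \<and> g j \<in> SE n \<and> (\<forall>s. g j s \<noteq> 0 \<longrightarrow> bdeg n False s = p \<and> bdeg n True s + 2 * j = k)"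
  proof (induction j)
    case 0
    have "gder (GX (2*n+1)) (base p k) = 0" using assms by (intro gder_GX_base) auto
    moreover have "gder (GH (2*n+1)) (base p k) = 0" using assms by (intro gder_GH_base) auto
    moreover have "bdeg n False s = p \<and> bdeg n True s = k" if "base p k s \<noteq> 0" for s
      using that bdeg_basemono[of n k p] assms by (auto simp: base_def split: if_splits)
    ultimately show ?case
      using assms D12_base F21_base base_SE by (simp add: g_def del: split_paired_All)
  next
    case (Suc j)
    have g: "g (Suc j) = Dop n True (g j)" by (simp add: g_def)
    have F: "Fop n True (Dop n True (g j)) = 0"
    proof -
      have "Dop n False (g j) = 0" "Fop n True (g j) = 0" using Suc by blast+
      then show ?thesis using D22_F21[of n "g j"] by (simp add: DF_lins)
    qed
    have "bdeg n False s = p \<and> bdeg n True s + 2 * Suc j = k" if "Dop n True (g j) s \<noteq> 0" for s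
      using that
    proof (rule Dop_supp)
      fix s' assume s': "g j s' \<noteq> 0" and b: "\<And>b. bdeg n b s' = bdeg n b s + of_bool (b = True) + of_bool b"
      have "bdeg n False s' = p \<and> bdeg n True s' + 2 * j = k" using Suc s' by blast
      then show ?thesis using b[of False] b[of True] by simp
    qed
    note deg = this
    have IH: "gder (GX (2*n+1)) (g j) = 0" "gder (GH (2*n+1)) (g j) = 0" "Dop n False (g j) = 0" "g j \<in> SE n"
      using Suc by blast+
    show ?case
      unfolding g gder_D22 D12_D22 IH lin_rules(3)[OF lin_Dop] using deg F SE_Dop[OF IH(4)] by blast
  qed
  then show "gder (GX (2*n+1)) (g j) = 0" "gder (GH (2*n+1)) (g j) = 0" "Dop n False (g j) = 0" "Fop n True (g j) = 0"
    "g j \<in> SE n" "g j s \<noteq> 0 \<Longrightarrow> bdeg n False s = p \<and> bdeg n True s + 2 * j = k"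
    by blast+
qed

text \<open>The sum telescopes under \<open>D22\<close>: the second derivative in \<open>t\<close>
  of term \<open>j + 1\<close> cancels \<open>D22\<close> applied to the \<open>t\<close>-free
  factor of term \<open>j\<close>, by the choice of the signs and factorials in
  \<open>c\<close>.\<close>

lemma harm_Low:
  assumes a: "n \<ge> 1" "p = 0 \<or> k < 2*n" "k \<le> 2*n" "p = 0 \<or> k \<ge> 1" and b: "b \<le> 1"
  shows "harm n b p k \<in> Low n p (k + b)"
proof -
  define g where "g j = (Dop n True ^^ j) (base p k)" for j
  note g = D22_power_base[OF a, folded g_def]
  define c :: "nat \<Rightarrow> complex" where "c j = (-1) ^ j / fact (2*j+b)" for j
  have h: "harm n b p k = (\<Sum>j\<le>k. c j \<odot> tpow n (2*j+b) (g j))"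
    by (simp add: harm_def g_def c_def)
  have gS: "Dop n True (g j) = g (Suc j)" for j by (simp add: g_def)
  \<comment> \<open>Each \<open>D22\<close> lowers the degree in the \<open>w_1\<close> variables by
    2, so its power \<open>k + 1\<close> annihilates a base of degree \<open>k\<close>, and the
    summation range \<open>j <= k\<close> loses nothing.\<close>
  have "g (Suc k) s = 0" for s using g(6)[of "Suc k" s] by auto
  then have gk: "g (Suc k) = 0" by (auto simp: fun_eq_iff)
  have c: "c (Suc j) * (of_nat (2 * Suc j + b) * of_nat (2 * Suc j + b - 1)) = - c j" for j
  proof -
    define x :: complex where "x = of_nat (2 * Suc j + b) * of_nat (2 * Suc j + b - 1)"
    have F: "(fact (2 * Suc j + b) :: complex) = x * fact (2 * j + b)"
      by (simp add: x_def algebra_simps)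
    have "x \<noteq> 0"
      unfolding x_def mult_eq_0_iff of_nat_eq_0_iff by simp
    then have "c (Suc j) * x = - c j" unfolding c_def F power_Suc by simp
    then show ?thesis unfolding x_def .
  qed
  have D: "Dop n False (harm n b p k) = 0" "Fop n True (harm n b p k) = 0"
    unfolding h by (simp_all add: DF_lins D12_tpow F21_tpow g tpow_lins)
  have D22: "Dop n True (harm n b p k) = (\<Sum>j\<le>k. c j \<odot> ((of_nat (2*j+b) * of_nat (2*j+b-1)) \<odot> tpow n (2*j+b-2) (g j)))
     + (\<Sum>j\<le>k. c j \<odot> tpow n (2*j+b) (g (Suc j)))"
    unfolding h sum.distrib[symmetric]
    by (simp add: DF_lins D22_tpow[OF g(1)] gS fs.scale_right_distrib)
  have "(\<Sum>j\<le>k. c j \<odot> ((of_nat (2*j+b) * of_nat (2*j+b-1)) \<odot> tpow n (2*j+b-2) (g j)))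
     = (\<Sum>j\<le>Suc k. c j \<odot> ((of_nat (2*j+b) * of_nat (2*j+b-1)) \<odot> tpow n (2*j+b-2) (g j)))"
    by (simp add: gk tpow_lins)
  \<comment> \<open>The term \<open>j = 0\<close> drops out because \<open>b * (b - 1) = 0\<close>
    for \<open>b <= 1\<close>.\<close>
  also have "\<dots> = (\<Sum>j\<le>k. c (Suc j) \<odot> ((of_nat (2*Suc j+b) * of_nat (2*Suc j+b-1)) \<odot> tpow n (2*Suc j+b-2) (g (Suc j))))"
    unfolding sum.atMost_Suc_shift using b by simp
  also have "\<dots> = (\<Sum>j\<le>k. - (c j \<odot> tpow n (2*j+b) (g (Suc j))))"
    by (intro sum.cong refl) (simp only: fs.scale_scale c fs.scale_minus_left, simp)
  finally have D22: "Dop n True (harm n b p k) = 0"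
    unfolding D22 by (simp only: sum_negf add.left_inverse)
  have "bdeg n False s = p \<and> bdeg n True s = k + b" if s: "harm n b p k s \<noteq> 0" for s
  proof -
    obtain j where "c j * tpow n (2*j+b) (g j) s \<noteq> 0"
      using s unfolding h sum_fun_apply by (metis (no_types, lifting) fscale_def sum.neutral)
    then have "tpow n (2*j+b) (g j) s \<noteq> 0" by simp
    then obtain s' where s': "g j s' \<noteq> 0" "bdeg n False s = bdeg n False s'" "bdeg n True s = bdeg n True s' + (2*j+b)"
      by (rule tpow_supp) blast
    then show ?thesis using g(6)[of j s'] by simp
  qed
  moreover have "harm n b p k \<in> SE n"
    unfolding h by (intro fs.subspace_sum fs.subspace_scale subspace_SE SE_tpow g)
  ultimately show ?thesis unfolding Low_def using D D22 by blast
qed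

text \<open>At the monomial \<open>t^b\<close> times the base the exponent of \<open>t\<close> is at
  most 1, so only the term \<open>j = 0\<close> contributes, with coefficient 1.\<close>

lemma harm_nonzero:
  assumes "n \<ge> 1" "b \<le> 1"
  shows "harm n b p k \<noteq> 0"
proof -
  let ?m = "(fst (basemono p k))(2*n+1 := b)"
  have m: "?m(2*n+1 := 0) = fst (basemono p k)" using assms by (auto simp: basemono_def fun_eq_iff)
  have "harm n b p k (?m, {1..k}) = (\<Sum>j\<le>k. if j = 0 then 1 else 0)"
    unfolding harm_def sum_fun_apply
  proof (intro sum.cong refl)
    fix j
    show "(((-1) ^ j / fact (2*j+b)) \<odot> tpow n (2*j+b) ((Dop n True ^^ j) (base p k))) (?m, {1..k}) = (if j = 0 then 1 else 0)"
    proof (cases j)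
      case 0
      have "(fact b :: complex) = 1" using assms by (cases b) auto
      then show ?thesis using 0 m by (simp add: fscale_def tpow_apply base_def basemono_def)
    next
      case (Suc i)
      then show ?thesis by (simp add: fscale_def tpow_apply)
    qed
  qed
  then have "harm n b p k (?m, {1..k}) \<noteq> 0" by simp
  then show ?thesis by auto
qed

lemma Low_admissible:
  assumes "n \<ge> 1" "admissible n p r"
  shows "Low n p r \<noteq> {0}"
proof (cases "n < r")
  case True
  \<comment> \<open>For \<open>r > n\<close> one factor is taken from \<open>t\<close>; then
    \<open>k = r - 1\<close> satisfies \<open>k <= 2*n\<close> for every admissible
    \<open>r\<close>, and \<open>k < 2*n\<close> if \<open>p > 0\<close>.\<close>
  then have "harm n 1 p (r - 1) \<in> Low n p (r - 1 + 1)"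
    using assms by (intro harm_Low) (auto simp: admissible_def)
  then show ?thesis using harm_nonzero[of n 1 p "r - 1"] assms True by auto
next
  case False
  then have "harm n 0 p r \<in> Low n p (r + 0)"
    using assms by (intro harm_Low) (auto simp: admissible_def)
  then show ?thesis using harm_nonzero[of n 0 p r] assms by auto
qed

subsection \<open>Gradings\<close>

definition graded_part :: "('a \<Rightarrow> 'b) \<Rightarrow> 'b \<Rightarrow> ('a \<Rightarrow> complex) \<Rightarrow> ('a \<Rightarrow> complex)"
  where "graded_part \<gamma> x f = (\<lambda>s. if \<gamma> s = x then f s else 0)"

text \<open>\<open>\<phi>\<close> turns the degree of an output monomial into that of the inputs
  contributing to it. At a given monomial \<open>T f\<close> therefore sees either only the
  component of degree \<open>x\<close> or nothing of it.\<close>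

lemma graded_part_kernel:
  assumes T: "lin T" and shift: "\<And>g s. T g s \<noteq> 0 \<Longrightarrow> \<exists>s'. g s' \<noteq> 0 \<and> \<gamma> s' = \<phi> (\<gamma>' s)" and "T f = 0"
  shows "T (graded_part \<gamma> x f) = 0"
proof (rule ccontr)
  assume "T (graded_part \<gamma> x f) \<noteq> 0"
  then obtain s where s: "T (graded_part \<gamma> x f) s \<noteq> 0" by (metis ext zero_fun_apply)
  then obtain s' where "graded_part \<gamma> x f s' \<noteq> 0" "\<gamma> s' = \<phi> (\<gamma>' s)" using shift by blast
  then have x: "\<phi> (\<gamma>' s) = x" by (auto simp: graded_part_def split: if_splits)
  have "T (f - graded_part \<gamma> x f) s = 0"
  proof (rule ccontr)
    assume "T (f - graded_part \<gamma> x f) s \<noteq> 0"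
    then obtain t where "(f - graded_part \<gamma> x f) t \<noteq> 0" "\<gamma> t = \<phi> (\<gamma>' s)" using shift by blast
    then show False using x by (auto simp: graded_part_def split: if_splits)
  qed
  moreover have "T (f - graded_part \<gamma> x f) = T f - T (graded_part \<gamma> x f)" by (rule lin_rules(5)[OF T])
  ultimately have "T (graded_part \<gamma> x f) s = 0" using \<open>T f = 0\<close> by simp
  with s show False by simp
qed

lemma SE_graded_part: "f \<in> SE n \<Longrightarrow> graded_part \<gamma> x f \<in> SE n"
  unfolding SE_iff graded_part_def
  by (auto elim!: rev_finite_subset simp del: split_paired_All)

lemma graded_part_sum:
  assumes "finite {s. f s \<noteq> 0}"
  shows "f = (\<Sum>x\<in>\<gamma> ` {s. f s \<noteq> 0}. graded_part \<gamma> x f)"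
proof
  fix s
  have "(\<Sum>x\<in>\<gamma> ` {s. f s \<noteq> 0}. graded_part \<gamma> x f s) = (\<Sum>x\<in>\<gamma> ` {s. f s \<noteq> 0}. if x = \<gamma> s then f s else 0)"
    by (intro sum.cong) (auto simp: graded_part_def)
  also have "\<dots> = f s" using assms by auto
  finally show "f s = (\<Sum>x\<in>\<gamma> ` {s. f s \<noteq> 0}. graded_part \<gamma> x f) s" by (simp add: sum_fun_apply)
qed

section \<open>The parity grading and its involution\<close>

definition hpar :: "nat \<Rightarrow> smono \<Rightarrow> bool"
  where "hpar n s = odd (hdeg n s)"

text \<open>The parity involution. It turns the Koszul sign of passing an odd operator into a linear
  operator, which makes sense for inhomogeneous vectors too.\<close>

definition eps :: "nat \<Rightarrow> spoly \<Rightarrow> spoly"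
  where "eps n f = (\<lambda>s. (if hpar n s then -1 else 1) * f s)"

lemma eps_eps [simp]: "eps n (eps n f) = f"
  by (auto simp: eps_def fun_eq_iff)

lemma lin_eps: "lin (eps n)"
  by (rule linI) (auto simp: eps_def fun_eq_iff fscale_def algebra_simps)

lemma graded_part_hpar: "graded_part (hpar n) True f + graded_part (hpar n) False f = f"
  "eps n f = graded_part (hpar n) False f - graded_part (hpar n) True f"
  by (auto simp: fun_eq_iff graded_part_def eps_def)

lemma eps_intertwine:
  assumes T: "lin T" and shift: "\<And>g s. T g s \<noteq> 0 \<Longrightarrow> \<exists>s'. g s' \<noteq> 0 \<and> hpar n s' = (hpar n s \<noteq> e)"
  shows "eps n (T f) = koszul True e \<odot> T (eps n f)"
proof
  fix s
  have 1: "T (graded_part (hpar n) q f) s = 0" if "q \<noteq> (hpar n s \<noteq> e)" for q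
  proof (rule ccontr)
    assume "T (graded_part (hpar n) q f) s \<noteq> 0"
    then obtain s' where "graded_part (hpar n) q f s' \<noteq> 0" "hpar n s' = (hpar n s \<noteq> e)" using shift by blast
    then show False using that by (auto simp: graded_part_def split: if_splits)
  qed
  have "T f s = T (graded_part (hpar n) True f) s + T (graded_part (hpar n) False f) s"
    using lin_rules(1)[OF T, of "graded_part (hpar n) True f" "graded_part (hpar n) False f"] graded_part_hpar(1)[of n f] by simp
  moreover have "T (eps n f) s = T (graded_part (hpar n) False f) s - T (graded_part (hpar n) True f) s"
    unfolding graded_part_hpar(2) by (simp add: lin_rules(5)[OF T])
  ultimately show "eps n (T f) s = (koszul True e \<odot> T (eps n f)) s"
    using 1[of True] 1[of False] by (cases e; cases "hpar n s") (simp_all add: eps_def fscale_def koszul_def)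
qed

lemma spoX_hpar_shift:
  assumes "k \<in> idx n" "l \<in> idx n" "spoX n k l g s \<noteq> 0"
  shows "\<exists>s'. g s' \<noteq> 0 \<and> hpar n s' = (hpar n s \<noteq> (spo_par n k \<noteq> spo_par n l))"
  using assms(3,1,2) by (rule spoX_supp) (auto simp: hpar_def)

lemma Fop_hpar_shift: "Fop n a g s \<noteq> 0 \<Longrightarrow> \<exists>s'. g s' \<noteq> 0 \<and> hpar n s' = (hpar n s \<noteq> True)"
  by (erule Fop_supp) (auto simp: hpar_def)

lemma Dop_hpar_shift: "Dop n a g s \<noteq> 0 \<Longrightarrow> \<exists>s'. g s' \<noteq> 0 \<and> hpar n s' = (hpar n s \<noteq> (\<not> a))"
  by (erule Dop_supp) (auto simp: hpar_def)

lemma Low_graded_part_hpar: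
  assumes "f \<in> Low n p r"
  shows "graded_part (hpar n) q f \<in> Low n p r"
proof -
  have f: "f \<in> SE n" "Dop n False f = 0" "Dop n True f = 0" "Fop n True f = 0"
    and deg: "\<And>s. f s \<noteq> 0 \<Longrightarrow> bdeg n False s = p \<and> bdeg n True s = r"
    using assms unfolding Low_def by blast+
  have D: "Dop n a (graded_part (hpar n) q f) = 0" if "Dop n a f = 0" for a
    by (rule graded_part_kernel[OF lin_Dop, where \<phi> = "\<lambda>x. x \<noteq> (\<not> a)" and \<gamma>' = "hpar n"]) (use Dop_hpar_shift that in auto)
  have F: "Fop n True (graded_part (hpar n) q f) = 0"
    by (rule graded_part_kernel[OF lin_Fop, where \<phi> = "\<lambda>x. x \<noteq> True" and \<gamma>' = "hpar n"]) (use Fop_hpar_shift f(4) in auto)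
  have "f s \<noteq> 0" if "graded_part (hpar n) q f s \<noteq> 0" for s using that by (simp add: graded_part_def split: if_splits)
  then have "bdeg n False s = p \<and> bdeg n True s = r" if "graded_part (hpar n) q f s \<noteq> 0" for s using that deg by blast
  then show ?thesis unfolding Low_def using SE_graded_part[OF f(1)] D[OF f(2)] D[OF f(3)] F by simp
qed

lemma Low_eps: "f \<in> Low n p r \<Longrightarrow> eps n f \<in> Low n p r"
  unfolding graded_part_hpar(2) by (intro fs.subspace_diff subspace_Low Low_graded_part_hpar)

lemma hpar_SE:
  assumes "f \<in> SE n" "f (m, A) \<noteq> 0"
  shows "hpar n (m, A) = odd (card A)"
proof -
  have A: "A \<subseteq> idx n" using assms by (auto simp: SE_def idx_def)
  have "(\<Sum>i\<in>idx n. of_bool (i \<in> A) :: nat) = (\<Sum>i\<in>A. 1)"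
    by (rule sum.mono_neutral_cong_right) (use A in auto)
  then show ?thesis by (simp add: hpar_def hdeg_def)
qed

lemma SE_part_iff: "f \<in> SE_part n q \<longleftrightarrow> f \<in> SE n \<and> (\<forall>s. f s \<noteq> 0 \<longrightarrow> hpar n s = q)"
proof
  assume f: "f \<in> SE_part n q"
  then have "hpar n s = q" if "f s \<noteq> 0" for s
    using hpar_SE[of f n "fst s" "snd s"] that f by (cases s) (simp add: SE_part_def)
  then show "f \<in> SE n \<and> (\<forall>s. f s \<noteq> 0 \<longrightarrow> hpar n s = q)" using f by (simp add: SE_part_def)
next
  assume f: "f \<in> SE n \<and> (\<forall>s. f s \<noteq> 0 \<longrightarrow> hpar n s = q)"
  then have "odd (card A) = q" if "f (m, A) \<noteq> 0" for m A
    using hpar_SE[of f n m A] that by blast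
  then show "f \<in> SE_part n q" using f by (simp add: SE_part_def)
qed

lemma subspace_SE_part: "fs.subspace (SE_part n q)"
proof -
  have "SE_part n q = SE n \<inter> {f. \<forall>s. f s \<noteq> 0 \<longrightarrow> hpar n s = q}" unfolding SE_part_iff[abs_def] by (auto simp: SE_part_iff)
  then show ?thesis using fs.subspace_inter[OF subspace_SE subspace_supported] by simp
qed

lemma eps_SE_part: "f \<in> SE_part n q \<Longrightarrow> eps n f = koszul True q \<odot> f"
  by (rule ext) (auto simp: eps_def fscale_def koszul_def SE_part_iff simp del: split_paired_All)

subsection \<open>The action of spo(2n|1)\<close>

text \<open>Nonzero entries of \<open>X\<close> and \<open>Y\<close> belong to matrix units of
  parity \<open>p\<close> and \<open>q\<close>, so the relations \<open>glE_glE\<close> all carry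
  the same sign and can be summed with the entries as weights.\<close>

lemma spo_act_supercomm:
  assumes X: "homogeneous (spo_par n) p X" and Y: "homogeneous (spo_par n) q Y"
  shows "spo_act n (supercomm (2*n+1) p q X Y) f
    = spo_act n X (spo_act n Y f) - koszul p q \<odot> spo_act n Y (spo_act n X f)"
proof -
  let ?I = "idx n"
  let ?K = "koszul p q"
  have prod: "spo_act n A (spo_act n B f) = (\<Sum>i\<in>?I. \<Sum>j\<in>?I. \<Sum>k\<in>?I. \<Sum>l\<in>?I. (A (i, j) * B (k, l)) \<odot> glE n i j (glE n k l f))" for A B
    unfolding spo_act_glE[of n A] spo_act_glE[of n B] by (simp add: glE_lins fs.scale_sum_right)
  have mul: "spo_act n (mat_mul (2*n+1) A B) f = (\<Sum>i\<in>?I. \<Sum>j\<in>?I. \<Sum>k\<in>?I. \<Sum>l\<in>?I. if j = k then (A (i, j) * B (k, l)) \<odot> glE n i l f else 0)" for A B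
  proof -
    have "spo_act n (mat_mul (2*n+1) A B) f = (\<Sum>i\<in>?I. \<Sum>l\<in>?I. \<Sum>j\<in>?I. (A (i, j) * B (j, l)) \<odot> glE n i l f)"
      unfolding spo_act_glE mat_mul_def by (simp add: idx_def[symmetric] fs.scale_sum_left del: One_nat_def)
    also have "\<dots> = (\<Sum>i\<in>?I. \<Sum>j\<in>?I. \<Sum>l\<in>?I. (A (i, j) * B (j, l)) \<odot> glE n i l f)"
      by (intro sum.cong refl sum.swap)
    also have "\<dots> = (\<Sum>i\<in>?I. \<Sum>j\<in>?I. \<Sum>k\<in>?I. if j = k then \<Sum>l\<in>?I. (A (i, j) * B (k, l)) \<odot> glE n i l f else 0)"
      by (rule sum.cong[OF refl], rule sum.cong[OF refl]) simp
    also have "\<dots> = (\<Sum>i\<in>?I. \<Sum>j\<in>?I. \<Sum>k\<in>?I. \<Sum>l\<in>?I. if j = k then (A (i, j) * B (k, l)) \<odot> glE n i l f else 0)"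
      by (intro sum.cong refl) simp
    finally show ?thesis .
  qed
  have swap: "(\<Sum>i\<in>?I. \<Sum>j\<in>?I. \<Sum>k\<in>?I. \<Sum>l\<in>?I. G k l i j) = (\<Sum>i\<in>?I. \<Sum>j\<in>?I. \<Sum>k\<in>?I. \<Sum>l\<in>?I. G i j k l)"
    for G :: "nat \<Rightarrow> nat \<Rightarrow> nat \<Rightarrow> nat \<Rightarrow> spoly"
  proof -
    have pair: "(\<Sum>i\<in>?I. \<Sum>j\<in>?I. F i j) = (\<Sum>x\<in>?I\<times>?I. F (fst x) (snd x))" for F :: "nat \<Rightarrow> nat \<Rightarrow> spoly"
      by (simp add: sum.cartesian_product split_def)
    show ?thesis unfolding pair by (rule sum.swap)
  qed
  have "(X (i, j) * Y (k, l)) \<odot> glE n i j (glE n k l f)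
     = (if j = k then (X (i, j) * Y (k, l)) \<odot> glE n i l f else 0)
      + ?K \<odot> ((Y (k, l) * X (i, j)) \<odot> glE n k l (glE n i j f)
         - (if l = i then (Y (k, l) * X (i, j)) \<odot> glE n k j f else 0))"
    if "i \<in> ?I" "j \<in> ?I" "k \<in> ?I" "l \<in> ?I" for i j k l
  proof (cases "X (i, j) = 0 \<or> Y (k, l) = 0")
    case True
    then show ?thesis by auto
  next
    case False
    then have "(spo_par n i \<noteq> spo_par n j) = p" "(spo_par n k \<noteq> spo_par n l) = q"
      using X Y unfolding homogeneous_def by blast+
    then have "glE n i j (glE n k l f) = (if j = k then glE n i l f else 0) + ?K \<odot> (glE n k l (glE n i j f) - (if i = l then glE n k j f else 0))"
      using glE_glE[OF that, of f] by (simp only:)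
    then show ?thesis by (simp add: fscale_simps mult_ac)
  qed
  then have "spo_act n X (spo_act n Y f) = (\<Sum>i\<in>?I. \<Sum>j\<in>?I. \<Sum>k\<in>?I. \<Sum>l\<in>?I.
     (if j = k then (X (i, j) * Y (k, l)) \<odot> glE n i l f else 0)
      + ?K \<odot> ((Y (k, l) * X (i, j)) \<odot> glE n k l (glE n i j f)
         - (if l = i then (Y (k, l) * X (i, j)) \<odot> glE n k j f else 0)))"
    unfolding prod by (intro sum.cong refl) blast
  also have "\<dots> = spo_act n (mat_mul (2*n+1) X Y) f + ?K \<odot> (spo_act n Y (spo_act n X f) - spo_act n (mat_mul (2*n+1) Y X) f)"
    unfolding mul prod sum.distrib sum_subtractf fs.scale_sum_right[symmetric]
    unfolding swap[of "\<lambda>k l i j. (Y (k, l) * X (i, j)) \<odot> glE n k l (glE n i j f)"]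
      swap[of "\<lambda>k l i j. if l = i then (Y (k, l) * X (i, j)) \<odot> glE n k j f else 0"] ..
  finally show ?thesis
    by (simp add: supercomm_def spo_act_mat_linear fscale_simps)
qed

lemma spo_act_spoX_spo:
  assumes "X \<in> spo n"
  shows "spo_act n X f = (1/2) \<odot> (\<Sum>k\<in>idx n. \<Sum>l\<in>idx n. X (k, l) \<odot> spoX n k l f)"
proof -
  have "X \<in> fs.span (\<Union>p. spo_part n p)" using assms by (simp add: spo_def)
  then show ?thesis
  proof (induction rule: fs.span_induct)
    case base
    define R where "R X = (1/2) \<odot> (\<Sum>k\<in>idx n. \<Sum>l\<in>idx n. X (k, l) \<odot> spoX n k l f)" for X :: cmat
    have "R (X + Y) = R X + R Y" for X Y
      by (simp add: R_def fs.scale_left_distrib sum.distrib fs.scale_right_distrib)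
    moreover have "R (c \<odot> X) = c \<odot> R X" for c X
      by (simp add: R_def fs.scale_sum_right fscale_def[of c X])
    moreover have "spo_act n 0 f = R 0" by (simp add: R_def spo_act_def)
    ultimately show ?case
      unfolding R_def[symmetric] by (simp add: fs.subspace_def spo_act_mat_linear)
  next
    case (step X)
    then show ?case using spo_act_spoX by blast
  qed
qed

definition Lmod :: "nat \<Rightarrow> nat \<Rightarrow> nat \<Rightarrow> smono smodule"
  where "Lmod n p r = \<lparr>part = (\<lambda>q. Low n p r \<inter> SE_part n q), act = spo_act n\<rparr>"

lemma scarrier_Lmod: "scarrier (Lmod n p r) = Low n p r"
proof -
  have "f \<in> scarrier (Lmod n p r)" if f: "f \<in> Low n p r" for f
  proof -
    have "graded_part (hpar n) q f \<in> SE_part n q" for q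
      using f SE_graded_part[of f n "hpar n" q] by (auto simp: SE_part_iff Low_def graded_part_def split: if_splits)
    then have "graded_part (hpar n) q f \<in> part (Lmod n p r) q" for q
      using Low_graded_part_hpar[OF f] by (simp add: Lmod_def)
    moreover have "f = graded_part (hpar n) False f + graded_part (hpar n) True f"
      using graded_part_hpar(1)[of n f] by (simp add: add.commute)
    ultimately show ?thesis unfolding scarrier_def by blast
  qed
  moreover have "f \<in> Low n p r" if "f \<in> scarrier (Lmod n p r)" for f
    using that fs.subspace_add[OF subspace_Low] by (auto simp: scarrier_def Lmod_def)
  ultimately show ?thesis by blast
qed

lemma spo_act_parity:
  assumes f: "f \<in> SE_part n q" and X: "homogeneous (spo_par n) p X"
  shows "spo_act n X f \<in> SE_part n (p \<noteq> q)"
proof -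
  have "X (i, j) \<odot> glE n i j f \<in> SE_part n (p \<noteq> q)" if ij: "i \<in> idx n" "j \<in> idx n" for i j
  proof (cases "X (i, j) = 0")
    case True
    then show ?thesis using fs.subspace_0[OF subspace_SE_part] by simp
  next
    case False
    then have p: "(spo_par n i \<noteq> spo_par n j) = p" using X unfolding homogeneous_def by blast
    have "hpar n s = (p \<noteq> q)" if "glE n i j f s \<noteq> 0" for s
      using that ij by (rule glE_supp) (use f p in \<open>auto simp: SE_part_iff hpar_def\<close>)
    then have "glE n i j f \<in> SE_part n (p \<noteq> q)"
      using SE_glE[of f n i j] f ij unfolding SE_part_iff by blast
    then show ?thesis by (rule fs.subspace_scale[OF subspace_SE_part])
  qed
  then show ?thesis unfolding spo_act_glE by (intro fs.subspace_sum subspace_SE_part)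
qed

lemma Lmod_smodule: "is_smodule (spo n) (spo_par n) (2*n+1) (Lmod n p r)"
proof -
  have "f = 0" if "f \<in> SE_part n False" "f \<in> SE_part n True" for f
  proof (rule ccontr)
    assume "f \<noteq> 0"
    then obtain s where "f s \<noteq> 0" by (metis ext zero_fun_apply)
    then show False using that unfolding SE_part_iff by blast
  qed
  then have "part (Lmod n p r) False \<inter> part (Lmod n p r) True = {0}"
    using fs.subspace_0[OF subspace_Low] fs.subspace_0[OF subspace_SE_part] by (auto simp: Lmod_def)
  moreover have "fs.subspace (part (Lmod n p r) q)" for q
    using fs.subspace_inter[OF subspace_Low subspace_SE_part] by (simp add: Lmod_def)
  moreover have "linear_on (scarrier (Lmod n p r)) (act (Lmod n p r) X)" for X
    using lin_rules(1,2)[OF lin_spo_act] by (simp add: Lmod_def linear_on_def)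
  moreover have "linear_on (spo n) (\<lambda>X. act (Lmod n p r) X v)" for v
    by (simp add: Lmod_def linear_on_def spo_act_mat_linear)
  ultimately show ?thesis
    unfolding is_smodule_def
    using spo_stable_spo_act[OF spo_stable_Low] spo_act_parity spo_act_supercomm by (simp add: Lmod_def)
qed

lemma Lmod_irreducible:
  assumes n: "n \<ge> 1" and a: "admissible n p r"
  shows "is_irreducible (spo n) (spo_par n) (2*n+1) (Lmod n p r)"
  unfolding is_irreducible_def
proof (intro conjI allI impI Lmod_smodule)
  show "scarrier (Lmod n p r) \<noteq> {0}" using Low_admissible[OF n a] by (simp add: scarrier_Lmod)
  fix U assume U: "is_subsmodule (spo n) (Lmod n p r) U"
  then have sub: "fs.subspace U" and decomp: "U = {u + v | u v. u \<in> U \<inter> part (Lmod n p r) False \<and> v \<in> U \<inter> part (Lmod n p r) True}"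
    and stable: "\<And>X u. X \<in> spo n \<Longrightarrow> u \<in> U \<Longrightarrow> spo_act n X u \<in> U"
    by (simp_all add: is_subsmodule_def Lmod_def)
  have "U \<subseteq> scarrier (Lmod n p r)"
  proof
    fix u assume "u \<in> U"
    then show "u \<in> scarrier (Lmod n p r)" by (subst (asm) decomp) (auto simp: scarrier_def)
  qed
  then have "U \<subseteq> Low n p r" by (simp add: scarrier_Lmod)
  moreover have "spo_stable n U"
    unfolding spo_stable_def
  proof (intro conjI ballI sub)
    fix k l f assume kl: "k \<in> idx n" "l \<in> idx n" and f: "f \<in> U"
    then have "spog n k l \<in> spo n" using spog_spo_part spo_part_subset_spo by blast
    then show "spoX n k l f \<in> U" using stable[OF _ f] spo_act_spog[OF kl] by metis
  qed
  ultimately show "U = {0} \<or> U = scarrier (Lmod n p r)"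
    using Low_irreducible[OF n] by (auto simp: scarrier_Lmod)
qed

text \<open>For even elements the height order follows from upper triangularity. The odd index, last
  in the matrix, has height zero, so that \<open>E_(k,2n+1)\<close> and
  \<open>E_(2n+1,2n+1-k)\<close> do not lower the height either.\<close>

lemma spo_borel_height:
  assumes "X \<in> spo_borel n"
  shows "X \<in> spo n" and "k \<in> idx n \<Longrightarrow> l \<in> idx n \<Longrightarrow> X (k, l) \<noteq> 0 \<Longrightarrow> height n l \<le> height n k"
proof -
  let ?P = "\<lambda>X. X \<in> spo n \<and> (\<forall>k\<in>idx n. \<forall>l\<in>idx n. X (k, l) \<noteq> 0 \<longrightarrow> height n l \<le> height n k)"
  have "fs.subspace {X. ?P X}"
  proof -
    have "{X. ?P X} = spo n \<inter> {X. \<forall>s. X s \<noteq> 0 \<longrightarrow> (fst s \<in> idx n \<longrightarrow> snd s \<in> idx n \<longrightarrow> height n (snd s) \<le> height n (fst s))}"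
      by auto
    then show ?thesis unfolding spo_def by (simp only:) (intro fs.subspace_inter fs.subspace_span subspace_supported)
  qed
  moreover have "?P X" if "X \<in> spo_part n False" "\<forall>i j. X (i, j) \<noteq> 0 \<longrightarrow> i \<le> j" for X
  proof (intro conjI ballI impI)
    show "X \<in> spo n" using that spo_part_subset_spo by blast
    fix k l assume kl: "k \<in> idx n" "l \<in> idx n" "X (k, l) \<noteq> 0"
    then have "spo_par n k = spo_par n l" using that(1) by (auto simp: spo_part_def homogeneous_def)
    then show "height n l \<le> height n k" using kl that(2) by (fastforce simp: height_def spo_par_def idx_def)
  qed
  moreover have "?P (mat_unit k (2*n+1) + mat_unit (2*n+1) (2*n+1-k))" if k: "k \<in> {1..n}" for k
  proof (intro conjI ballI impI)
    have "dsign n k (2*n+1) = -1"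
      using k by (auto simp: dsign_def koszul_def spo_par_def bsign_def dual_def)
    then have "mat_unit k (2*n+1) + mat_unit (2*n+1) (2*n+1-k) = spog n k (2*n+1)"
      unfolding spog_def bsign_psign_simps(9) bsign_psign_simps(7)[OF k] by (simp add: fs.scale_minus_left)
    moreover have "spog n k (2*n+1) \<in> spo n"
      using spog_spo_part[of k n "2*n+1"] spo_part_subset_spo k by (force simp: idx_def)
    ultimately show "mat_unit k (2*n+1) + mat_unit (2*n+1) (2*n+1-k) \<in> spo n" by simp
    fix i j assume "(mat_unit k (2*n+1) + mat_unit (2*n+1) (2*n+1-k)) (i, j) \<noteq> 0"
    then have "i = k \<and> j = 2*n+1 \<or> i = 2*n+1 \<and> j = 2*n+1-k" by (auto simp: mat_unit_def split: if_splits)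
    then show "height n j \<le> height n i" using k by (auto simp: height_def)
  qed
  ultimately have "fs.span ({X \<in> spo_part n False. \<forall>i j. X (i, j) \<noteq> 0 \<longrightarrow> i \<le> j} \<union>
     {mat_unit k (2*n+1) + mat_unit (2*n+1) (2*n+1-k) | k. k \<in> {1..n}}) \<subseteq> {X. ?P X}"
    by (intro fs.span_minimal) blast+
  then have "?P X" using assms unfolding spo_borel_def by blast
  then show "X \<in> spo n" and "k \<in> idx n \<Longrightarrow> l \<in> idx n \<Longrightarrow> X (k, l) \<noteq> 0 \<Longrightarrow> height n l \<le> height n k"
    by blast+
qed

text \<open>The component of parity opposite to that of \<open>topmono n p r\<close> also lies in
  \<open>Low\<close> and has no coefficient of degree at most 1 in the last even variable, so it
  vanishes by \<open>D22_determined\<close>.\<close>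

lemma topvec_homogeneous:
  assumes "topvec n p r f"
  shows "\<exists>q. f \<in> SE_part n q"
proof -
  define q where "q = hpar n (topmono n p r)"
  have f: "f \<in> Low n p r" using assms by (simp add: topvec_def)
  define g where "g = f - graded_part (hpar n) q f"
  have "g \<in> Low n p r" unfolding g_def by (intro fs.subspace_diff subspace_Low f Low_graded_part_hpar)
  then have D: "Dop n True g = 0" by (simp add: Low_def)
  have "g = 0"
  proof (rule D22_determined[OF D])
    fix s :: smono assume s: "fst s (2*n+1) \<le> 1"
    show "g s = 0"
    proof (cases "s = topmono n p r")
      case False
      then have "f s = 0" using assms s unfolding topvec_def by blast
      then show ?thesis by (simp add: g_def graded_part_def)
    qed (simp add: g_def graded_part_def q_def)
  qed
  then have "f = graded_part (hpar n) q f" by (simp add: g_def)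
  then have "hpar n s = q" if "f s \<noteq> 0" for s using that by (metis graded_part_def)
  then have "f \<in> SE_part n q" using f unfolding SE_part_iff Low_def by blast
  then show ?thesis ..
qed

lemma Lmod_is_V_spo:
  assumes n: "n \<ge> 1" and a: "admissible n p r" and w: "length w = n"
    "\<And>i. i \<in> {1..n} \<Longrightarrow> w ! (i - 1) = (if i = 1 then of_nat p else 0) + of_bool (i \<le> rbar n r)"
  shows "is_V_spo n w (Lmod n p r)"
proof -
  have "\<not> Low n p r \<subseteq> {0}" using Low_admissible[OF n a] fs.subspace_0[OF subspace_Low] by blast
  then obtain f \<mu> where f: "f \<in> Low n p r" "f \<notin> {0}" "wvec n \<mu> f" "topvec n p r f"
    and \<mu>: "\<And>i. i \<in> {1..n} \<Longrightarrow> \<mu> i = (if i = 1 then int p else 0) + of_bool (i \<le> rbar n r)"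
    and raise: "\<And>k l. k \<in> idx n \<Longrightarrow> l \<in> idx n \<Longrightarrow> height n k > height n l \<Longrightarrow> spoX n k l f \<in> {0}"
    using exists_topvec[OF n spo_stable_zero spo_stable_Low order_refl] by metis
  have cartan: "spo_act n (spo_cartan n i) f = (w ! (i - 1)) \<odot> f" if i: "i \<in> {1..n}" for i
  proof -
    have ii: "i \<in> idx n" "2*n+1-i \<in> idx n" using i by (auto simp: idx_def)
    have "spo_act n (spo_cartan n i) f = spoX n i i f"
      unfolding spo_cartan_def spo_act_mat_linear spo_act_unit[OF ii(1) ii(1)] spo_act_unit[OF ii(2) ii(2)]
      unfolding spoX_def bsign_psign_simps(7)[OF i] by (simp add: dsign_def koszul_def)
    also have "\<dots> = of_int (\<mu> i) \<odot> f" by (rule wvec_spoX_diag[OF f(3) ii(1)])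
    also have "(of_int (\<mu> i) :: complex) = w ! (i - 1)" using \<mu>[OF i] w(2)[OF i] by simp
    finally show ?thesis .
  qed
  have nil: "spo_act n X f = 0" if X: "X \<in> spo_nilrad n" for X
  proof -
    have X': "X \<in> spo_borel n" "\<And>i. X (i, i) = 0" using X by (simp_all add: spo_nilrad_def)
    \<comment> \<open>The diagonal vanishes on the nilradical and \<open>height\<close> is
      injective, so the weak inequality for nonzero entries of a Borel element becomes
      strict.\<close>
    have term0: "X (k, l) \<odot> spoX n k l f = 0" if kl: "k \<in> idx n" "l \<in> idx n" for k l
    proof (cases "X (k, l) = 0")
      case False
      then have "height n l \<le> height n k" "k \<noteq> l" using spo_borel_height(2)[OF X'(1) kl] X'(2) by auto
      then have "height n k > height n l" using height_inj[OF kl] by force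
      then show ?thesis using raise[OF kl] by simp
    qed simp
    have "(\<Sum>k\<in>idx n. \<Sum>l\<in>idx n. X (k, l) \<odot> spoX n k l f) = 0"
      by (intro sum.neutral ballI) (rule term0)
    then show ?thesis unfolding spo_act_spoX_spo[OF spo_borel_height(1)[OF X'(1)]] by simp
  qed
  obtain q where "f \<in> SE_part n q" using topvec_homogeneous[OF f(4)] by blast
  then have "f \<in> part (Lmod n p r) False \<union> part (Lmod n p r) True"
    using f(1) by (cases q) (simp_all add: Lmod_def)
  then have "spo_hw_vector n w (Lmod n p r) f"
    using f(2) w(1) cartan nil by (simp add: spo_hw_vector_def Lmod_def)
  then show ?thesis using Lmod_irreducible[OF n a] by (auto simp: is_V_spo_def)
qed

subsection \<open>Irreducible gl(1|1)-modules\<close>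

declare split_paired_All [simp del] split_paired_Ex [simp del]

text \<open>Two arbitrary distinct labels in the type \<open>smono\<close> for the basis of a
  gl(1|1)-module; they are not meant as monomials of S(E).\<close>

definition lo :: smono where "lo = (\<lambda>_. 0, {})"
definition hi :: smono where "hi = (\<lambda>_. 0, {0})"

lemma lo_hi [simp]: "lo \<noteq> hi" "hi \<noteq> lo"
  by (auto simp: lo_def hi_def)

definition delta :: "smono \<Rightarrow> spoly"
  where "delta a = (\<lambda>s. if s = a then 1 else 0)"

text \<open>
  The vectors at \<open>lo\<close> and \<open>hi\<close> have weights \<open>(a, b)\<close> and \<open>(a + 1, b - 1)\<close>. In the atypical case
  \<open>a + b = 0\<close> the module is one-dimensional and \<open>hi\<close> is absent.
\<close>

definition Mmod :: "complex \<Rightarrow> complex \<Rightarrow> smono smodule"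
  where "Mmod a b = \<lparr>
    part = (\<lambda>q. {v. \<forall>s. v s \<noteq> 0 \<longrightarrow> (if q then s = hi \<and> a + b \<noteq> 0 else s = lo)}),
    act = (\<lambda>Y v s. if s = lo then (Y (1, 1) * a + Y (2, 2) * b) * v lo + (a + b) * Y (2, 1) * v hi
      else if s = hi \<and> a + b \<noteq> 0 then (Y (1, 1) * (a + 1) + Y (2, 2) * (b - 1)) * v hi + Y (1, 2) * v lo
      else 0)\<rparr>"

lemma scarrier_Mmod:
  "scarrier (Mmod a b) = {v. \<forall>s. v s \<noteq> 0 \<longrightarrow> s = lo \<or> s = hi \<and> a + b \<noteq> 0}"
proof (intro equalityI subsetI)
  fix v assume "v \<in> scarrier (Mmod a b)"
  then obtain u w where v: "v = u + w" "u \<in> part (Mmod a b) False" "w \<in> part (Mmod a b) True"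
    unfolding scarrier_def by blast
  have "s = lo \<or> s = hi \<and> a + b \<noteq> 0" if "v s \<noteq> 0" for s
  proof -
    have "u s \<noteq> 0 \<or> w s \<noteq> 0" using that v(1) by auto
    then show ?thesis using v(2,3) unfolding Mmod_def by auto
  qed
  then show "v \<in> {v. \<forall>s. v s \<noteq> 0 \<longrightarrow> s = lo \<or> s = hi \<and> a + b \<noteq> 0}" by blast
next
  fix v :: spoly assume v: "v \<in> {v. \<forall>s. v s \<noteq> 0 \<longrightarrow> s = lo \<or> s = hi \<and> a + b \<noteq> 0}"
  define u w where "u = v lo \<odot> delta lo" and "w = v hi \<odot> delta hi"
  have "v = u + w"
  proof
    fix s
    show "v s = (u + w) s"
    proof (cases "s = lo \<or> s = hi")
      case True
      then show ?thesis by (auto simp: u_def w_def fscale_def delta_def)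
    next
      case False
      then have "v s = 0" using v by blast
      then show ?thesis using False by (simp add: u_def w_def fscale_def delta_def)
    qed
  qed
  moreover have "u \<in> part (Mmod a b) False" by (simp add: u_def Mmod_def fscale_def delta_def)
  moreover have "w \<in> part (Mmod a b) True"
  proof -
    have "a + b \<noteq> 0" if "v hi \<noteq> 0" using v that lo_hi by blast
    then show ?thesis by (auto simp: w_def Mmod_def fscale_def delta_def)
  qed
  ultimately show "v \<in> scarrier (Mmod a b)" unfolding scarrier_def by blast
qed

lemma sum_two: "(\<Sum>j=1..2::nat. h j) = h 1 + h 2"
  by (simp add: numeral_2_eq_2 One_nat_def)

lemma Mmod_smodule: "is_smodule (gl 2) gl11_par 2 (Mmod a b)"
  unfolding is_smodule_def
proof (intro conjI allI ballI impI)
  show "fs.subspace (part (Mmod a b) q)" for q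
    unfolding Mmod_def by (simp add: subspace_supported del: split_paired_All)
  show "part (Mmod a b) False \<inter> part (Mmod a b) True = {0}"
  proof (intro equalityI subsetI)
    fix v assume "v \<in> part (Mmod a b) False \<inter> part (Mmod a b) True"
    then have v: "s = lo \<and> s = hi" if "v s \<noteq> 0" for s using that unfolding Mmod_def by auto
    have "v s = 0" for s using v[of s] lo_hi by metis
    then show "v \<in> {0}" by (auto simp: fun_eq_iff)
  qed (simp add: Mmod_def)
  show "linear_on (scarrier (Mmod a b)) (act (Mmod a b) X)" for X
    by (auto simp: linear_on_def Mmod_def fun_eq_iff fscale_def algebra_simps)
  show "linear_on (gl 2) (\<lambda>X. act (Mmod a b) X v)" for v
    by (auto simp: linear_on_def Mmod_def fun_eq_iff fscale_def algebra_simps)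
next
  fix p q X v assume X: "homogeneous gl11_par p X" and v: "v \<in> part (Mmod a b) q"
  have v0: "v lo = 0" if q using v that unfolding Mmod_def using lo_hi by auto
  have v1: "v hi = 0" if "\<not> q" using v that unfolding Mmod_def using lo_hi by auto
  have X0: "X (1, 2) = 0" "X (2, 1) = 0" if "\<not> p"
    using X that unfolding homogeneous_def gl11_par_def by force+
  have X1: "X (1, 1) = 0" "X (2, 2) = 0" if p
    using X that unfolding homogeneous_def by force+
  show "act (Mmod a b) X v \<in> part (Mmod a b) (p \<noteq> q)"
    using v0 v1 X0 X1 by (cases p; cases q) (auto simp: Mmod_def)
next
  fix p q X Y v assume X: "homogeneous gl11_par p X" and Y: "homogeneous gl11_par q Y"
    and v: "v \<in> scarrier (Mmod a b)"
  \<comment> \<open>Eliminating \<open>b\<close> in favour of \<open>D\<close> leaves polynomial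
    identities in which the atypical case is \<open>D = 0\<close>; there \<open>v hi = 0\<close>
    holds in the carrier.\<close>
  define D where "D = a + b"
  have v1: "v hi = 0" if "D = 0"
    using v that unfolding scarrier_Mmod D_def using lo_hi by blast
  have X0: "X (1, 2) = 0" "X (2, 1) = 0" if "\<not> p"
    using X that unfolding homogeneous_def gl11_par_def by force+
  have X1: "X (1, 1) = 0" "X (2, 2) = 0" if p
    using X that unfolding homogeneous_def by force+
  have Y0: "Y (1, 2) = 0" "Y (2, 1) = 0" if "\<not> q"
    using Y that unfolding homogeneous_def gl11_par_def by force+
  have Y1: "Y (1, 1) = 0" "Y (2, 2) = 0" if q
    using Y that unfolding homogeneous_def by force+
  show "act (Mmod a b) (supercomm 2 p q X Y) v =
    act (Mmod a b) X (act (Mmod a b) Y v) - koszul p q \<odot> act (Mmod a b) Y (act (Mmod a b) X v)"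
  proof
    fix s
    have lo: "act (Mmod a b) Z u lo = (Z (1, 1) * a + Z (2, 2) * (D - a)) * u lo + D * Z (2, 1) * u hi" for Z u
      by (simp add: Mmod_def D_def)
    have hi: "act (Mmod a b) Z u hi = (if D = 0 then 0 else (Z (1, 1) * (a + 1) + Z (2, 2) * (D - a - 1)) * u hi + Z (1, 2) * u lo)" for Z u
      by (simp add: Mmod_def D_def)
    have oth: "act (Mmod a b) Z u s = 0" if "s \<noteq> lo" "s \<noteq> hi" for Z u
      using that by (simp add: Mmod_def)
    have S: "supercomm 2 p' q' X Y (i, j) = X (i, 1) * Y (1, j) + X (i, 2) * Y (2, j)
       - koszul p' q' * (Y (i, 1) * X (1, j) + Y (i, 2) * X (2, j))" for p' q' i j
      by (simp add: supercomm_def mat_mul_def fscale_def sum_two del: One_nat_def)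
    consider "s = lo" | "s = hi" | "s \<noteq> lo" "s \<noteq> hi" by blast
    then show "act (Mmod a b) (supercomm 2 p q X Y) v s =
      (act (Mmod a b) X (act (Mmod a b) Y v) - koszul p q \<odot> act (Mmod a b) Y (act (Mmod a b) X v)) s"
    proof cases
      case 1
      then show ?thesis using X0 X1 Y0 Y1 v1
        by (cases p; cases q; cases "D = 0") (simp_all add: fscale_def lo hi S koszul_def algebra_simps)
    next
      case 2
      then show ?thesis using X0 X1 Y0 Y1
        by (cases p; cases q; cases "D = 0") (simp_all add: fscale_def lo hi S koszul_def algebra_simps)
    next
      case 3
      then show ?thesis by (simp add: fscale_def oth)
    qed
  qed
qed

lemma mat_unit_gl: "i \<in> {1..N} \<Longrightarrow> j \<in> {1..N} \<Longrightarrow> mat_unit i j \<in> gl N"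
  by (auto simp: gl_def mat_unit_def split: if_splits)

text \<open>\<open>E_12\<close> takes \<open>lo\<close> to \<open>hi\<close> and \<open>E_21\<close>
  takes \<open>hi\<close> to \<open>a + b\<close> times \<open>lo\<close>, so in the typical case
  each of the two vectors generates the whole module.\<close>

lemma Mmod_irreducible: "is_irreducible (gl 2) gl11_par 2 (Mmod a b)"
  unfolding is_irreducible_def
proof (intro conjI allI impI Mmod_smodule)
  have "delta lo \<in> scarrier (Mmod a b)" "delta lo \<noteq> 0"
    by (auto simp: scarrier_Mmod delta_def fun_eq_iff)
  then show "scarrier (Mmod a b) \<noteq> {0}" by blast
  fix U assume U: "is_subsmodule (gl 2) (Mmod a b) U"
  then have sub: "fs.subspace U" and decomp: "U = {u + v | u v. u \<in> U \<inter> part (Mmod a b) False \<and> v \<in> U \<inter> part (Mmod a b) True}"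
    and stable: "\<And>X u. X \<in> gl 2 \<Longrightarrow> u \<in> U \<Longrightarrow> act (Mmod a b) X u \<in> U"
    by (simp_all add: is_subsmodule_def)
  have even: "v = v lo \<odot> delta lo" if "v \<in> part (Mmod a b) False" for v
    using that by (auto simp: Mmod_def delta_def fscale_def fun_eq_iff simp del: split_paired_All)
  have odd: "v = v hi \<odot> delta hi" if "v \<in> part (Mmod a b) True" for v
    using that by (auto simp: Mmod_def delta_def fscale_def fun_eq_iff simp del: split_paired_All)
  have odd': "a + b \<noteq> 0" if "v \<in> part (Mmod a b) True" "v \<noteq> 0" for v
  proof -
    obtain s where "v s \<noteq> 0" using \<open>v \<noteq> 0\<close> by (metis ext zero_fun_apply)
    then show ?thesis using that(1) unfolding Mmod_def by auto
  qed
  have scale: "x \<in> U" if "c \<odot> x \<in> U" "c \<noteq> 0" for c x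
    using fs.subspace_scale[OF sub that(1), of "1/c"] that(2) by simp
  have up: "delta hi \<in> U" if "delta lo \<in> U" "a + b \<noteq> 0"
  proof -
    have "act (Mmod a b) (mat_unit 1 2) (delta lo) = delta hi"
      using that(2) by (auto simp: Mmod_def mat_unit_def delta_def fun_eq_iff)
    then show ?thesis using stable[OF mat_unit_gl[of 1 2 2] that(1)] by simp
  qed
  have down: "delta lo \<in> U" if "delta hi \<in> U" "a + b \<noteq> 0"
  proof -
    have "act (Mmod a b) (mat_unit 2 1) (delta hi) = (a + b) \<odot> delta lo"
      by (auto simp: Mmod_def mat_unit_def delta_def fun_eq_iff fscale_def)
    then show ?thesis using stable[OF mat_unit_gl[of 2 2 1] that(1)] that(2) scale by simp
  qed
  show "U = {0} \<or> U = scarrier (Mmod a b)"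
  proof (cases "U = {0}")
    case False
    moreover have "0 \<in> U" using sub by (rule fs.subspace_0)
    ultimately obtain x where "x \<in> U" "x \<noteq> 0" by blast
    then obtain u v where uv: "x = u + v" "u \<in> U" "u \<in> part (Mmod a b) False" "v \<in> U" "v \<in> part (Mmod a b) True"
      by (subst (asm) decomp) blast
    have lo: "delta lo \<in> U"
    proof (cases "u = 0")
      case True
      then have "v \<noteq> 0" using uv \<open>x \<noteq> 0\<close> by simp
      then have "v hi \<odot> delta hi \<in> U" "v hi \<noteq> 0" using odd[OF uv(5)] uv(4) by (metis fs.scale_zero_left)+
      then show ?thesis using down scale odd'[OF uv(5) \<open>v \<noteq> 0\<close>] by blast
    next
      case False
      then have "u lo \<odot> delta lo \<in> U" "u lo \<noteq> 0" using even[OF uv(3)] uv(2) by (metis fs.scale_zero_left)+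
      then show ?thesis using scale by blast
    qed
    have "v \<in> U" if "v \<in> part (Mmod a b) False" for v
      using even[OF that] fs.subspace_scale[OF sub lo, of "v lo"] by simp
    moreover have "v \<in> U" if "v \<in> part (Mmod a b) True" for v
    proof (cases "v = 0")
      case True
      then show ?thesis using fs.subspace_0[OF sub] by simp
    next
      case False
      then show ?thesis
        using odd[OF that] fs.subspace_scale[OF sub up[OF lo odd'[OF that False]], of "v hi"] by simp
    qed
    ultimately have "scarrier (Mmod a b) \<subseteq> U"
      unfolding scarrier_def using fs.subspace_add[OF sub] by blast
    moreover have "U \<subseteq> scarrier (Mmod a b)"
      unfolding scarrier_def by (subst decomp) blast
    ultimately show ?thesis by blast
  qed simp
qed

lemma Mmod_is_V_gl11:
  "a + b \<noteq> 0 \<Longrightarrow> is_V_gl11 (a + 1, b - 1) (Mmod a b)"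
  "a + b = 0 \<Longrightarrow> is_V_gl11 (a, b) (Mmod a b)"
proof -
  assume ab: "a + b \<noteq> 0"
  have "gl11_hw_vector (a + 1, b - 1) (Mmod a b) (delta hi)"
    using ab by (auto simp: gl11_hw_vector_def Mmod_def mat_unit_def delta_def fun_eq_iff fscale_def)
  then show "is_V_gl11 (a + 1, b - 1) (Mmod a b)" using Mmod_irreducible by (auto simp: is_V_gl11_def)
next
  assume ab: "a + b = 0"
  have "gl11_hw_vector (a, b) (Mmod a b) (delta lo)"
    using ab by (auto simp: gl11_hw_vector_def Mmod_def mat_unit_def delta_def fun_eq_iff fscale_def)
  then show "is_V_gl11 (a, b) (Mmod a b)" using Mmod_irreducible by (auto simp: is_V_gl11_def)
qed

subsection \<open>The joint submodules\<close>

definition Joint :: "nat \<Rightarrow> nat \<Rightarrow> nat \<Rightarrow> spoly set"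
  where "Joint n p r = {u + Fop n False v | u v. u \<in> Low n p r \<and> v \<in> Low n p r}"

text \<open>
  The vector \<open>u\<close> at \<open>lo\<close> is sent to \<open>u\<close> and the vector \<open>u\<close> at \<open>hi\<close> to \<open>F\<^sub>1\<^sub>2 u\<close>, up to the sign
  \<open>eps\<close> by which the odd operator \<open>F\<^sub>1\<^sub>2\<close> passes \<open>u\<close>.
\<close>

definition \<Phi> :: "nat \<Rightarrow> (smono \<times> smono \<Rightarrow> complex) \<Rightarrow> spoly"
  where "\<Phi> n T = (\<lambda>m. T (m, lo)) + Fop n False (eps n (\<lambda>m. T (m, hi)))"

lemma lin_Phi: "lin (\<Phi> n)"
proof (rule linI)
  fix S T :: "smono \<times> smono \<Rightarrow> complex" and c
  have "(\<lambda>m. (S + T) (m, h)) = (\<lambda>m. S (m, h)) + (\<lambda>m. T (m, h))" "(\<lambda>m. (c \<odot> T) (m, h)) = c \<odot> (\<lambda>m. T (m, h))" for h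
    by (auto simp: fun_eq_iff fscale_def)
  then show "\<Phi> n (S + T) = \<Phi> n S + \<Phi> n T" "\<Phi> n (c \<odot> T) = c \<odot> \<Phi> n T"
    unfolding \<Phi>_def by (simp_all only: lin_rules(1,2)[OF lin_eps] lin_rules(1,2)[OF lin_Fop] fs.scale_right_distrib add_ac)
qed

lemma Phi_ptensor: "\<Phi> n (ptensor u v) = v lo \<odot> u + v hi \<odot> Fop n False (eps n u)"
proof -
  have "(\<lambda>m. ptensor u v (m, h)) = v h \<odot> u" for h by (auto simp: ptensor_def fscale_def)
  then show ?thesis unfolding \<Phi>_def by (simp only: lin_rules(2)[OF lin_eps] lin_rules(2)[OF lin_Fop])
qed

lemma Low_D: 
  assumes "f \<in> Low n p r"
  shows "f \<in> SE n" "Dop n False f = 0" "Dop n True f = 0" "Fop n True f = 0"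
    "\<And>s. f s \<noteq> 0 \<Longrightarrow> bdeg n False s = p" "\<And>s. f s \<noteq> 0 \<Longrightarrow> bdeg n True s = r"
  using assms unfolding Low_def by blast+

lemma sum_glE_bdeg: "(\<And>s. f s \<noteq> 0 \<Longrightarrow> bdeg n False s = p \<and> bdeg n True s = r) \<Longrightarrow>
  (\<Sum>i\<in>idx n. glE n i i f) = of_nat (p + r) \<odot> f"
  unfolding sum_glE_diag degop_def
proof
  fix s
  assume "\<And>s. f s \<noteq> 0 \<Longrightarrow> bdeg n False s = p \<and> bdeg n True s = r"
  then show "((\<Sum>i\<in>idx n. muld (zgen n False i) (zgen n False i) f) + (\<Sum>i\<in>idx n. muld (zgen n True i) (zgen n True i) f)) s
    = (of_nat (p + r) \<odot> f) s"
    by (cases "f s = 0") (simp_all add: degop_apply fscale_def distrib_right)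
qed

lemma F21_F12_Low: "f \<in> Low n p r \<Longrightarrow> Fop n True (Fop n False f) = of_nat (p + r) \<odot> f"
  using Fop_Fop[of n True f] sum_glE_bdeg[of f n p r] Low_D[of f n p r] by (simp add: DF_lins)

lemma F12_Low_zero:
  assumes "f \<in> Low n p 0"
  shows "Fop n False f = 0"
proof (rule ccontr)
  assume "Fop n False f \<noteq> 0"
  then obtain s where "Fop n False f s \<noteq> 0" by (metis ext zero_fun_apply)
  then obtain s' where "f s' \<noteq> 0" "bdeg n True s + 1 = bdeg n True s'"
    by (rule Fop_supp) auto
  then show False using Low_D(6)[OF assms] by simp
qed

lemma F12_bdeg:
  assumes "f \<in> Low n p r" "Fop n False f s \<noteq> 0"
  shows "bdeg n False s = p + 1" "bdeg n True s + 1 = r"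
proof -
  obtain s' where "f s' \<noteq> 0" "bdeg n False s = bdeg n False s' + 1" "bdeg n True s + 1 = bdeg n True s'"
    using assms(2) by (rule Fop_supp) auto
  then show "bdeg n False s = p + 1" "bdeg n True s + 1 = r" using Low_D(5,6)[OF assms(1)] by simp_all
qed

text \<open>The summands have degrees \<open>p\<close> and \<open>p + 1\<close> in the
  \<open>v_1\<close> variables and vanish separately; applying \<open>F21\<close> then recovers
  \<open>p + r\<close> times \<open>v\<close>.\<close>

lemma Low_F12_sum_zero:
  assumes u: "u \<in> Low n p r" and v: "v \<in> Low n p r" and z: "u + Fop n False v = 0"
  shows "u = 0" and "p + r \<noteq> 0 \<Longrightarrow> v = 0"
proof -
  show "u = 0"
  proof (rule ccontr)
    assume "u \<noteq> 0"
    then obtain s where s: "u s \<noteq> 0" by (metis ext zero_fun_apply)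
    have "u s + Fop n False v s = 0" using fun_cong[OF z, of s] by simp
    then have "Fop n False v s \<noteq> 0" using s by auto
    then show False using F12_bdeg[OF v] Low_D(5)[OF u s] by auto
  qed
  then have "Fop n False v = 0" using z by simp
  then have "of_nat (p + r) \<odot> v = 0" using F21_F12_Low[OF v] by (simp add: DF_lins)
  then show "v = 0" if "p + r \<noteq> 0"
    using that unfolding fs.scale_eq_0_iff of_nat_eq_0_iff by blast
qed

text \<open>The second factor has the basis \<open>lo\<close>, \<open>hi\<close>, so a tensor is a
  pair of elements of \<open>Low n p r\<close>; the second one is missing for
  \<open>p + r = 0\<close>, where the gl(1|1)-module is one-dimensional.\<close>

lemma tensor_space_eq:
  assumes D: "a + b = of_nat (p + r)"
  shows "tensor_space (Lmod n p r) (Mmod a b) =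
    {T. (\<forall>m s. s \<noteq> lo \<longrightarrow> s \<noteq> hi \<longrightarrow> T (m, s) = 0) \<and> (\<lambda>m. T (m, lo)) \<in> Low n p r \<and> (\<lambda>m. T (m, hi)) \<in> Low n p r
      \<and> (p + r = 0 \<longrightarrow> (\<lambda>m. T (m, hi)) = 0)}" (is "_ = ?R")
proof
  have sub: "fs.subspace ?R"
    unfolding fs.subspace_def
  proof (intro conjI ballI allI)
    show "0 \<in> ?R" using fs.subspace_0[OF subspace_Low, of n p r] by (simp add: zero_fun_def)
  next
    fix S T assume S: "S \<in> ?R" and T: "T \<in> ?R"
    have e: "(\<lambda>m. (S + T) (m, h)) = (\<lambda>m. S (m, h)) + (\<lambda>m. T (m, h))" for h by auto
    show "S + T \<in> ?R"
      using S T unfolding mem_Collect_eq e by (intro conjI fs.subspace_add[OF subspace_Low]) auto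
  next
    fix c S assume S: "S \<in> ?R"
    have e: "(\<lambda>m. (c \<odot> S) (m, h)) = c \<odot> (\<lambda>m. S (m, h))" for h by (auto simp: fscale_def)
    show "c \<odot> S \<in> ?R"
      using S unfolding mem_Collect_eq e by (intro conjI fs.subspace_scale[OF subspace_Low]) (auto simp: fscale_def)
  qed
  have D0: "a + b = 0 \<longleftrightarrow> p + r = 0" unfolding D of_nat_eq_0_iff ..
  have "ptensor u v \<in> ?R" if u: "u \<in> Low n p r" and v: "v \<in> scarrier (Mmod a b)" for u v
  proof -
    have v0: "v s = 0" if "s \<noteq> lo" "s \<noteq> hi" for s using v that unfolding scarrier_Mmod by blast
    have v1: "v hi = 0" if "p + r = 0" using v that D0 unfolding scarrier_Mmod using lo_hi by blast
    have e: "(\<lambda>m. ptensor u v (m, h)) = v h \<odot> u" for h by (auto simp: ptensor_def fscale_def)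
    show ?thesis
      unfolding mem_Collect_eq e using u v0 v1 by (auto simp: ptensor_def intro: fs.subspace_scale[OF subspace_Low])
  qed
  then show "tensor_space (Lmod n p r) (Mmod a b) \<subseteq> ?R"
    unfolding tensor_space_def scarrier_Lmod by (intro fs.span_minimal sub) blast
  show "?R \<subseteq> tensor_space (Lmod n p r) (Mmod a b)"
  proof
    fix T assume T: "T \<in> ?R"
    define u v where "u = (\<lambda>m. T (m, lo))" and "v = (\<lambda>m. T (m, hi))"
    have T_eq: "T = ptensor u (delta lo) + ptensor v (delta hi)"
    proof
      fix x :: "smono \<times> smono"
      obtain m s where x: "x = (m, s)" by (cases x) auto
      show "T x = (ptensor u (delta lo) + ptensor v (delta hi)) x"
        using T unfolding x by (auto simp: ptensor_def delta_def u_def v_def)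
    qed
    have "delta lo \<in> scarrier (Mmod a b)" by (auto simp: scarrier_Mmod delta_def)
    then have 1: "ptensor u (delta lo) \<in> tensor_space (Lmod n p r) (Mmod a b)"
      unfolding tensor_space_def using T by (intro fs.span_base) (auto simp: scarrier_Lmod u_def)
    have "ptensor v (delta hi) \<in> tensor_space (Lmod n p r) (Mmod a b)"
    proof (cases "p + r = 0")
      case True
      then have "v = 0" using T by (simp add: v_def)
      then have "ptensor v (delta hi) = 0" by (auto simp: ptensor_def fun_eq_iff)
      then show ?thesis unfolding tensor_space_def by (simp add: fs.span_zero)
    next
      case False
      then have "delta hi \<in> scarrier (Mmod a b)" using D0 by (auto simp: scarrier_Mmod delta_def)
      then show ?thesis
        unfolding tensor_space_def using T by (intro fs.span_base) (auto simp: scarrier_Lmod v_def)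
    qed
    then show "T \<in> tensor_space (Lmod n p r) (Mmod a b)"
      unfolding T_eq using 1 by (simp add: tensor_space_def fs.span_add)
  qed
qed

lemma Phi_bij:
  assumes D: "a + b = of_nat (p + r)"
  shows "bij_betw (\<Phi> n) (tensor_space (Lmod n p r) (Mmod a b)) (Joint n p r)"
proof -
  let ?T = "tensor_space (Lmod n p r) (Mmod a b)"
  have sub: "fs.subspace ?T" unfolding tensor_space_def by (rule fs.subspace_span)
  have "inj_on (\<Phi> n) ?T"
  proof (rule inj_onI)
    fix S T assume ST: "S \<in> ?T" "T \<in> ?T" and eq: "\<Phi> n S = \<Phi> n T"
    define X where "X = S - T"
    have X: "X \<in> ?T" unfolding X_def using sub ST by (rule fs.subspace_diff)
    have "\<Phi> n X = 0" unfolding X_def lin_rules(5)[OF lin_Phi] eq by simp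
    then have z: "(\<lambda>m. X (m, lo)) + Fop n False (eps n (\<lambda>m. X (m, hi))) = 0" by (simp only: \<Phi>_def)
    have X': "(\<forall>m s. s \<noteq> lo \<longrightarrow> s \<noteq> hi \<longrightarrow> X (m, s) = 0)" "(\<lambda>m. X (m, lo)) \<in> Low n p r" "(\<lambda>m. X (m, hi)) \<in> Low n p r"
      "p + r = 0 \<longrightarrow> (\<lambda>m. X (m, hi)) = 0"
      using X unfolding tensor_space_eq[OF D] by blast+
    have "(\<lambda>m. X (m, lo)) = 0" by (rule Low_F12_sum_zero(1)[OF X'(2) Low_eps[OF X'(3)] z])
    moreover have "(\<lambda>m. X (m, hi)) = 0"
    proof (cases "p + r = 0")
      case False
      have "eps n (\<lambda>m. X (m, hi)) = 0" by (rule Low_F12_sum_zero(2)[OF X'(2) Low_eps[OF X'(3)] z False])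
      then have "eps n (eps n (\<lambda>m. X (m, hi))) = 0" using lin_rules(3)[OF lin_eps] by simp
      then show ?thesis by simp
    qed (use X' in simp)
    ultimately have "X (m, s) = 0" for m s
      using X'(1) by (cases "s = lo"; cases "s = hi") (auto dest: fun_cong)
    then have "X = 0" by (auto simp: fun_eq_iff)
    then show "S = T" by (simp add: X_def)
  qed
  moreover have "\<Phi> n ` ?T = Joint n p r"
  proof (intro equalityI subsetI)
    fix w assume "w \<in> \<Phi> n ` ?T"
    then obtain T where "T \<in> ?T" "w = \<Phi> n T" by blast
    then show "w \<in> Joint n p r" unfolding tensor_space_eq[OF D] \<Phi>_def Joint_def using Low_eps by blast
  next
    fix w assume "w \<in> Joint n p r"
    then obtain u v where w: "w = u + Fop n False v" "u \<in> Low n p r" "v \<in> Low n p r" unfolding Joint_def by blast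
    \<comment> \<open>For \<open>p + r = 0\<close> the component at \<open>hi\<close> is absent, but
      then \<open>r = 0\<close> and \<open>F12\<close> kills \<open>v\<close>, so that
      \<open>v\<close> can be replaced by 0.\<close>
    define v' where "v' = (if p + r = 0 then 0 else v)"
    have v': "v' \<in> Low n p r" "Fop n False v' = Fop n False v"
      using w fs.subspace_0[OF subspace_Low, of n p r] F12_Low_zero[of v n p] by (auto simp: v'_def DF_lins)
    define T where "T = (\<lambda>(m, s). if s = lo then u m else if s = hi then eps n v' m else 0)"
    have T: "(\<lambda>m. T (m, lo)) = u" "(\<lambda>m. T (m, hi)) = eps n v'" by (auto simp: T_def)
    have "p + r = 0 \<longrightarrow> eps n v' = 0" by (auto simp: v'_def lin_rules(3)[OF lin_eps])
    moreover have "\<forall>m s. s \<noteq> lo \<longrightarrow> s \<noteq> hi \<longrightarrow> T (m, s) = 0" by (auto simp: T_def)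
    ultimately have "T \<in> ?T" unfolding tensor_space_eq[OF D] mem_Collect_eq T using w(2) Low_eps[OF v'(1)] by blast
    moreover have "\<Phi> n T = w" unfolding \<Phi>_def T w(1) eps_eps v'(2) ..
    ultimately show "w \<in> \<Phi> n ` ?T" by blast
  qed
  ultimately show ?thesis by (simp add: bij_betw_def)
qed

text \<open>Passing \<open>F12\<close> and passing the parity involution each contribute the sign of
  the parity of the element of spo(2n|1), and the two signs cancel.\<close>

lemma spo_act_F12_eps:
  assumes "X \<in> spo n"
  shows "spo_act n X (Fop n False (eps n u)) = Fop n False (eps n (spo_act n X u))"
proof -
  have "spoX n k l (Fop n False (eps n u)) = Fop n False (eps n (spoX n k l u))" if kl: "k \<in> idx n" "l \<in> idx n" for k l
  proof -
    have "eps n (spoX n k l u) = koszul True (spo_par n k \<noteq> spo_par n l) \<odot> spoX n k l (eps n u)"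
      by (rule eps_intertwine[OF lin_spoX]) (rule spoX_hpar_shift[OF kl])
    then show ?thesis by (simp add: DF_lins Fop_spoX[OF kl]) (simp add: koszul_def)
  qed
  then show ?thesis
    unfolding spo_act_spoX_spo[OF assms] lin_rules(2)[OF lin_eps] lin_rules(6)[OF lin_eps] DF_lins
    by (simp cong: sum.cong)
qed

lemma F11_F22_eigen:
  assumes "\<And>s. f s \<noteq> 0 \<Longrightarrow> bdeg n False s = p \<and> bdeg n True s = r"
  shows "F11 n f = (of_nat p + (2 * of_nat n - 1) / 2) \<odot> f" "F22 n f = (of_nat r - (2 * of_nat n - 1) / 2) \<odot> f"
  by (rule ext, use assms in \<open>fastforce simp: F11_apply F22_apply fscale_def simp del: split_paired_All\<close>)+

lemma Phi_gl11:
  assumes u: "u \<in> Low n p r" "u \<in> SE_part n c" and v: "v \<in> scarrier (Mmod a b)"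
    and Y: "homogeneous gl11_par q Y"
    and a: "a = of_nat p + (2 * of_nat n - 1) / 2" and b: "b = of_nat r - (2 * of_nat n - 1) / 2"
  shows "gl11_act n Y (\<Phi> n (ptensor u v)) = koszul q c \<odot> \<Phi> n (ptensor u (act (Mmod a b) Y v))"
proof -
  have D: "a + b = of_nat (p + r)" by (simp add: a b)
  have D0: "a + b = 0 \<longleftrightarrow> p + r = 0" unfolding D of_nat_eq_0_iff ..
  \<comment> \<open>\<open>F12 u\<close> and \<open>F21 w\<close> agree with \<open>w\<close> and
    \<open>(a + b) u\<close> up to the sign given by the parity of \<open>u\<close>, which is the
    Koszul sign demanded when an odd \<open>Y\<close> passes \<open>u\<close>.\<close>
  define w where "w = Fop n False (eps n u)"
  have eu: "eps n u \<in> Low n p r" by (rule Low_eps[OF u(1)])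
  have v1: "v hi = 0" if "a + b = 0" using v that unfolding scarrier_Mmod using lo_hi by blast
  have w0: "w = 0" if "a + b = 0" using that D0 F12_Low_zero eu by (auto simp: w_def)
  have eps: "eps n u = koszul True c \<odot> u" by (rule eps_SE_part[OF u(2)])
  have Fu: "F11 n u = a \<odot> u" "F22 n u = b \<odot> u" "F21 n u = 0" "F12 n u = koszul True c \<odot> w"
    using F11_F22_eigen[of u n p r] Low_D[OF u(1)]
    by (simp_all add: a b F21_eq F12_eq w_def eps DF_lins koszul_def)
  have Fw: "F11 n w = (a + 1) \<odot> w" "F22 n w = (b - 1) \<odot> w" "F12 n w = 0" "F21 n w = (a + b) \<odot> koszul True c \<odot> u"
  proof -
    have w: "bdeg n False s = p + 1 \<and> bdeg n True s = r - 1 \<and> r \<ge> 1" if "w s \<noteq> 0" for s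
      using F12_bdeg[OF eu that[unfolded w_def]] by simp
    show "F11 n w = (a + 1) \<odot> w" using F11_F22_eigen(1)[of w n "p+1" "r-1"] w by (simp add: a add_ac)
    show "F22 n w = (b - 1) \<odot> w"
    proof (cases "r \<ge> 1")
      case True
      then show ?thesis using F11_F22_eigen(2)[of w n "p+1" "r-1"] w by (simp add: b of_nat_diff algebra_simps)
    next
      case False
      then have "w = 0" using w by (auto simp: fun_eq_iff)
      then show ?thesis by (simp add: F22_def lins)
    qed
    show "F12 n w = 0" by (simp add: F12_eq w_def Fop_square)
    show "F21 n w = (a + b) \<odot> koszul True c \<odot> u"
      unfolding F21_eq w_def D using F21_F12_Low[OF eu] unfolding eps .
  qed
  have lin: "lin (F11 n)" "lin (F12 n)" "lin (F21 n)" "lin (F22 n)"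
  proof -
    have "F12 n = Fop n False" "F21 n = Fop n True" by (auto simp: F12_eq F21_eq fun_eq_iff)
    then show "lin (F12 n)" "lin (F21 n)" by (simp_all add: lin_Fop)
    show "lin (F11 n)" "lin (F22 n)"
      by (intro linI; rule ext; simp add: F11_apply F22_apply fscale_def distrib_left mult.left_commute)+
  qed
  have P: "\<Phi> n (ptensor u v') = v' lo \<odot> u + v' hi \<odot> w" for v' unfolding Phi_ptensor w_def ..
  have act_lo: "act (Mmod a b) Y v lo = (Y (1, 1) * a + Y (2, 2) * b) * v lo + (a + b) * Y (2, 1) * v hi"
    by (simp add: Mmod_def)
  have act_hi: "act (Mmod a b) Y v hi = (if a + b = 0 then 0 else (Y (1, 1) * (a + 1) + Y (2, 2) * (b - 1)) * v hi + Y (1, 2) * v lo)"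
    by (simp add: Mmod_def)
  have F: "F11 n (x \<odot> u + y \<odot> w) = (x * a) \<odot> u + (y * (a + 1)) \<odot> w"
    "F22 n (x \<odot> u + y \<odot> w) = (x * b) \<odot> u + (y * (b - 1)) \<odot> w"
    "F12 n (x \<odot> u + y \<odot> w) = (x * koszul True c) \<odot> w"
    "F21 n (x \<odot> u + y \<odot> w) = (y * (a + b) * koszul True c) \<odot> u" for x y
    by (simp_all add: lin_rules(1,2)[OF lin(1)] lin_rules(1,2)[OF lin(2)] lin_rules(1,2)[OF lin(3)] lin_rules(1,2)[OF lin(4)] Fu Fw mult.assoc)
  have Y0: "Y (1, 2) = 0" "Y (2, 1) = 0" if "\<not> q"
    using Y that unfolding homogeneous_def gl11_par_def by force+
  have Y1: "Y (1, 1) = 0" "Y (2, 2) = 0" if q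
    using Y that unfolding homogeneous_def by force+
  show ?thesis
    unfolding gl11_act_def P F act_lo act_hi
    using Y0 Y1 v1 w0
    by (cases q; cases "a + b = 0")
      (simp_all add: fscale_simps koszul_def fs.scale_minus_left algebra_simps)
qed

lemma Phi_parity:
  assumes u: "u \<in> SE_part n p" and v: "v \<in> part (Mmod a b) q"
  shows "\<Phi> n (ptensor u v) \<in> SE_part n (p \<noteq> q)"
proof (cases q)
  case False
  then have "v hi = 0" using v lo_hi unfolding Mmod_def by auto
  then show ?thesis using False u by (simp add: Phi_ptensor fs.subspace_scale[OF subspace_SE_part])
next
  case True
  then have v0: "v lo = 0" using v lo_hi unfolding Mmod_def by auto
  have "hpar n s = (\<not> p)" if "Fop n False u s \<noteq> 0" for s
    using Fop_hpar_shift[OF that] u unfolding SE_part_iff by auto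
  then have "Fop n False u \<in> SE_part n (\<not> p)"
    using u SE_Fop unfolding SE_part_iff by blast
  moreover have "Fop n False (eps n u) = koszul True p \<odot> Fop n False u"
    by (simp add: eps_SE_part[OF u] DF_lins)
  ultimately show ?thesis using True v0 by (simp add: Phi_ptensor fs.subspace_scale[OF subspace_SE_part])
qed

lemma joint_iso_Joint:
  assumes a: "a = of_nat p + (2 * of_nat n - 1) / 2" and b: "b = of_nat r - (2 * of_nat n - 1) / 2"
  shows "joint_iso n (Lmod n p r) (Mmod a b) (Joint n p r) (\<Phi> n)"
  unfolding joint_iso_def
proof (intro conjI allI ballI impI)
  show "linear_on (tensor_space (Lmod n p r) (Mmod a b)) (\<Phi> n)"
    using lin_rules(1,2)[OF lin_Phi] by (simp add: linear_on_def)
  show "bij_betw (\<Phi> n) (tensor_space (Lmod n p r) (Mmod a b)) (Joint n p r)"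
    by (rule Phi_bij) (simp add: a b)
next
  fix c q u v assume u: "u \<in> part (Lmod n p r) c" and v: "v \<in> part (Mmod a b) q"
  have u': "u \<in> Low n p r" "u \<in> SE_part n c" using u by (simp_all add: Lmod_def)
  show "\<Phi> n (ptensor u v) \<in> SE_part n (c \<noteq> q)" using u'(2) v by (rule Phi_parity)
  show "spo_act n X (\<Phi> n (ptensor u v)) = \<Phi> n (ptensor (act (Lmod n p r) X u) v)" if X: "X \<in> spo n" for X
    unfolding Phi_ptensor lin_rules(1,2)[OF lin_spo_act] spo_act_F12_eps[OF X] by (simp add: Lmod_def)
  have "fs.subspace (part (Mmod a b) q)" for q
    unfolding Mmod_def by (simp add: subspace_supported del: split_paired_All)
  then have "0 \<in> part (Mmod a b) q" for q by (rule fs.subspace_0)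
  then have "v \<in> scarrier (Mmod a b)"
    using v unfolding scarrier_def by (cases q) (auto intro: exI[of _ v] exI[of _ 0])
  then show "gl11_act n Y (\<Phi> n (ptensor u v)) = koszul t c \<odot> \<Phi> n (ptensor u (act (Mmod a b) Y v))"
    if "homogeneous gl11_par t Y" for t Y
    using Phi_gl11[OF u' _ that a b] by blast
qed

subsection \<open>The decomposition\<close>

lemma SE_inv_eq: "SE_inv n = {f \<in> SE n. Dop n False f = 0 \<and> Dop n True f = 0}"
  by (simp add: SE_inv_def D12_eq D22_eq)

lemma subspace_SE_inv: "fs.subspace (SE_inv n)"
proof -
  have ker: "fs.subspace {f. T f = 0}" if "lin T" for T :: "spoly \<Rightarrow> spoly"
    using that by (auto simp: fs.subspace_def lin_rules)
  have "SE_inv n = SE n \<inter> {f. Dop n False f = 0} \<inter> {f. Dop n True f = 0}" by (auto simp: SE_inv_eq)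
  then show ?thesis by (simp only:) (intro fs.subspace_inter subspace_SE ker lin_Dop)
qed

lemma Low_subset_SE_inv: "Low n p r \<subseteq> SE_inv n"
  by (auto simp: Low_def SE_inv_eq)

lemma SE_inv_Fop:
  assumes "f \<in> SE_inv n"
  shows "Fop n a f \<in> SE_inv n"
proof -
  have f: "f \<in> SE n" "Dop n False f = 0" "Dop n True f = 0" using assms by (simp_all add: SE_inv_eq)
  have "Dop n False (Fop n a f) = 0 \<and> Dop n True (Fop n a f) = 0"
    by (cases a) (simp_all add: D12_F12 D22_F12 D12_F21 D22_F21 f DF_lins)
  then show ?thesis using SE_Fop[OF f(1)] by (simp add: SE_inv_eq)
qed

lemma subspace_Joint: "fs.subspace (Joint n p r)"
  unfolding fs.subspace_def
proof (intro conjI ballI allI)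
  have "0 = 0 + Fop n False 0" by (simp add: DF_lins)
  then show "0 \<in> Joint n p r" unfolding Joint_def using fs.subspace_0[OF subspace_Low] by blast
next
  fix x y assume "x \<in> Joint n p r" "y \<in> Joint n p r"
  then obtain u v u' v' where "x = u + Fop n False v" "y = u' + Fop n False v'" "u \<in> Low n p r" "v \<in> Low n p r" "u' \<in> Low n p r" "v' \<in> Low n p r"
    unfolding Joint_def by blast
  then have "x + y = (u + u') + Fop n False (v + v')" "u + u' \<in> Low n p r" "v + v' \<in> Low n p r"
    by (simp_all add: DF_lins add_ac fs.subspace_add[OF subspace_Low])
  then show "x + y \<in> Joint n p r" unfolding Joint_def by blast
next
  fix c x assume "x \<in> Joint n p r"
  then obtain u v where "x = u + Fop n False v" "u \<in> Low n p r" "v \<in> Low n p r" unfolding Joint_def by blast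
  then have "c \<odot> x = c \<odot> u + Fop n False (c \<odot> v)" "c \<odot> u \<in> Low n p r" "c \<odot> v \<in> Low n p r"
    by (simp_all add: DF_lins fs.scale_right_distrib fs.subspace_scale[OF subspace_Low])
  then show "c \<odot> x \<in> Joint n p r" unfolding Joint_def by blast
qed

lemma Joint_subset_SE_inv: "Joint n p r \<subseteq> SE_inv n"
  unfolding Joint_def using Low_subset_SE_inv SE_inv_Fop fs.subspace_add[OF subspace_SE_inv] by blast

text \<open>The bidegree of the gl(1|1)-lowest vectors. Its first entry is \<open>d\<close> rather
  than \<open>d + 1\<close>, since one unit of the first coordinate of the weight stems from
  \<open>eta_1\<close>; \<open>Sum_low\<close> and \<open>Sum_high\<close> are exchanged by
  \<open>r -> 2*n+1-r\<close>.\<close>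

fun bidegree :: "nat \<Rightarrow> summand \<Rightarrow> nat \<times> nat"
  where
    "bidegree n Sum_const = (0, 0)"
  | "bidegree n Sum_top = (0, 2*n+1)"
  | "bidegree n (Sum_low d k) = (d, k)"
  | "bidegree n (Sum_high d k) = (d, 2*n+1-k)"

definition summand_space :: "nat \<Rightarrow> summand \<Rightarrow> spoly set"
  where "summand_space n i = Joint n (fst (bidegree n i)) (snd (bidegree n i))"

lemma bidegree_inj: "inj_on (bidegree n) (summands n)"
  by (rule inj_onI) (auto simp: summands_def)

lemma bidegree_surj:
  assumes "admissible n p r"
  shows "\<exists>i\<in>summands n. bidegree n i = (p, r)"
proof -
  consider "p = 0" "r = 0" | "p = 0" "r = 2*n+1" | "r \<in> {1..n}" | "2*n+1-r \<in> {1..n}" "2*n+1-(2*n+1-r) = r"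
    using assms unfolding admissible_def by force
  then show ?thesis
  proof cases
    case 1 then show ?thesis by (intro bexI[of _ Sum_const]) (auto simp: summands_def)
  next
    case 2 then show ?thesis by (intro bexI[of _ Sum_top]) (auto simp: summands_def)
  next
    case 3 then show ?thesis by (intro bexI[of _ "Sum_low p r"]) (auto simp: summands_def)
  next
    case 4 then show ?thesis by (intro bexI[of _ "Sum_high p (2*n+1-r)"]) (auto simp: summands_def)
  qed
qed

lemma Joint_in_span:
  assumes n: "n \<ge> 1"
  shows "Joint n p r \<subseteq> fs.span (\<Union>i\<in>summands n. summand_space n i)"
proof (cases "admissible n p r")
  case True
  then obtain i where "i \<in> summands n" "bidegree n i = (p, r)" using bidegree_surj by blast
  then have "Joint n p r \<subseteq> (\<Union>i\<in>summands n. summand_space n i)" by (force simp: summand_space_def)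
  then show ?thesis using fs.span_superset by blast
next
  case False
  then have "Low n p r = {0}" by (rule Low_not_admissible[OF n])
  then have "Joint n p r = {0}" by (simp add: Joint_def DF_lins)
  then show ?thesis by (simp add: fs.span_zero)
qed

text \<open>Dividing the anticommutator by the total degree gives
  \<open>f = (F21 F12 f + F12 F21 f) / (p + r)\<close>. The first term lies in
  \<open>Low n p r\<close>, and \<open>F21 f\<close> lies in \<open>Low\<close> of the neighbouring
  bidegree. Total degree zero is treated apart: there \<open>F21 f = 0\<close>.\<close>

lemma bihomogeneous_in_span:
  assumes n: "n \<ge> 1" and f: "f \<in> SE_inv n" and deg: "\<And>s. f s \<noteq> 0 \<Longrightarrow> bdeg n False s = p \<and> bdeg n True s = r"
  shows "f \<in> fs.span (\<Union>i\<in>summands n. summand_space n i)" (is "f \<in> ?S")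
proof -
  have LLI: "g \<in> Low n p' r'" if "g \<in> SE_inv n" "Fop n True g = 0" "\<And>s. g s \<noteq> 0 \<Longrightarrow> bdeg n False s = p' \<and> bdeg n True s = r'"
    for g p' r' using that by (simp add: Low_def SE_inv_eq del: split_paired_All)
  have LS: "g \<in> ?S" "Fop n False g \<in> ?S" if g: "g \<in> Low n p' r'" for g p' r'
  proof -
    have 0: "0 \<in> Low n p' r'" by (rule fs.subspace_0[OF subspace_Low])
    have "g = g + Fop n False 0" "Fop n False g = 0 + Fop n False g" by (simp_all add: DF_lins)
    then have "g \<in> Joint n p' r'" "Fop n False g \<in> Joint n p' r'" unfolding Joint_def using g 0 by blast+
    then show "g \<in> ?S" "Fop n False g \<in> ?S" using Joint_in_span[OF n] by blast+
  qed
  have F21_deg: "bdeg n False s + 1 = p \<and> bdeg n True s = r + 1" if "Fop n True f s \<noteq> 0" for s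
    using that by (rule Fop_supp) (use deg in auto)
  \<comment> \<open>By \<open>F21_deg\<close> a nonzero coefficient forces \<open>p >= 1\<close>, so
    the truncated subtraction is exact where it matters.\<close>
  have "bdeg n False s = p - 1 \<and> bdeg n True s = r + 1" if "Fop n True f s \<noteq> 0" for s
    using F21_deg[OF that] by linarith
  then have 1: "Fop n False (Fop n True f) \<in> ?S"
    by (rule LS(2)[OF LLI[OF SE_inv_Fop[OF f] Fop_square]])
  show ?thesis
  proof (cases "p + r = 0")
    case True
    then have "Fop n True f s = 0" for s using F21_deg[of s] by auto
    then have "Fop n True f = 0" by (auto simp: fun_eq_iff)
    then show ?thesis using LS(1)[OF LLI[OF f _ deg]] by blast
  next
    case False
    have F12_deg: "bdeg n False s = p + 1 \<and> bdeg n True s + 1 = r" if "Fop n False f s \<noteq> 0" for s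
      using that by (rule Fop_supp) (use deg in auto)
    have "bdeg n False s = p \<and> bdeg n True s = r" if "Fop n True (Fop n False f) s \<noteq> 0" for s
      using that by (rule Fop_supp) (use F12_deg in force)
    then have 2: "Fop n True (Fop n False f) \<in> ?S"
      by (rule LS(1)[OF LLI[OF SE_inv_Fop[OF SE_inv_Fop[OF f]] Fop_square]])
    have "Fop n True (Fop n False f) + Fop n False (Fop n True f) = of_nat (p + r) \<odot> f"
      using Fop_Fop[of n True f] sum_glE_bdeg[of f n p r] deg by simp
    then have "of_nat (p + r) \<odot> f \<in> ?S" using fs.span_add[OF 2 1] by simp
    then have "(1 / of_nat (p + r)) \<odot> of_nat (p + r) \<odot> f \<in> ?S" by (rule fs.span_scale)
    moreover have "of_nat (p + r) \<noteq> (0 :: complex)" using False by (simp only: of_nat_eq_0_iff not_False_eq_True)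
    ultimately show ?thesis by simp
  qed
qed

lemma SE_inv_span:
  assumes n: "n \<ge> 1"
  shows "SE_inv n = fs.span (\<Union>i\<in>summands n. summand_space n i)" (is "_ = ?S")
proof
  show "?S \<subseteq> SE_inv n"
    using Joint_subset_SE_inv by (intro fs.span_minimal subspace_SE_inv) (force simp: summand_space_def)
  show "SE_inv n \<subseteq> ?S"
  proof
    fix f assume f: "f \<in> SE_inv n"
    define \<gamma> where "\<gamma> s = (bdeg n False s, bdeg n True s)" for s
    have "graded_part \<gamma> x f \<in> ?S" for x
    proof (rule bihomogeneous_in_span[OF n, of _ "fst x" "snd x"])
      have "Dop n a (graded_part \<gamma> x f) = 0" for a
      \<comment> \<open>\<open>Dop n a\<close> removes one variable of flag \<open>a\<close> and one
        of flag \<open>True\<close>; \<open>\<phi>\<close> adds them back to find the degree of the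
        input.\<close>
      proof (rule graded_part_kernel[OF lin_Dop, where \<phi> = "\<lambda>(i, j). (i + of_bool (False = a), j + of_bool (True = a) + 1)" and \<gamma>' = \<gamma>])
        show "\<exists>s'. g s' \<noteq> 0 \<and> \<gamma> s' = (case \<gamma> s of (i, j) \<Rightarrow> (i + of_bool (False = a), j + of_bool (True = a) + 1))"
          if "Dop n a g s \<noteq> 0" for g s
          using that
        proof (rule Dop_supp)
          fix s' assume s': "g s' \<noteq> 0" and b: "\<And>b. bdeg n b s' = bdeg n b s + of_bool (b = a) + of_bool b"
          show ?thesis using s' b[of False] b[of True] by (auto simp: \<gamma>_def)
        qed
        show "Dop n a f = 0" using f by (cases a) (simp_all add: SE_inv_eq)
      qed
      then show "graded_part \<gamma> x f \<in> SE_inv n" using f SE_graded_part[of f n \<gamma> x] by (simp add: SE_inv_eq)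
      show "bdeg n False s = fst x \<and> bdeg n True s = snd x" if "graded_part \<gamma> x f s \<noteq> 0" for s
        using that by (auto simp: graded_part_def \<gamma>_def split: if_splits)
    qed
    moreover have "finite {s. f s \<noteq> 0}" using f by (simp add: SE_inv_eq SE_def)
    ultimately have "finite {s. f s \<noteq> 0}" "(\<Sum>x\<in>\<gamma> ` {s. f s \<noteq> 0}. graded_part \<gamma> x f) \<in> ?S"
      by (simp_all only: fs.span_sum)
    then show "f \<in> ?S" by (simp only: graded_part_sum[of f \<gamma>, symmetric])
  qed
qed

lemma independent_degrees:
  fixes g :: "'i \<Rightarrow> 'a \<Rightarrow> complex"
  assumes "finite J" "inj_on d J" and deg: "\<And>i s. i \<in> J \<Longrightarrow> g i s \<noteq> 0 \<Longrightarrow> \<gamma> s = d i"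
    and z: "(\<Sum>i\<in>J. g i) = 0" and i: "i \<in> J"
  shows "g i = 0"
proof (rule ccontr)
  assume "g i \<noteq> 0"
  then obtain s where s: "g i s \<noteq> 0" by (metis ext zero_fun_apply)
  have "g j s = 0" if "j \<in> J" "j \<noteq> i" for j
    using deg[OF that(1)] deg[OF i s] \<open>inj_on d J\<close> that i by (metis inj_onD)
  then have "(\<Sum>j\<in>J. g j s) = (\<Sum>j\<in>J. if j = i then g i s else 0)" by (intro sum.cong) auto
  also have "\<dots> = g i s" using i \<open>finite J\<close> by simp
  finally have "(\<Sum>j\<in>J. g j) s = g i s" by (simp add: sum_fun_apply)
  then show False using z s by simp
qed

text \<open>A summand has components of bidegree \<open>(p, r)\<close> and
  \<open>(p + 1, r - 1)\<close>, so different summands can share a bidegree. Applying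
  \<open>F21\<close> first kills the lowest parts and leaves multiples of the \<open>v i\<close>,
  which have distinct bidegrees and vanish. What remains of each \<open>w i\<close> is lowest, again
  with distinct bidegrees.\<close>

lemma summand_independent:
  assumes J: "finite J" "J \<subseteq> summands n" and w: "\<And>i. i \<in> J \<Longrightarrow> w i \<in> summand_space n i"
    and z: "(\<Sum>i\<in>J. w i) = 0" and i: "i \<in> J"
  shows "w i = 0"
proof -
  define P R where "P i = fst (bidegree n i)" and "R i = snd (bidegree n i)" for i
  have "\<forall>i\<in>J. \<exists>u v. w i = u + Fop n False v \<and> u \<in> Low n (P i) (R i) \<and> v \<in> Low n (P i) (R i)"
    using w by (auto simp: summand_space_def Joint_def P_def R_def)
  then obtain u v where uv: "\<And>i. i \<in> J \<Longrightarrow> w i = u i + Fop n False (v i)"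
    "\<And>i. i \<in> J \<Longrightarrow> u i \<in> Low n (P i) (R i)" "\<And>i. i \<in> J \<Longrightarrow> v i \<in> Low n (P i) (R i)"
    by metis
  have inj: "inj_on (bidegree n) J" using bidegree_inj J inj_on_subset by blast
  define \<gamma> where "\<gamma> s = (bdeg n False s, bdeg n True s)" for s
  have deg: "\<gamma> s = bidegree n i" if "i \<in> J" "g \<in> Low n (P i) (R i)" "g s \<noteq> 0" for i g s
    using Low_D(5,6)[OF that(2,3)] by (simp add: \<gamma>_def P_def R_def)
  have FTw: "Fop n True (w i) = of_nat (P i + R i) \<odot> v i" if "i \<in> J" for i
    using uv(1)[OF that] Low_D(4)[OF uv(2)[OF that]] F21_F12_Low[OF uv(3)[OF that]] by (simp add: DF_lins)
  have "(\<Sum>i\<in>J. of_nat (P i + R i) \<odot> v i) = Fop n True (\<Sum>i\<in>J. w i)"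
    unfolding lin_rules(6)[OF lin_Fop] using FTw by (intro sum.cong) auto
  then have "(\<Sum>i\<in>J. of_nat (P i + R i) \<odot> v i) = 0" using z by (simp add: DF_lins)
  moreover have "\<gamma> s = bidegree n i" if "i \<in> J" "(of_nat (P i + R i) \<odot> v i) s \<noteq> 0" for i s
    by (rule deg[OF that(1) uv(3)[OF that(1)]]) (use that(2) in \<open>auto simp: fscale_def\<close>)
  ultimately have v0: "of_nat (P i + R i) \<odot> v i = 0" if "i \<in> J" for i
    using independent_degrees[OF J(1) inj, of "\<lambda>i. of_nat (P i + R i) \<odot> v i" \<gamma>] that by blast
  have F0: "Fop n False (v i) = 0" if "i \<in> J" for i
  proof (cases "P i + R i = 0")
    case True
    then show ?thesis using F12_Low_zero[of "v i" n "P i"] uv(3)[OF that] by simp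
  next
    case False
    then have "of_nat (P i + R i) \<noteq> (0 :: complex)" unfolding of_nat_eq_0_iff .
    then have "v i = 0" using v0[OF that] by (metis fs.scale_eq_0_iff)
    then show ?thesis by (simp add: DF_lins)
  qed
  then have wu: "w i = u i" if "i \<in> J" for i using uv(1)[OF that] that by simp
  have "\<gamma> s = bidegree n i" if "i \<in> J" "w i s \<noteq> 0" for i s
    by (rule deg[OF that(1) uv(2)[OF that(1)]]) (use that(2) wu[OF that(1)] in simp)
  then show ?thesis using independent_degrees[OF J(1) inj, of w \<gamma>] z i by blast
qed

lemma direct_sum:
  assumes "n \<ge> 1"
  shows "is_direct_sum (SE_inv n) (summands n) (summand_space n)"
  unfolding is_direct_sum_def
proof (intro conjI ballI allI impI)
  show "fs.subspace (summand_space n i)" for i unfolding summand_space_def by (rule subspace_Joint)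
  show "SE_inv n = fs.span (\<Union>i\<in>summands n. summand_space n i)" by (rule SE_inv_span[OF assms])
  fix J w i
  assume "finite J" "J \<subseteq> summands n" "\<forall>i\<in>J. w i \<in> summand_space n i" "(\<Sum>i\<in>J. w i) = 0" "i \<in> J"
  then show "w i = 0" by (intro summand_independent[of J n w i]) blast+
qed

lemma summand_is_V_tensor_V:
  assumes n: "n \<ge> 1" and a: "admissible n p r" and w: "length w = n"
    "\<And>i. i \<in> {1..n} \<Longrightarrow> w ! (i - 1) = (if i = 1 then of_nat p else 0) + of_bool (i \<le> rbar n r)"
    and \<mu>: "\<mu> = (of_nat p + (2 * of_nat n - 1) / 2 + of_bool (p + r \<noteq> 0), of_nat r - (2 * of_nat n - 1) / 2 - of_bool (p + r \<noteq> 0))"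
  shows "is_V_tensor_V n w \<mu> (Joint n p r)"
proof -
  define x y :: complex where "x = of_nat p + (2 * of_nat n - 1) / 2" and "y = of_nat r - (2 * of_nat n - 1) / 2"
  have xy: "x + y = of_nat (p + r)" by (simp add: x_def y_def)
  have "is_V_gl11 \<mu> (Mmod x y)"
  proof (cases "p + r = 0")
    case True
    then have "x + y = 0" unfolding xy by simp
    then show ?thesis using Mmod_is_V_gl11(2)[of x y] True by (simp add: \<mu> x_def y_def)
  next
    case False
    then have "x + y \<noteq> 0" unfolding xy of_nat_eq_0_iff .
    then show ?thesis using Mmod_is_V_gl11(1)[of x y] False by (simp add: \<mu> x_def y_def)
  qed
  then show ?thesis
    unfolding is_V_tensor_V_def using Lmod_is_V_spo[OF n a w] joint_iso_Joint[OF x_def y_def] by blast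
qed

theorem theorem6p8:
  fixes n :: nat and \<alpha> :: complex
  assumes "n \<ge> 1" and "\<alpha> = (2 * of_nat n - 1) / 2"
  shows "\<exists>W :: summand \<Rightarrow> spoly set.
    is_direct_sum (SE_inv n) (summands n) W \<and>
    is_V_tensor_V n (replicate n 0) (\<alpha>, - \<alpha>) (W Sum_const) \<and>
    is_V_tensor_V n (replicate n 0) (1 + \<alpha>, 2 * of_nat n - \<alpha>) (W Sum_top) \<and>
    (\<forall>d. \<forall>k\<in>{1..n}.
      is_V_tensor_V n (of_nat (d + 1) # replicate (k - 1) 1 @ replicate (n - k) 0)
        (of_nat d + 1 + \<alpha>, of_nat k - 1 - \<alpha>) (W (Sum_low d k)) \<and>
      is_V_tensor_V n (of_nat (d + 1) # replicate (k - 1) 1 @ replicate (n - k) 0)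
        (of_nat d + 1 + \<alpha>, 2 * of_nat n - of_nat k - \<alpha>) (W (Sum_high d k)))"
proof (intro exI[of _ "summand_space n"] conjI allI ballI)
  show "is_direct_sum (SE_inv n) (summands n) (summand_space n)" by (rule direct_sum[OF assms(1)])
  show "is_V_tensor_V n (replicate n 0) (\<alpha>, - \<alpha>) (summand_space n Sum_const)"
    unfolding summand_space_def bidegree.simps fst_conv snd_conv
    by (rule summand_is_V_tensor_V[OF assms(1)]) (auto simp: admissible_def rbar_def assms(2))
  show "is_V_tensor_V n (replicate n 0) (1 + \<alpha>, 2 * of_nat n - \<alpha>) (summand_space n Sum_top)"
    unfolding summand_space_def bidegree.simps fst_conv snd_conv
    by (rule summand_is_V_tensor_V[OF assms(1)]) (auto simp: admissible_def rbar_def assms(2))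
next
  fix d k assume k: "k \<in> {1..n}"
  have w: "length (of_nat (d + 1) # replicate (k - 1) 1 @ replicate (n - k) 0 :: complex list) = n"
    "\<And>i. i \<in> {1..n} \<Longrightarrow> (of_nat (d + 1) # replicate (k - 1) 1 @ replicate (n - k) 0 :: complex list) ! (i - 1)
      = (if i = 1 then of_nat d else 0) + of_bool (i \<le> k)"
    using k by (auto simp: nth_Cons' nth_append)
  \<comment> \<open>Both bidegrees fold to \<open>k\<close>, hence the equal spo-weights of the two
    summands.\<close>
  have rbar: "rbar n k = k" "rbar n (2*n+1-k) = k" using k by (auto simp: rbar_def)
  have adm: "admissible n d k" "admissible n d (2*n+1-k)" using k by (auto simp: admissible_def)
  show "is_V_tensor_V n (of_nat (d + 1) # replicate (k - 1) 1 @ replicate (n - k) 0)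
        (of_nat d + 1 + \<alpha>, of_nat k - 1 - \<alpha>) (summand_space n (Sum_low d k))"
    unfolding summand_space_def bidegree.simps fst_conv snd_conv
  proof (rule summand_is_V_tensor_V[OF assms(1) adm(1) w(1)], unfold rbar, rule w(2))
    show "(of_nat d + 1 + \<alpha>, of_nat k - 1 - \<alpha>) =
      (of_nat d + (2 * of_nat n - 1) / 2 + of_bool (d + k \<noteq> 0), of_nat k - (2 * of_nat n - 1) / 2 - of_bool (d + k \<noteq> 0))"
      using k unfolding assms(2) by simp
  qed
  have "of_nat (2*n+1-k) = (2 * of_nat n + 1 - of_nat k :: complex)" using k by (simp add: of_nat_diff)
  then have \<mu>: "(of_nat d + 1 + \<alpha>, 2 * of_nat n - of_nat k - \<alpha>) =
      (of_nat d + (2 * of_nat n - 1) / 2 + of_bool (d + (2*n+1-k) \<noteq> 0),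
       of_nat (2*n+1-k) - (2 * of_nat n - 1) / 2 - of_bool (d + (2*n+1-k) \<noteq> 0))"
    using k unfolding assms(2) by simp
  show "is_V_tensor_V n (of_nat (d + 1) # replicate (k - 1) 1 @ replicate (n - k) 0)
        (of_nat d + 1 + \<alpha>, 2 * of_nat n - of_nat k - \<alpha>) (summand_space n (Sum_high d k))"
    unfolding summand_space_def bidegree.simps fst_conv snd_conv
    by (rule summand_is_V_tensor_V[OF assms(1) adm(2) w(1) _ \<mu>], unfold rbar, rule w(2))
qed

end
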